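(* A generalized $\beta$-conformal change $L\mapsto\overline L=f(e^{\sigma}L,\beta)$ is projective if and only if the vector $$\varphi_i:=L^2e^{\sigma}p\,\sigma_i-(pLe^{\sigma}l_i-q_0\beta\,m_i)\sigma_0+2qF_{0i}-q_0E_{00}m_i$$ vanishes.
   Context: $(M,L)$ is an $n$-dimensional smooth Finsler manifold; $\partial_i=\partial/\partial x^i$, $\dot\partial_i=\partial/\partial y^i$, $g_{ij}=\frac12\dot\partial_i\dot\partial_jL^2$, $l_i=\dot\partial_iL$, $y_i=g_{ij}y^j$. The canonical spray is $G^i=\frac12\gamma^i_{jk}y^jy^k$ with $\gamma^i_{jk}=\frac12g^{ir}(\partial_jg_{kr}+\partial_kg_{jr}-\partial_rg_{jk})$; $N^i_j=\dot\partial_jG^i$, $\delta_i=\partial_i-N^r_i\dot\partial_r$, $\Gamma^i_{jk}=\frac12g^{ir}(\delta_jg_{kr}+\delta_kg_{jr}-\delta_rg_{jk})$, and the horizontal covariant derivative of $b_i(x)$ is $b_{i|j}=\partial_jb_i-b_m\Gamma^m_{ij}$. A generalized $\beta$-conformal change is $L\mapsto\overline{L}=f(\widetilde L,\beta)$ with $\widetilde L=e^{\sigma(x)}L$, $\sigma$ a smooth function on $M$, $\beta=b_i(x)y^i$ a 1-form, and $f$ smooth and positively homogeneous of degree one in $(\widetilde L,\beta)$; it is assumed that $(M,\overline L)$ is a Finsler space. Subscripts $1,2$ on $f$ denote partial derivatives with respect to $\widetilde L,\beta$. Put $q=ff_2$, $p=ff_1/L$, $q_0=ff_{22}$, $m_i=b_i-(\beta/L^2)y_i$,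 $m^2=g^{ij}m_im_j$, $\sigma_i=\partial_i\sigma$, $\sigma_0=\sigma_iy^i$, $F_{ij}=\frac12(b_{i|j}-b_{j|i})$, $E_{ij}=\frac12(b_{i|j}+b_{j|i})$, $F_{0i}=F_{li}y^l$, $E_{00}=E_{ij}y^iy^j$. Standing assumptions at the points under consideration: $m_i\ne0$, $m^2\neq0$, $p\neq0$, $e^{\sigma}p+m^2q_0\neq0$. The change $L\mapsto\overline L$ is projective if every geodesic of $(M,L)$ is a geodesic of $(M,\overline L)$ and vice versa, where a geodesic of $(M,L)$ is a curve satisfying $\frac{dy^i}{dt}+2G^i=w\,y^i$, $y^i=\frac{dx^i}{dt}$, for some function $w$ (arbitrary parametrization allowed); equivalently, a curve satisfying $\partial_iL-\frac{d}{dt}(\dot\partial_iL)=0$. *)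

theory Defs
  imports "HOL-Analysis.Analysis"
begin

section \<open>Smooth functions on open subsets of normed spaces\<close>

primrec Ck_on :: "nat \<Rightarrow> 'a set \<Rightarrow> ('a::real_normed_vector \<Rightarrow> 'b::real_normed_vector) \<Rightarrow> bool" where
  "Ck_on 0 S f \<longleftrightarrow> continuous_on S f"
| "Ck_on (Suc k) S f \<longleftrightarrow>
     (\<forall>x\<in>S. f differentiable at x) \<and> (\<forall>v. Ck_on k S (\<lambda>x. frechet_derivative f (at x) v))"

definition smooth_on :: "'a set \<Rightarrow> ('a::real_normed_vector \<Rightarrow> 'b::real_normed_vector) \<Rightarrow> bool" where
  "smooth_on S f \<longleftrightarrow> (\<forall>k. Ck_on k S f)"


section \<open>Manifolds and tangent vectors\<close>

text \<open>A chart is a pair of its domain and its coordinate map; only the values of the coordinate map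
  on the domain matter. The manifold is the union of the chart domains. It is Hausdorff and second
  countable because the ambient type is taken in the corresponding type classes.\<close>

type_synonym ('m, 'n) chart = "'m set \<times> ('m \<Rightarrow> real ^ 'n)"

definition chart_inv :: "('m, 'n) chart \<Rightarrow> real ^ 'n \<Rightarrow> 'm" where
  "chart_inv c = inv_into (fst c) (snd c)"

definition chart_range :: "('m, 'n) chart \<Rightarrow> (real ^ 'n) set" where
  "chart_range c = snd c ` fst c"

definition transition :: "('m, 'n) chart \<Rightarrow> ('m, 'n) chart \<Rightarrow> real ^ 'n \<Rightarrow> real ^ 'n" where
  "transition c c' = snd c' \<circ> chart_inv c"

definition smooth_atlas ::
  "('m::{t2_space, second_countable_topology}, 'n::finite) chart set \<Rightarrow> bool" where
  "smooth_atlas \<A> \<longleftrightarrow>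
     (\<forall>c\<in>\<A>. open (fst c) \<and> open (chart_range c) \<and>
        homeomorphism (fst c) (chart_range c) (snd c) (chart_inv c)) \<and>
     (\<forall>c\<in>\<A>. \<forall>c'\<in>\<A>. smooth_on (snd c ` (fst c \<inter> fst c')) (transition c c'))"

definition manifold :: "('m, 'n) chart set \<Rightarrow> 'm set" where
  "manifold \<A> = (\<Union>c\<in>\<A>. fst c)"

text \<open>A tangent vector at \<open>p\<close> is the family of its coordinate vectors in the charts around \<open>p\<close>,
  related by the Jacobians of the transition maps; it is set to zero at all other charts, so that
  equality of tangent vectors is equality of functions.\<close>

type_synonym ('m, 'n) tvec = "('m, 'n) chart \<Rightarrow> real ^ 'n"

definition tangent_space :: "('m, 'n::finite) chart set \<Rightarrow> 'm \<Rightarrow> ('m, 'n) tvec set" where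
  "tangent_space \<A> p = {v.
     (\<forall>c\<in>\<A>. \<forall>c'\<in>\<A>. p \<in> fst c \<and> p \<in> fst c' \<longrightarrow>
        v c' = frechet_derivative (transition c c') (at (snd c p)) (v c)) \<and>
     (\<forall>c. c \<notin> \<A> \<or> p \<notin> fst c \<longrightarrow> v c = 0)}"

definition slit_tangent_bundle ::
  "('m, 'n::finite) chart set \<Rightarrow> ('m \<times> ('m, 'n) tvec) set" where
  "slit_tangent_bundle \<A> =
     {(p, v). p \<in> manifold \<A> \<and> v \<in> tangent_space \<A> p \<and> v \<noteq> (\<lambda>c. 0)}"

text \<open>The tangent vector at the point with coordinates \<open>x\<close> in the chart \<open>c\<close> that has
  components \<open>y\<close> in that chart.\<close>

definition tangent_of ::
  "('m, 'n::finite) chart set \<Rightarrow> ('m, 'n) chart \<Rightarrow> real ^ 'n \<Rightarrow> real ^ 'n \<Rightarrow> ('m, 'n) tvec" where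
  "tangent_of \<A> c x y = (\<lambda>c'. if c' \<in> \<A> \<and> chart_inv c x \<in> fst c'
     then frechet_derivative (transition c c') (at x) y else 0)"

definition point_of ::
  "('m, 'n::finite) chart set \<Rightarrow> ('m, 'n) chart \<Rightarrow> real ^ 'n \<Rightarrow> real ^ 'n \<Rightarrow> 'm \<times> ('m, 'n) tvec" where
  "point_of \<A> c x y = (chart_inv c x, tangent_of \<A> c x y)"

text \<open>Coordinate expressions of a function on (part of) the tangent bundle and of a subset of the
  tangent bundle.\<close>

definition loc ::
  "('m, 'n::finite) chart set \<Rightarrow> ('m, 'n) chart \<Rightarrow> ('m \<times> ('m, 'n) tvec \<Rightarrow> real)
     \<Rightarrow> real ^ 'n \<Rightarrow> real ^ 'n \<Rightarrow> real" where
  "loc \<A> c F x y = F (point_of \<A> c x y)"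

definition loc_dom ::
  "('m, 'n::finite) chart set \<Rightarrow> ('m, 'n) chart \<Rightarrow> ('m \<times> ('m, 'n) tvec) set
     \<Rightarrow> ((real ^ 'n) \<times> (real ^ 'n)) set" where
  "loc_dom \<A> c D = {(x, y). x \<in> chart_range c \<and> point_of \<A> c x y \<in> D}"

definition smooth_scalar ::
  "('m, 'n::finite) chart set \<Rightarrow> ('m \<Rightarrow> real) \<Rightarrow> bool" where
  "smooth_scalar \<A> \<sigma> \<longleftrightarrow> (\<forall>c\<in>\<A>. smooth_on (chart_range c) (\<sigma> \<circ> chart_inv c))"

text \<open>A 1-form is regarded as a fibrewise linear function on the tangent bundle;
  \<open>covec \<A> c \<beta> x\<close> is the vector of its components \<open>b\<^sub>i(x)\<close> in the chart \<open>c\<close>.\<close>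

definition covec ::
  "('m, 'n::finite) chart set \<Rightarrow> ('m, 'n) chart \<Rightarrow> ('m \<times> ('m, 'n) tvec \<Rightarrow> real)
     \<Rightarrow> real ^ 'n \<Rightarrow> real ^ 'n" where
  "covec \<A> c \<beta> x = (\<chi> i. loc \<A> c \<beta> x (axis i 1))"

definition smooth_one_form ::
  "('m, 'n::finite) chart set \<Rightarrow> ('m \<times> ('m, 'n) tvec \<Rightarrow> real) \<Rightarrow> bool" where
  "smooth_one_form \<A> \<beta> \<longleftrightarrow> (\<forall>c\<in>\<A>.
     (\<forall>x\<in>chart_range c. linear (loc \<A> c \<beta> x)) \<and> smooth_on (chart_range c) (covec \<A> c \<beta>))"


section \<open>Finsler geometry in coordinates\<close>

text \<open>Here \<open>L x y\<close> is the coordinate expression of the Finsler function; \<open>dx i\<close> and \<open>dy i\<close> are the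
  partial derivatives with respect to \<open>x\<^sup>i\<close> and \<open>y\<^sup>i\<close>.\<close>

type_synonym 'n coord_fun = "real ^ 'n \<Rightarrow> real ^ 'n \<Rightarrow> real"

definition dx :: "'n::finite \<Rightarrow> 'n coord_fun \<Rightarrow> 'n coord_fun" where
  "dx i H x y = deriv (\<lambda>t. H (x + t *\<^sub>R axis i 1) y) 0"

definition dy :: "'n::finite \<Rightarrow> 'n coord_fun \<Rightarrow> 'n coord_fun" where
  "dy i H x y = deriv (\<lambda>t. H x (y + t *\<^sub>R axis i 1)) 0"

definition g_low :: "'n::finite coord_fun \<Rightarrow> 'n \<Rightarrow> 'n \<Rightarrow> 'n coord_fun" where
  "g_low L i j x y = 1/2 * dy i (dy j (\<lambda>x y. (L x y)\<^sup>2)) x y"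

definition g_mat :: "'n::finite coord_fun \<Rightarrow> real ^ 'n \<Rightarrow> real ^ 'n \<Rightarrow> real ^ 'n ^ 'n" where
  "g_mat L x y = (\<chi> i j. g_low L i j x y)"

definition g_up :: "'n::finite coord_fun \<Rightarrow> 'n \<Rightarrow> 'n \<Rightarrow> 'n coord_fun" where
  "g_up L i j x y = matrix_inv (g_mat L x y) $ i $ j"

definition l_low :: "'n::finite coord_fun \<Rightarrow> 'n \<Rightarrow> 'n coord_fun" where
  "l_low L i = dy i L"

definition y_low :: "'n::finite coord_fun \<Rightarrow> 'n \<Rightarrow> 'n coord_fun" where
  "y_low L i x y = (\<Sum>j\<in>UNIV. g_low L i j x y * y $ j)"

definition christoffel :: "'n::finite coord_fun \<Rightarrow> 'n \<Rightarrow> 'n \<Rightarrow> 'n \<Rightarrow> 'n coord_fun" where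
  "christoffel L i j k x y = 1/2 * (\<Sum>r\<in>UNIV. g_up L i r x y *
     (dx j (g_low L k r) x y + dx k (g_low L j r) x y - dx r (g_low L j k) x y))"

definition spray :: "'n::finite coord_fun \<Rightarrow> 'n \<Rightarrow> 'n coord_fun" where
  "spray L i x y = 1/2 * (\<Sum>j\<in>UNIV. \<Sum>k\<in>UNIV. christoffel L i j k x y * y $ j * y $ k)"

definition nonlinear_connection :: "'n::finite coord_fun \<Rightarrow> 'n \<Rightarrow> 'n \<Rightarrow> 'n coord_fun" where
  "nonlinear_connection L i j = dy j (spray L i)"

definition delta :: "'n::finite coord_fun \<Rightarrow> 'n \<Rightarrow> 'n coord_fun \<Rightarrow> 'n coord_fun" where
  "delta L i H x y = dx i H x y - (\<Sum>r\<in>UNIV. nonlinear_connection L r i x y * dy r H x y)"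

definition Gamma_h :: "'n::finite coord_fun \<Rightarrow> 'n \<Rightarrow> 'n \<Rightarrow> 'n \<Rightarrow> 'n coord_fun" where
  "Gamma_h L i j k x y = 1/2 * (\<Sum>r\<in>UNIV. g_up L i r x y *
     (delta L j (g_low L k r) x y + delta L k (g_low L j r) x y - delta L r (g_low L j k) x y))"

text \<open>\<open>hcov L b i j\<close> is \<open>b\<^sub>i\<^sub>|\<^sub>j\<close>.\<close>

definition hcov :: "'n::finite coord_fun \<Rightarrow> (real ^ 'n \<Rightarrow> real ^ 'n) \<Rightarrow> 'n \<Rightarrow> 'n \<Rightarrow> 'n coord_fun" where
  "hcov L b i j x y =
     dx j (\<lambda>x y. b x $ i) x y - (\<Sum>m\<in>UNIV. b x $ m * Gamma_h L m i j x y)"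

definition F_low :: "'n::finite coord_fun \<Rightarrow> (real ^ 'n \<Rightarrow> real ^ 'n) \<Rightarrow> 'n \<Rightarrow> 'n \<Rightarrow> 'n coord_fun" where
  "F_low L b i j x y = 1/2 * (hcov L b i j x y - hcov L b j i x y)"

definition E_low :: "'n::finite coord_fun \<Rightarrow> (real ^ 'n \<Rightarrow> real ^ 'n) \<Rightarrow> 'n \<Rightarrow> 'n \<Rightarrow> 'n coord_fun" where
  "E_low L b i j x y = 1/2 * (hcov L b i j x y + hcov L b j i x y)"

definition F_0 :: "'n::finite coord_fun \<Rightarrow> (real ^ 'n \<Rightarrow> real ^ 'n) \<Rightarrow> 'n \<Rightarrow> 'n coord_fun" where
  "F_0 L b i x y = (\<Sum>l\<in>UNIV. F_low L b l i x y * y $ l)"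

definition E_00 :: "'n::finite coord_fun \<Rightarrow> (real ^ 'n \<Rightarrow> real ^ 'n) \<Rightarrow> 'n coord_fun" where
  "E_00 L b x y = (\<Sum>i\<in>UNIV. \<Sum>j\<in>UNIV. E_low L b i j x y * y $ i * y $ j)"

definition form :: "(real ^ 'n::finite \<Rightarrow> real ^ 'n) \<Rightarrow> 'n coord_fun" where
  "form b x y = (\<Sum>i\<in>UNIV. b x $ i * y $ i)"

definition m_low :: "'n::finite coord_fun \<Rightarrow> (real ^ 'n \<Rightarrow> real ^ 'n) \<Rightarrow> 'n \<Rightarrow> 'n coord_fun" where
  "m_low L b i x y = b x $ i - form b x y / (L x y)\<^sup>2 * y_low L i x y"

definition m_sq :: "'n::finite coord_fun \<Rightarrow> (real ^ 'n \<Rightarrow> real ^ 'n) \<Rightarrow> 'n coord_fun" where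
  "m_sq L b x y = (\<Sum>i\<in>UNIV. \<Sum>j\<in>UNIV. g_up L i j x y * m_low L b i x y * m_low L b j x y)"

definition sigma_low :: "(real ^ 'n::finite \<Rightarrow> real) \<Rightarrow> 'n \<Rightarrow> 'n coord_fun" where
  "sigma_low s i = dx i (\<lambda>x y. s x)"

definition sigma_0 :: "(real ^ 'n::finite \<Rightarrow> real) \<Rightarrow> 'n coord_fun" where
  "sigma_0 s x y = (\<Sum>i\<in>UNIV. sigma_low s i x y * y $ i)"


section \<open>The generalized \<open>\<beta>\<close>-conformal change\<close>

definition partial1 :: "(real \<times> real \<Rightarrow> real) \<Rightarrow> real \<times> real \<Rightarrow> real" where
  "partial1 f = (\<lambda>(u, v). deriv (\<lambda>t. f (t, v)) u)"

definition partial2 :: "(real \<times> real \<Rightarrow> real) \<Rightarrow> real \<times> real \<Rightarrow> real" where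
  "partial2 f = (\<lambda>(u, v). deriv (\<lambda>t. f (u, t)) v)"

definition changed_metric ::
  "('m \<Rightarrow> real) \<Rightarrow> ('m \<times> ('m, 'n::finite) tvec \<Rightarrow> real) \<Rightarrow> (real \<times> real \<Rightarrow> real)
     \<Rightarrow> ('m \<times> ('m, 'n) tvec \<Rightarrow> real) \<Rightarrow> 'm \<times> ('m, 'n) tvec \<Rightarrow> real" where
  "changed_metric \<sigma> \<beta> f L = (\<lambda>(p, v). f (exp (\<sigma> p) * L (p, v), \<beta> (p, v)))"

text \<open>In the following, \<open>L\<close>, \<open>s\<close> and \<open>b\<close> are the coordinate expressions of the Finsler function,
  of \<open>\<sigma>\<close> and of the components of \<open>\<beta>\<close>.\<close>

definition f_arg ::
  "'n::finite coord_fun \<Rightarrow> (real ^ 'n \<Rightarrow> real) \<Rightarrow> (real ^ 'n \<Rightarrow> real ^ 'n)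
     \<Rightarrow> real ^ 'n \<Rightarrow> real ^ 'n \<Rightarrow> real \<times> real" where
  "f_arg L s b x y = (exp (s x) * L x y, form b x y)"

definition q_coef ::
  "(real \<times> real \<Rightarrow> real) \<Rightarrow> 'n::finite coord_fun \<Rightarrow> (real ^ 'n \<Rightarrow> real)
     \<Rightarrow> (real ^ 'n \<Rightarrow> real ^ 'n) \<Rightarrow> 'n coord_fun" where
  "q_coef f L s b x y = f (f_arg L s b x y) * partial2 f (f_arg L s b x y)"

definition p_coef ::
  "(real \<times> real \<Rightarrow> real) \<Rightarrow> 'n::finite coord_fun \<Rightarrow> (real ^ 'n \<Rightarrow> real)
     \<Rightarrow> (real ^ 'n \<Rightarrow> real ^ 'n) \<Rightarrow> 'n coord_fun" where
  "p_coef f L s b x y = f (f_arg L s b x y) * partial1 f (f_arg L s b x y) / L x y"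

definition q0_coef ::
  "(real \<times> real \<Rightarrow> real) \<Rightarrow> 'n::finite coord_fun \<Rightarrow> (real ^ 'n \<Rightarrow> real)
     \<Rightarrow> (real ^ 'n \<Rightarrow> real ^ 'n) \<Rightarrow> 'n coord_fun" where
  "q0_coef f L s b x y = f (f_arg L s b x y) * partial2 (partial2 f) (f_arg L s b x y)"

definition phi_low ::
  "(real \<times> real \<Rightarrow> real) \<Rightarrow> 'n::finite coord_fun \<Rightarrow> (real ^ 'n \<Rightarrow> real)
     \<Rightarrow> (real ^ 'n \<Rightarrow> real ^ 'n) \<Rightarrow> 'n \<Rightarrow> 'n coord_fun" where
  "phi_low f L s b i x y =
     (L x y)\<^sup>2 * exp (s x) * p_coef f L s b x y * sigma_low s i x y
     - (p_coef f L s b x y * L x y * exp (s x) * l_low L i x y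
        - q0_coef f L s b x y * form b x y * m_low L b i x y) * sigma_0 s x y
     + 2 * q_coef f L s b x y * F_0 L b i x y
     - q0_coef f L s b x y * E_00 L b x y * m_low L b i x y"

text \<open>If the metric tensor is positive definite and \<open>D\<close> contains all nonzero vectors, then \<open>m\<^sub>i\<close>
  vanishes at the directions \<open>y\<close> dual to \<open>\<plusminus>b\<close>. Hence on a full slit tangent bundle the
  assumptions cannot hold everywhere, only at generic points.\<close>

definition standing_assumptions ::
  "(real \<times> real \<Rightarrow> real) \<Rightarrow> 'n::finite coord_fun \<Rightarrow> (real ^ 'n \<Rightarrow> real)
     \<Rightarrow> (real ^ 'n \<Rightarrow> real ^ 'n) \<Rightarrow> real ^ 'n \<Rightarrow> real ^ 'n \<Rightarrow> bool" where
  "standing_assumptions f L s b x y \<longleftrightarrow>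
     (\<exists>i. m_low L b i x y \<noteq> 0) \<and> m_sq L b x y \<noteq> 0 \<and> p_coef f L s b x y \<noteq> 0 \<and>
     exp (s x) * p_coef f L s b x y + m_sq L b x y * q0_coef f L s b x y \<noteq> 0"


section \<open>Finsler metrics and geodesics on a manifold\<close>

text \<open>The Finsler function lives on an open conic set \<open>D\<close> of nonzero tangent vectors, possibly all
  of them. A proper subset is needed for instance for Kropina-type metrics \<open>L\<^sup>2/\<beta>\<close>. The metric
  tensor is required to be nondegenerate, not necessarily positive definite.\<close>

definition conic_domain ::
  "('m, 'n::finite) chart set \<Rightarrow> ('m \<times> ('m, 'n) tvec) set \<Rightarrow> bool" where
  "conic_domain \<A> D \<longleftrightarrow> D \<subseteq> slit_tangent_bundle \<A> \<and> (\<forall>c\<in>\<A>. open (loc_dom \<A> c D)) \<and>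
     (\<forall>p v r. (p, v) \<in> D \<and> 0 < r \<longrightarrow> (p, \<lambda>c. r *\<^sub>R v c) \<in> D)"

definition finsler_metric ::
  "('m, 'n::finite) chart set \<Rightarrow> ('m \<times> ('m, 'n) tvec) set
     \<Rightarrow> ('m \<times> ('m, 'n) tvec \<Rightarrow> real) \<Rightarrow> bool" where
  "finsler_metric \<A> D L \<longleftrightarrow> conic_domain \<A> D \<and>
     (\<forall>c\<in>\<A>. smooth_on (loc_dom \<A> c D) (\<lambda>(x, y). loc \<A> c L x y)) \<and>
     (\<forall>u\<in>D. 0 < L u) \<and>
     (\<forall>p v r. (p, v) \<in> D \<and> 0 < r \<longrightarrow> L (p, \<lambda>c. r *\<^sub>R v c) = r * L (p, v)) \<and>
     (\<forall>c\<in>\<A>. \<forall>(x, y)\<in>loc_dom \<A> c D. invertible (g_mat (loc \<A> c L) x y))"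

definition velocity ::
  "('m, 'n::finite) chart set \<Rightarrow> (real \<Rightarrow> 'm) \<Rightarrow> real \<Rightarrow> ('m, 'n) tvec" where
  "velocity \<A> \<gamma> t = (\<lambda>c. if c \<in> \<A> \<and> \<gamma> t \<in> fst c
     then vector_derivative (snd c \<circ> \<gamma>) (at t) else 0)"

text \<open>Geodesics in arbitrary parametrization: \<open>dy\<^sup>i/dt + 2 G\<^sup>i = w y\<^sup>i\<close> with \<open>y\<^sup>i = dx\<^sup>i/dt\<close> for some
  function \<open>w\<close> of the parameter, in all charts.\<close>

definition geodesic ::
  "('m::topological_space, 'n::finite) chart set \<Rightarrow> ('m \<times> ('m, 'n) tvec) set
     \<Rightarrow> ('m \<times> ('m, 'n) tvec \<Rightarrow> real) \<Rightarrow> real set \<Rightarrow> (real \<Rightarrow> 'm) \<Rightarrow> bool" where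
  "geodesic \<A> D L I \<gamma> \<longleftrightarrow>
     continuous_on I \<gamma> \<and> \<gamma> ` I \<subseteq> manifold \<A> \<and> (\<forall>t\<in>I. (\<gamma> t, velocity \<A> \<gamma> t) \<in> D) \<and>
     (\<exists>w :: real \<Rightarrow> real. \<forall>c\<in>\<A>. \<forall>t\<in>I. \<gamma> t \<in> fst c \<longrightarrow>
        (let x = snd c \<circ> \<gamma>; y = (\<lambda>r. vector_derivative x (at r)) in
         x differentiable at t \<and> y differentiable at t \<and>
         (\<forall>i. vector_derivative y (at t) $ i + 2 * spray (loc \<A> c L) i (x t) (y t) = w t * y t $ i)))"

definition projectively_related ::
  "('m::topological_space, 'n::finite) chart set \<Rightarrow> ('m \<times> ('m, 'n) tvec) set
     \<Rightarrow> ('m \<times> ('m, 'n) tvec \<Rightarrow> real) \<Rightarrow> ('m \<times> ('m, 'n) tvec \<Rightarrow> real) \<Rightarrow> bool" where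
  "projectively_related \<A> D L L' \<longleftrightarrow>
     (\<forall>I \<gamma>. open I \<and> is_interval I \<longrightarrow> (geodesic \<A> D L I \<gamma> \<longleftrightarrow> geodesic \<A> D L' I \<gamma>))"

end

theory Submission
  imports Defs
begin

text \<open>
  Let \<open>E\<^sub>i(H)\<close> denote the Euler-Lagrange expression \<open>\<partial>H/\<partial>x\<^sup>i - d/dt (\<partial>H/\<partial>y\<^sup>i)\<close>, regarded as a
  function of position \<open>x\<close>, velocity \<open>y\<close> and acceleration \<open>z\<close>. For a Finsler function \<open>L\<close> with
  spray \<open>G\<close>, nondegeneracy of the metric tensor and Euler's relations show that \<open>z + 2 G = w y\<close> holds
  if and only if \<open>E(L) = 0\<close> and \<open>w\<close> is the logarithmic derivative of \<open>L\<close> along the curve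
  (\<open>geodesic_equation_iff\<close>). Two consequences: at each point \<open>(x, y)\<close> the accelerations with
  \<open>E(L) = 0\<close> form a line parallel to \<open>y\<close>, and a sufficiently regular curve is a geodesic if and only if
  \<open>E(L) = 0\<close> along it in all charts (\<open>geodesic_iff_extremal\<close>).

  Now let \<open>L'\<close> be the changed metric \<open>f (e\<^sup>\<sigma> L, \<beta>)\<close>. Evaluated at \<open>z = -2 G\<close>, the spray of the original
  metric, the chain rule and the homogeneity relations for the second derivatives of \<open>f\<close> give
  \<open>\<phi>\<^sub>i = L' E\<^sub>i(L')\<close> (\<open>phi_low_eq\<close>). So \<open>\<phi>\<close> vanishes at \<open>(x, y)\<close> if and only if \<open>-2 G\<close> lies on the line
  of accelerations that belongs to \<open>L'\<close>.

  If \<open>\<phi>\<close> vanishes on the dense set \<open>P\<close>, then by continuity \<open>E(L') = 0\<close> holds at \<open>z = -2 G\<close> over all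
  of \<open>D\<close>. The two lines of accelerations then have a point in common and agree
  (\<open>extremal_directions_agree\<close>), hence so do the geodesics. Conversely, through each point of \<open>D\<close> there is
  a geodesic of \<open>L\<close> with acceleration \<open>-2 G\<close> (\<open>geodesic_exists\<close>). If the change is projective, it is a
  geodesic of \<open>L'\<close>, so \<open>E(L') = 0\<close> at its initial point, and \<open>\<phi>\<close> vanishes there. The existence of
  this geodesic needs the theorem of Picard and Lindeloef (\<open>ode_solution_exists\<close>) and, since being a
  geodesic is a condition in all charts, the covariance of the Euler-Lagrange expressions under
  coordinate changes (\<open>euler_lagrange_covariant\<close>).
\<close>

section \<open>Directional derivatives and smooth functions\<close>
text \<open>The derivative of \<open>H\<close> at \<open>p\<close> in direction \<open>v\<close>. The point is the last argument, so that
  \<open>pd v H\<close> is again a function and higher derivatives are iterates.\<close>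

definition pd :: "'a \<Rightarrow> ('a::real_normed_vector \<Rightarrow> 'b::real_normed_vector) \<Rightarrow> 'a \<Rightarrow> 'b" where
  "pd v H p = frechet_derivative H (at p) v"

lemma has_derivative_pd: "H differentiable at p \<Longrightarrow> (H has_derivative (\<lambda>v. pd v H p)) (at p)"
  unfolding pd_def by (metis (full_types) eta_contract_eq frechet_derivative_works)

lemma pd_eqI: "(H has_derivative H') (at p) \<Longrightarrow> pd v H p = H' v"
  unfolding pd_def by (metis frechet_derivative_at)

lemma linear_pd: "H differentiable at p \<Longrightarrow> linear (\<lambda>v. pd v H p)"
  using has_derivative_pd has_derivative_linear by blast

lemma pd_cong:
  assumes "open S" "p \<in> S" "\<And>q. q \<in> S \<Longrightarrow> H q = K q" "H differentiable at p"
  shows "pd v K p = pd v H p"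
  unfolding pd_def using frechet_derivative_transform_within_open[OF assms(4,1,2,3)] by simp

lemma differentiable_cong:
  assumes "open S" "p \<in> S" "\<And>q. q \<in> S \<Longrightarrow> H q = K q" "H differentiable at p"
  shows "K differentiable at p"
  using assms has_derivative_transform_within_open unfolding differentiable_def by blast

text \<open>Differentiation at a point of an open set only sees values on that set. This is what allows
  functions given by a formula merely on the domain of a chart to be differentiated repeatedly.\<close>

lemma Ck_on_cong:
  assumes "open S" "\<And>x. x \<in> S \<Longrightarrow> f x = g x" "Ck_on k S f"
  shows "Ck_on k S g"
  using assms(2,3)
proof (induction k arbitrary: f g)
  case 0
  then show ?case by (metis Ck_on.simps(1) continuous_on_cong)
next
  case (Suc k)
  have d: "g differentiable at x" if "x \<in> S" for x
    using differentiable_cong[OF assms(1) that, of f g] Suc.prems that by auto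
  have "Ck_on k S (\<lambda>x. frechet_derivative g (at x) v)" for v
  proof (rule Suc.IH)
    show "Ck_on k S (\<lambda>x. frechet_derivative f (at x) v)" using Suc.prems by auto
    show "frechet_derivative f (at x) v = frechet_derivative g (at x) v" if "x \<in> S" for x
      using frechet_derivative_transform_within_open[OF _ assms(1) that, of f g] Suc.prems that by simp
  qed
  with d show ?case by auto
qed

lemma Ck_on_Suc_imp: "Ck_on (Suc k) S f \<Longrightarrow> Ck_on k S f"
proof (induction k arbitrary: f)
  case 0
  then show ?case
    by (auto intro!: continuous_at_imp_continuous_on differentiable_imp_continuous_within)
next
  case (Suc k)
  then show ?case by auto
qed

lemma Ck_on_subset: "Ck_on k S f \<Longrightarrow> T \<subseteq> S \<Longrightarrow> Ck_on k T f"
  by (induction k arbitrary: f) (auto intro: continuous_on_subset)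

lemma Ck_on_const: "Ck_on k S (\<lambda>x. c)"
  by (induction k arbitrary: c) auto

lemma Ck_on_bounded_linear:
  assumes "bounded_linear A"
  shows "Ck_on k S A"
proof (cases k)
  case 0
  then show ?thesis
    by (simp add: assms linear_continuous_on)
next
  case (Suc n)
  have "frechet_derivative A (at x) = A" for x
    using bounded_linear_imp_has_derivative[OF assms] frechet_derivative_at by metis
  then show ?thesis using Suc assms
    by (auto simp: Ck_on_const bounded_linear_imp_differentiable)
qed

lemma Ck_on_add:
  assumes "open S"
  shows "Ck_on k S f \<Longrightarrow> Ck_on k S g \<Longrightarrow> Ck_on k S (\<lambda>x. f x + g x)"
proof (induction k arbitrary: f g)
  case 0
  then show ?case by (auto intro: continuous_on_add)
next
  case (Suc k)
  have "Ck_on k S (\<lambda>x. frechet_derivative (\<lambda>x. f x + g x) (at x) v)" for v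
  proof (rule Ck_on_cong[OF assms])
    show "Ck_on k S (\<lambda>x. pd v f x + pd v g x)"
      unfolding pd_def using Suc by auto
    show "pd v f x + pd v g x = frechet_derivative (\<lambda>x. f x + g x) (at x) v" if "x \<in> S" for x
      unfolding pd_def[of v "\<lambda>x. f x + g x", symmetric]
      by (rule pd_eqI[symmetric]) (use Suc that in \<open>auto intro!: has_derivative_add has_derivative_pd\<close>)
  qed
  with Suc.prems show ?case by auto
qed

text \<open>By induction on the order, since the product rule expresses each directional derivative of the
  product by products of factors that are smooth to one order less.\<close>

lemma Ck_on_mult:
  fixes f g :: "'a::real_normed_vector \<Rightarrow> real"
  assumes "open S"
  shows "Ck_on k S f \<Longrightarrow> Ck_on k S g \<Longrightarrow> Ck_on k S (\<lambda>x. f x * g x)"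
proof (induction k arbitrary: f g)
  case 0
  then show ?case by (auto intro: continuous_on_mult)
next
  case (Suc k)
  have "Ck_on k S (\<lambda>x. frechet_derivative (\<lambda>x. f x * g x) (at x) v)" for v
  proof (rule Ck_on_cong[OF assms])
    show "Ck_on k S (\<lambda>x. f x * pd v g x + pd v f x * g x)"
      unfolding pd_def using Suc.prems Ck_on_Suc_imp[OF Suc.prems(1)] Ck_on_Suc_imp[OF Suc.prems(2)]
      by (intro Ck_on_add[OF assms] Suc.IH) auto
    show "f x * pd v g x + pd v f x * g x = frechet_derivative (\<lambda>x. f x * g x) (at x) v"
      if "x \<in> S" for x
      unfolding pd_def[of v "\<lambda>x. f x * g x", symmetric]
      by (rule pd_eqI[symmetric]) (use Suc that in \<open>auto intro!: has_derivative_mult has_derivative_pd\<close>)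
  qed
  with Suc.prems show ?case by auto
qed

lemma Ck_on_inverse:
  fixes f :: "'a::real_normed_vector \<Rightarrow> real"
  assumes "open S" "\<And>x. x \<in> S \<Longrightarrow> f x \<noteq> 0"
  shows "Ck_on k S f \<Longrightarrow> Ck_on k S (\<lambda>x. inverse (f x))"
proof (induction k)
  case 0
  then show ?case using assms by (auto intro: continuous_on_inverse)
next
  case (Suc k)
  have i: "Ck_on k S (\<lambda>x. inverse (f x))" using Suc Ck_on_Suc_imp by blast
  have "Ck_on k S (\<lambda>x. frechet_derivative (\<lambda>x. inverse (f x)) (at x) v)" for v
  proof (rule Ck_on_cong[OF assms(1)])
    show "Ck_on k S (\<lambda>x. - 1 * (inverse (f x) * pd v f x * inverse (f x)))"
      unfolding pd_def using Suc.prems i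
      by (intro Ck_on_mult[OF assms(1)] Ck_on_const) auto
    show "- 1 * (inverse (f x) * pd v f x * inverse (f x))
        = frechet_derivative (\<lambda>x. inverse (f x)) (at x) v"
      if "x \<in> S" for x
    proof -
      have "(f has_derivative (\<lambda>v. pd v f x)) (at x)"
        using Suc.prems that by (intro has_derivative_pd) auto
      from pd_eqI[OF Deriv.has_derivative_inverse[OF assms(2)[OF that] this], of v]
      show ?thesis by (simp add: pd_def[of v "\<lambda>x. inverse (f x)"])
    qed
  qed
  moreover have "(\<lambda>x. inverse (f x)) differentiable at x" if "x \<in> S" for x
    using that assms(2) Suc.prems by (auto intro: differentiable_inverse)
  ultimately show ?case by auto
qed

lemma Ck_on_compose_linear:
  assumes "bounded_linear A" "open S"
  shows "Ck_on k S f \<Longrightarrow> Ck_on k (A -` S) (\<lambda>x. f (A x))"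
proof (induction k arbitrary: f)
  case 0
  then show ?case
    using continuous_on_compose2[of S f _ A] linear_continuous_on[OF assms(1)] by auto
next
  case (Suc k)
  have h: "((\<lambda>x. f (A x)) has_derivative (\<lambda>v. pd (A v) f (A x))) (at x)"
    if "A x \<in> S" for x
    using has_derivative_compose[OF bounded_linear_imp_has_derivative[OF assms(1)] has_derivative_pd]
      Suc.prems that by auto
  have o: "open (A -` S)"
    using assms by (simp add: continuous_open_vimage linear_continuous_at)
  have "Ck_on k (A -` S) (\<lambda>x. frechet_derivative (\<lambda>x. f (A x)) (at x) v)" for v
  proof (rule Ck_on_cong[OF o])
    show "Ck_on k (A -` S) (\<lambda>x. pd (A v) f (A x))"
      using Suc by (auto simp: pd_def)
    show "pd (A v) f (A x) = frechet_derivative (\<lambda>x. f (A x)) (at x) v" if "x \<in> A -` S" for x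
      using pd_eqI[OF h] that unfolding pd_def by auto
  qed
  with h show ?case by (auto simp: differentiable_def)
qed

lemma Ck_on_linear_compose:
  assumes "bounded_linear A" "open S"
  shows "Ck_on k S f \<Longrightarrow> Ck_on k S (\<lambda>x. A (f x))"
proof (induction k arbitrary: f)
  case 0
  then show ?case
    using bounded_linear.continuous_on[OF assms(1)] by auto
next
  case (Suc k)
  have h: "((\<lambda>x. A (f x)) has_derivative (\<lambda>v. A (pd v f x))) (at x)" if "x \<in> S" for x
    using bounded_linear.has_derivative[OF assms(1) has_derivative_pd] Suc.prems that by auto
  have "Ck_on k S (\<lambda>x. frechet_derivative (\<lambda>x. A (f x)) (at x) v)" for v
  proof (rule Ck_on_cong[OF assms(2)])
    show "Ck_on k S (\<lambda>x. A (pd v f x))"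
      using Suc by (auto simp: pd_def)
    show "A (pd v f x) = frechet_derivative (\<lambda>x. A (f x)) (at x) v" if "x \<in> S" for x
      using pd_eqI[OF h] that unfolding pd_def by auto
  qed
  with h show ?case by (auto simp: differentiable_def)
qed

lemma smooth_on_differentiable: "smooth_on S f \<Longrightarrow> x \<in> S \<Longrightarrow> f differentiable at x"
  using Ck_on.simps(2) unfolding smooth_on_def by blast

lemma smooth_on_has_derivative:
  "smooth_on S f \<Longrightarrow> x \<in> S \<Longrightarrow> (f has_derivative (\<lambda>v. pd v f x)) (at x)"
  by (intro has_derivative_pd smooth_on_differentiable)

lemma smooth_on_continuous_on: "smooth_on S f \<Longrightarrow> continuous_on S f"
  using Ck_on.simps(1) unfolding smooth_on_def by blast

lemma smooth_on_pd: "smooth_on S f \<Longrightarrow> smooth_on S (pd v f)"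
  using Ck_on.simps(2) unfolding smooth_on_def pd_def[abs_def] by blast

lemma smooth_on_cong:
  "smooth_on S f \<Longrightarrow> open S \<Longrightarrow> (\<And>x. x \<in> S \<Longrightarrow> f x = g x) \<Longrightarrow> smooth_on S g"
  unfolding smooth_on_def using Ck_on_cong by blast

lemma smooth_on_subset: "smooth_on S f \<Longrightarrow> T \<subseteq> S \<Longrightarrow> smooth_on T f"
  unfolding smooth_on_def using Ck_on_subset by blast

lemma smooth_on_const: "smooth_on S (\<lambda>x. c)"
  unfolding smooth_on_def using Ck_on_const by blast

lemma smooth_on_bounded_linear: "bounded_linear A \<Longrightarrow> smooth_on S A"
  unfolding smooth_on_def using Ck_on_bounded_linear by blast

lemma smooth_on_add:
  "open S \<Longrightarrow> smooth_on S f \<Longrightarrow> smooth_on S g \<Longrightarrow> smooth_on S (\<lambda>x. f x + g x)"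
  unfolding smooth_on_def using Ck_on_add by blast

lemma smooth_on_mult:
  fixes f g :: "'a::real_normed_vector \<Rightarrow> real"
  shows "open S \<Longrightarrow> smooth_on S f \<Longrightarrow> smooth_on S g \<Longrightarrow> smooth_on S (\<lambda>x. f x * g x)"
  unfolding smooth_on_def using Ck_on_mult by blast

lemma smooth_on_diff:
  fixes f g :: "'a::real_normed_vector \<Rightarrow> real"
  assumes "open S" "smooth_on S f" "smooth_on S g"
  shows "smooth_on S (\<lambda>x. f x - g x)"
  using smooth_on_add[OF assms(1,2) smooth_on_mult[OF assms(1) smooth_on_const[of _ "-1"] assms(3)]]
  by simp

lemma smooth_on_divide:
  fixes f g :: "'a::real_normed_vector \<Rightarrow> real"
  assumes "open S" "smooth_on S f" "smooth_on S g" "\<And>x. x \<in> S \<Longrightarrow> g x \<noteq> 0"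
  shows "smooth_on S (\<lambda>x. f x / g x)"
proof -
  have "smooth_on S (\<lambda>x. inverse (g x))"
    using assms Ck_on_inverse unfolding smooth_on_def by blast
  from smooth_on_mult[OF assms(1,2) this] show ?thesis by (simp add: divide_inverse)
qed

lemma smooth_on_sum:
  fixes f :: "'i \<Rightarrow> 'a::real_normed_vector \<Rightarrow> 'b::real_normed_vector"
  assumes "open S" "\<And>i. i \<in> I \<Longrightarrow> smooth_on S (f i)"
  shows "smooth_on S (\<lambda>x. \<Sum>i\<in>I. f i x)"
  using assms(2)
  by (induction I rule: infinite_finite_induct)
     (auto intro: smooth_on_const smooth_on_add[OF assms(1)])

lemma smooth_on_prod:
  fixes f :: "'i \<Rightarrow> 'a::real_normed_vector \<Rightarrow> real"
  assumes "open S" "\<And>i. i \<in> I \<Longrightarrow> smooth_on S (f i)"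
  shows "smooth_on S (\<lambda>x. \<Prod>i\<in>I. f i x)"
  using assms(2)
  by (induction I rule: infinite_finite_induct)
     (auto intro: smooth_on_const smooth_on_mult[OF assms(1)])

lemma smooth_on_compose_linear:
  assumes "smooth_on S f" "bounded_linear A" "open S" "\<And>x. x \<in> T \<Longrightarrow> A x \<in> S"
  shows "smooth_on T (\<lambda>x. f (A x))"
proof -
  have "smooth_on (A -` S) (\<lambda>x. f (A x))"
    using assms Ck_on_compose_linear unfolding smooth_on_def by blast
  then show ?thesis by (rule smooth_on_subset) (use assms in auto)
qed

lemma smooth_on_linear_compose:
  assumes "smooth_on S f" "bounded_linear A" "open S"
  shows "smooth_on S (\<lambda>x. A (f x))"
  using assms Ck_on_linear_compose unfolding smooth_on_def by blast

section \<open>Symmetry of second derivatives\<close>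
lemma has_real_derivative_line:
  fixes H :: "'a::real_normed_vector \<Rightarrow> real"
  assumes "H differentiable at (p + s *\<^sub>R v)"
  shows "((\<lambda>s. H (p + s *\<^sub>R v)) has_real_derivative pd v H (p + s *\<^sub>R v)) (at s)"
proof -
  have 1: "((\<lambda>s. p + s *\<^sub>R v) has_derivative (\<lambda>s. s *\<^sub>R v)) (at s)"
    by (auto intro!: derivative_eq_intros)
  have "((\<lambda>s. H (p + s *\<^sub>R v)) has_derivative (\<lambda>s'. pd (s' *\<^sub>R v) H (p + s *\<^sub>R v))) (at s)"
    using has_derivative_compose[OF 1 has_derivative_pd[OF assms]] .
  moreover have "pd (s' *\<^sub>R v) H (p + s *\<^sub>R v) = pd v H (p + s *\<^sub>R v) * s'" for s'
    using linear_scale[OF linear_pd[OF assms]] by simp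
  ultimately show ?thesis by (simp add: has_field_derivative_def)
qed

text \<open>Two applications of the mean value theorem, first along \<open>v\<close> to the difference in the \<open>w\<close>
  direction and then along \<open>w\<close>.\<close>

lemma second_difference_eq:
  fixes H :: "'a::real_normed_vector \<Rightarrow> real"
  assumes H: "smooth_on S H" and t: "0 < t"
    and S: "\<And>a b. 0 \<le> a \<Longrightarrow> a \<le> t \<Longrightarrow> 0 \<le> b \<Longrightarrow> b \<le> t \<Longrightarrow> p + a *\<^sub>R v + b *\<^sub>R w \<in> S"
  obtains a b where "0 < a" "a < t" "0 < b" "b < t"
    "H (p + t *\<^sub>R v + t *\<^sub>R w) - H (p + t *\<^sub>R v) - H (p + t *\<^sub>R w) + H p
      = t\<^sup>2 * pd w (pd v H) (p + a *\<^sub>R v + b *\<^sub>R w)"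
proof -
  have S0: "p + a *\<^sub>R v \<in> S" if "0 \<le> a" "a \<le> t" for a using S[of a 0] that t by simp
  have Sw: "(p + t *\<^sub>R w) + a *\<^sub>R v \<in> S" if "0 \<le> a" "a \<le> t" for a
    using S[of a t] that t by (simp add: algebra_simps)
  have "\<exists>a>0. a < t \<and> (H ((p + t *\<^sub>R w) + t *\<^sub>R v) - H (p + t *\<^sub>R v))
      - (H ((p + t *\<^sub>R w) + 0 *\<^sub>R v) - H (p + 0 *\<^sub>R v))
     = (t - 0) * (pd v H ((p + t *\<^sub>R w) + a *\<^sub>R v) - pd v H (p + a *\<^sub>R v))"
    by (rule MVT2[OF t, where f = "\<lambda>a. H ((p + t *\<^sub>R w) + a *\<^sub>R v) - H (p + a *\<^sub>R v)"])
       (auto intro!: DERIV_diff has_real_derivative_line smooth_on_differentiable[OF H] S0 Sw)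
  then obtain a where a: "0 < a" "a < t"
    "H ((p + t *\<^sub>R w) + t *\<^sub>R v) - H (p + t *\<^sub>R v) - H (p + t *\<^sub>R w) + H p
      = t * (pd v H ((p + t *\<^sub>R w) + a *\<^sub>R v) - pd v H (p + a *\<^sub>R v))" by auto
  have "\<exists>b>0. b < t \<and> pd v H ((p + a *\<^sub>R v) + t *\<^sub>R w) - pd v H ((p + a *\<^sub>R v) + 0 *\<^sub>R w)
     = (t - 0) * pd w (pd v H) ((p + a *\<^sub>R v) + b *\<^sub>R w)"
    by (rule MVT2[OF t, where f = "\<lambda>b. pd v H ((p + a *\<^sub>R v) + b *\<^sub>R w)"])
       (use a S in \<open>auto intro!: has_real_derivative_line
          smooth_on_differentiable[OF smooth_on_pd[OF H]]\<close>)
  then obtain b where b: "0 < b" "b < t"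
     "pd v H ((p + a *\<^sub>R v) + t *\<^sub>R w) - pd v H (p + a *\<^sub>R v)
     = t * pd w (pd v H) ((p + a *\<^sub>R v) + b *\<^sub>R w)" by auto
  show ?thesis
    by (rule that[OF a(1,2) b(1,2)]) (use a(3) b(3) in \<open>simp add: power2_eq_square algebra_simps\<close>)
qed

text \<open>The second difference is symmetric in \<open>v\<close> and \<open>w\<close>. Hence each neighbourhood of \<open>p\<close> contains a
  value of \<open>pd w (pd v H)\<close> that is equal to a value of \<open>pd v (pd w H)\<close>, and continuity of both
  finishes the proof.\<close>

lemma pd_commute:
  fixes H :: "'a::real_normed_vector \<Rightarrow> real"
  assumes H: "smooth_on S H" and S: "open S" "p \<in> S"
  shows "pd v (pd w H) p = pd w (pd v H) p"
proof -
  have *: "\<forall>\<^sub>F q in nhds p. \<bar>pd v (pd w H) q - pd v (pd w H) p\<bar> < e" if "e > 0" for e v w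
  proof -
    have "isCont (pd v (pd w H)) p"
      using smooth_on_differentiable[OF smooth_on_pd[OF smooth_on_pd[OF H]] S(2)]
      by (simp add: differentiable_imp_continuous_within)
    then have "(pd v (pd w H) \<longlongrightarrow> pd v (pd w H) p) (nhds p)"
      by (simp add: isCont_def tendsto_at_iff_tendsto_nhds)
    from tendstoD[OF this that] show ?thesis by (simp add: dist_real_def)
  qed
  have "\<bar>pd v (pd w H) p - pd w (pd v H) p\<bar> \<le> e" if "e > 0" for e
  proof -
    have "\<forall>\<^sub>F q in nhds p. q \<in> S \<and> \<bar>pd v (pd w H) q - pd v (pd w H) p\<bar> < e/2
        \<and> \<bar>pd w (pd v H) q - pd w (pd v H) p\<bar> < e/2"
      using *[of "e/2"] that S by (intro eventually_conj eventually_nhds_in_open) auto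
    then obtain r where r: "r > 0" "\<And>q. dist q p < r \<Longrightarrow> q \<in> S"
      "\<And>q. dist q p < r \<Longrightarrow> \<bar>pd v (pd w H) q - pd v (pd w H) p\<bar> < e/2"
      "\<And>q. dist q p < r \<Longrightarrow> \<bar>pd w (pd v H) q - pd w (pd v H) p\<bar> < e/2"
      unfolding eventually_nhds_metric by blast
    \<comment> \<open>The summand 1 only keeps \<open>N\<close> positive.\<close>
    define N where "N = norm v + norm w + 1"
    define t where "t = r / (2 * N)"
    have n: "N > 0" by (simp add: N_def add_nonneg_pos)
    have t: "t > 0" using r(1) n by (simp add: t_def)
    have tn: "t * (norm v + norm w) < r"
    proof -
      have "t * (norm v + norm w) \<le> t * N" using t by (simp add: N_def)
      also have "\<dots> = r / 2" using n by (simp add: t_def)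
      also have "\<dots> < r" using r by simp
      finally show ?thesis .
    qed
    have d: "dist (p + a *\<^sub>R v + b *\<^sub>R w) p < r" if "0 \<le> a" "a \<le> t" "0 \<le> b" "b \<le> t" for a b
    proof -
      have "dist (p + a *\<^sub>R v + b *\<^sub>R w) p = norm (a *\<^sub>R v + b *\<^sub>R w)"
        by (simp add: dist_norm add.assoc)
      also have "\<dots> \<le> a * norm v + b * norm w"
        using norm_triangle_ineq[of "a *\<^sub>R v" "b *\<^sub>R w"] that by simp
      also have "\<dots> \<le> t * norm v + t * norm w"
        using that by (intro add_mono mult_right_mono) auto
      finally show ?thesis using tn by (simp add: distrib_left)
    qed
    obtain a b where ab: "0 < a" "a < t" "0 < b" "b < t"
      "H (p + t *\<^sub>R v + t *\<^sub>R w) - H (p + t *\<^sub>R v) - H (p + t *\<^sub>R w) + H p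
        = t\<^sup>2 * pd w (pd v H) (p + a *\<^sub>R v + b *\<^sub>R w)"
      by (rule second_difference_eq[OF H t]) (use d r in auto)
    have d': "dist (p + b *\<^sub>R w + a *\<^sub>R v) p < r" if "0 \<le> a" "a \<le> t" "0 \<le> b" "b \<le> t" for a b
      using d[OF that] by (simp add: algebra_simps)
    obtain a' b' where ab': "0 < a'" "a' < t" "0 < b'" "b' < t"
      "H (p + t *\<^sub>R w + t *\<^sub>R v) - H (p + t *\<^sub>R w) - H (p + t *\<^sub>R v) + H p
        = t\<^sup>2 * pd v (pd w H) (p + a' *\<^sub>R w + b' *\<^sub>R v)"
      by (rule second_difference_eq[OF H t, of p w v]) (use d' r in auto)
    have swap: "p + t *\<^sub>R v + t *\<^sub>R w = p + t *\<^sub>R w + t *\<^sub>R v" by (simp add: algebra_simps)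
    have "t\<^sup>2 * pd w (pd v H) (p + a *\<^sub>R v + b *\<^sub>R w)
        = t\<^sup>2 * pd v (pd w H) (p + a' *\<^sub>R w + b' *\<^sub>R v)"
      using ab(5)[unfolded swap] ab'(5) by linarith
    then have "pd w (pd v H) (p + a *\<^sub>R v + b *\<^sub>R w) = pd v (pd w H) (p + a' *\<^sub>R w + b' *\<^sub>R v)"
      using t by simp
    with r(4)[OF d[of a b]] r(3)[OF d'[of b' a']] ab ab' show ?thesis by (simp add: abs_if split: if_splits)
  qed
  then show ?thesis
    by (metis abs_le_zero_iff eq_iff_diff_eq_0 field_le_epsilon add_0)
qed

section \<open>Local existence for ordinary differential equations\<close>

lemma lipschitz_on_componentwise:
  fixes F :: "'a::metric_space \<Rightarrow> 'b::euclidean_space"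
  assumes "\<And>b. b \<in> Basis \<Longrightarrow> K-lipschitz_on S (\<lambda>x. F x \<bullet> b)"
  shows "(real DIM('b) * K)-lipschitz_on S F"
proof (rule lipschitz_onI)
  have K: "0 \<le> K" using assms lipschitz_on_nonneg nonempty_Basis by blast
  then show "0 \<le> real DIM('b) * K" by simp
  fix x y assume xy: "x \<in> S" "y \<in> S"
  have "dist (F x) (F y) \<le> (\<Sum>b\<in>Basis. \<bar>(F x - F y) \<bullet> b\<bar>)"
    unfolding dist_norm by (rule norm_le_l1)
  also have "\<dots> \<le> (\<Sum>b\<in>(Basis::'b set). K * dist x y)"
    using lipschitz_onD[OF assms xy] by (intro sum_mono) (auto simp: dist_real_def inner_diff_left)
  finally show "dist (F x) (F y) \<le> real DIM('b) * K * dist x y" by simp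
qed

text \<open>The partial derivatives are bounded on the compact ball, which is convex, so the mean value
  inequality applies.\<close>

lemma smooth_on_lipschitz_cball:
  fixes H :: "'a::euclidean_space \<Rightarrow> real"
  assumes H: "smooth_on S H" and S: "cball p r \<subseteq> S"
  obtains K where "K-lipschitz_on (cball p r) H"
proof -
  have "\<exists>B. \<forall>q\<in>cball p r. \<bar>pd b H q\<bar> \<le> B" for b
  proof -
    have "compact (pd b H ` cball p r)"
      using smooth_on_continuous_on[OF smooth_on_pd[OF H]] S
      by (intro compact_continuous_image) (auto intro: continuous_on_subset)
    then show ?thesis by (auto dest!: compact_imp_bounded simp: bounded_iff)
  qed
  then obtain B where B: "\<And>b q. q \<in> cball p r \<Longrightarrow> \<bar>pd b H q\<bar> \<le> B b" by metis
  define K where "K = (\<Sum>b\<in>Basis. \<bar>B b\<bar>)"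
  have on: "onorm (\<lambda>v. pd v H q) \<le> K" if "q \<in> cball p r" for q
  proof (rule onorm_bound)
    show "0 \<le> K" by (simp add: K_def sum_nonneg)
    fix v
    have lin: "linear (\<lambda>v. pd v H q)"
      using linear_pd smooth_on_differentiable[OF H] S that by blast
    have "pd v H q = pd (\<Sum>b\<in>Basis. (v \<bullet> b) *\<^sub>R b) H q" by (simp add: euclidean_representation)
    also have "\<dots> = (\<Sum>b\<in>Basis. (v \<bullet> b) *\<^sub>R pd b H q)"
      using linear_sum[OF lin, of "\<lambda>b. (v \<bullet> b) *\<^sub>R b" Basis] linear_scale[OF lin] by presburger
    also have "norm \<dots> \<le> (\<Sum>b\<in>Basis. \<bar>B b\<bar> * norm v)"
    proof (rule sum_norm_le)
      fix b :: 'a assume b: "b \<in> Basis"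
      have "\<bar>v \<bullet> b\<bar> * \<bar>pd b H q\<bar> \<le> norm v * \<bar>B b\<bar>"
        using b B[OF that, of b] by (intro mult_mono) (auto simp: Basis_le_norm)
      then show "norm ((v \<bullet> b) *\<^sub>R pd b H q) \<le> \<bar>B b\<bar> * norm v"
        by (simp add: abs_mult mult.commute)
    qed
    finally show "norm (pd v H q) \<le> K * norm v" by (simp add: K_def sum_distrib_right)
  qed
  have "K-lipschitz_on (cball p r) H"
  proof (rule lipschitz_onI)
    show "0 \<le> K" by (simp add: K_def sum_nonneg)
    fix x y assume xy: "x \<in> cball p r" "y \<in> cball p r"
    have "norm (H x - H y) \<le> K * norm (x - y)"
    proof (rule differentiable_bound[OF convex_cball _ on xy])
      show "(H has_derivative (\<lambda>v. pd v H q)) (at q within cball p r)" if "q \<in> cball p r" for q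
        using smooth_on_has_derivative[OF H] S that has_derivative_at_withinI by blast
    qed auto
    then show "dist (H x) (H y) \<le> K * dist x y" by (simp add: dist_norm)
  qed
  then show ?thesis by (rule that)
qed

text \<open>Picard-Lindeloef by Banach's fixed point theorem in the space of bounded continuous functions
  on the whole line. Two devices keep the fixed point problem free of side conditions: the vector
  field is precomposed with the projection \<open>\<pi>\<close> onto the ball, which makes it globally bounded and
  Lipschitz, and the time in the integral is clamped to \<open>[-h, h]\<close>. Near time 0 the solution stays
  in the ball, where the projection is the identity.\<close>

lemma ode_solution_exists:
  fixes F :: "'a::euclidean_space \<Rightarrow> 'a"
  assumes r: "r > 0" and F: "K-lipschitz_on (cball z0 r) F"
  obtains h z where "h > 0" "z 0 = z0"
    "\<And>t. \<bar>t\<bar> < h \<Longrightarrow> z t \<in> cball z0 r"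
    "\<And>t. \<bar>t\<bar> < h \<Longrightarrow> (z has_vector_derivative F (z t)) (at t)"
proof -
  define \<pi> where "\<pi> = closest_point (cball z0 r)"
  have ne: "cball z0 r \<noteq> {}" using r by auto
  have \<pi>: "\<pi> x \<in> cball z0 r" for x
    unfolding \<pi>_def using ne by (intro closest_point_in_set) auto
  define G where "G = F \<circ> \<pi>"
  have K: "K \<ge> 0" using F lipschitz_on_nonneg by blast
  have G_lip: "norm (G x - G y) \<le> K * norm (x - y)" for x y
  proof -
    have "norm (G x - G y) \<le> K * norm (\<pi> x - \<pi> y)"
      unfolding G_def o_def using lipschitz_on_normD[OF F \<pi> \<pi>] .
    also have "\<dots> \<le> K * norm (x - y)"
      using closest_point_lipschitz[OF convex_cball closed_cball ne, of x y] K
      by (intro mult_left_mono) (auto simp: \<pi>_def dist_norm)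
    finally show ?thesis .
  qed
  have "K-lipschitz_on UNIV G"
    by (rule lipschitz_onI) (use G_lip K in \<open>auto simp: dist_norm\<close>)
  then have G_cont: "continuous_on UNIV G" by (rule lipschitz_on_continuous_on)
  have "compact (F ` cball z0 r)"
    by (intro compact_continuous_image lipschitz_on_continuous_on[OF F]) auto
  then obtain M where M: "\<And>x. norm (G x) \<le> M"
    unfolding G_def o_def using \<pi> compact_imp_bounded bounded_iff by (metis imageI)
  \<comment> \<open>The integrals in \<open>T\<close> cover a time of at most \<open>2 h + h\<close>, so this \<open>h\<close> makes \<open>T\<close> a 3/4-contraction.\<close>
  define h where "h = 1 / (4 * (K + 1))"
  have h: "h > 0" using K by (simp add: h_def)
  have hK: "3 * h * K \<le> 3/4" using K by (simp add: h_def divide_simps)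
  define cl where "cl t = max (-h) (min h t)" for t
  have cl: "cl t \<in> {-h..h}" for t using h by (auto simp: cl_def)
  have cl_cont: "continuous_on UNIV cl" unfolding cl_def by (intro continuous_intros)
  \<comment> \<open>The integral from 0 to the clamped time, written so that it also makes sense for negative times.\<close>
  define T where "T \<phi> t = z0 + (integral {-h..cl t} (G \<circ> \<phi>) - integral {-h..0} (G \<circ> \<phi>))"
    for \<phi> :: "real \<Rightarrow> 'a" and t
  have G\<phi>: "continuous_on A (G \<circ> \<phi>)" if "continuous_on UNIV \<phi>" for \<phi> :: "real \<Rightarrow> 'a" and A
    using continuous_on_compose[OF continuous_on_subset[OF that] continuous_on_subset[OF G_cont]]
    by blast
  have bnd: "norm (integral {-h..u} (G \<circ> \<phi>)) \<le> 2 * h * M" if "continuous_on UNIV \<phi>" "u \<in> {-h..h}" for \<phi> u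
  proof -
    have "norm (integral {-h..u} (G \<circ> \<phi>)) \<le> M * (u - (-h))"
      using that M by (intro integral_bound G\<phi>) auto
    also have "\<dots> \<le> M * (2 * h)"
      using that order_trans[OF norm_ge_zero M] by (intro mult_left_mono) auto
    finally show ?thesis by (simp add: mult_ac)
  qed
  have T: "T \<phi> \<in> bcontfun" if c: "continuous_on UNIV \<phi>" for \<phi>
  proof (rule bcontfun_normI)
    have "continuous_on {-h..h} (\<lambda>u. integral {-h..u} (G \<circ> \<phi>))"
      by (intro indefinite_integral_continuous_1 integrable_continuous_real G\<phi> c)
    then have "continuous_on UNIV (\<lambda>t. integral {-h..cl t} (G \<circ> \<phi>))"
      using continuous_on_compose2[OF _ cl_cont] cl by blast
    then show "continuous_on UNIV (T \<phi>)" unfolding T_def by (intro continuous_intros)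
    show "norm (T \<phi> t) \<le> norm z0 + (2 * h * M + 2 * h * M)" for t
      unfolding T_def using bnd[OF c cl] bnd[OF c, of 0] h
      by (intro norm_triangle_le add_left_mono norm_triangle_le_diff add_mono) auto
  qed
  have dI: "norm (integral {-h..u} (G \<circ> \<phi>) - integral {-h..u} (G \<circ> \<psi>)) \<le> (u + h) * (K * d)"
    if c: "continuous_on UNIV \<phi>" "continuous_on UNIV \<psi>" and u: "u \<in> {-h..h}"
      and d: "\<And>t. norm (\<phi> t - \<psi> t) \<le> d" for \<phi> \<psi> u d
  proof -
    have "integral {-h..u} (G \<circ> \<phi>) - integral {-h..u} (G \<circ> \<psi>)
        = integral {-h..u} (\<lambda>t. (G \<circ> \<phi>) t - (G \<circ> \<psi>) t)"
      by (intro integral_diff[symmetric] integrable_continuous_real G\<phi> c)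
    also have "norm \<dots> \<le> (K * d) * (u - (-h))"
    proof (rule integral_bound)
      show "continuous_on {-h..u} (\<lambda>t. (G \<circ> \<phi>) t - (G \<circ> \<psi>) t)"
        by (intro continuous_on_diff G\<phi> c)
      show "norm ((G \<circ> \<phi>) t - (G \<circ> \<psi>) t) \<le> K * d" for t
        using order_trans[OF G_lip mult_left_mono[OF d K]] by simp
    qed (use u in auto)
    finally show ?thesis by (simp add: mult.commute)
  qed
  have contr: "dist (Bcontfun (T \<phi>)) (Bcontfun (T \<psi>)) \<le> 3/4 * dist \<phi> \<psi>" for \<phi> \<psi> :: "real \<Rightarrow>\<^sub>C 'a"
  proof (rule dist_bound)
    fix t
    have d: "norm (\<phi> t - \<psi> t) \<le> dist \<phi> \<psi>" for t
      using dist_bounded[of \<phi> t \<psi>] by (simp add: dist_norm)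
    have D: "0 \<le> K * dist \<phi> \<psi>" using K by simp
    have "dist (T \<phi> t) (T \<psi> t) = norm ((integral {-h..cl t} (G \<circ> \<phi>) - integral {-h..cl t} (G \<circ> \<psi>))
        - (integral {-h..0} (G \<circ> \<phi>) - integral {-h..0} (G \<circ> \<psi>)))"
      by (simp add: T_def dist_norm algebra_simps)
    also have "\<dots> \<le> (cl t + h) * (K * dist \<phi> \<psi>) + (0 + h) * (K * dist \<phi> \<psi>)"
      by (rule norm_triangle_le_diff, intro add_mono dI) (use h cl d in auto)
    also have "\<dots> \<le> (2 * h) * (K * dist \<phi> \<psi>) + h * (K * dist \<phi> \<psi>)"
      using cl[of t] D by (intro add_mono mult_right_mono) auto
    also have "\<dots> = 3 * h * K * dist \<phi> \<psi>" by simp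
    also have "\<dots> \<le> 3/4 * dist \<phi> \<psi>" using hK by (intro mult_right_mono) auto
    finally show "dist (Bcontfun (T \<phi>) t) (Bcontfun (T \<psi>) t) \<le> 3/4 * dist \<phi> \<psi>"
      using T by (simp add: Bcontfun_inverse)
  qed
  have "\<exists>!\<phi>. Bcontfun (T (apply_bcontfun \<phi>)) = \<phi>"
    by (rule banach_fix_type[of "3/4"]) (use contr in auto)
  then obtain \<phi> :: "real \<Rightarrow>\<^sub>C 'a" where \<phi>: "Bcontfun (T \<phi>) = \<phi>" by blast
  then have fixed: "\<phi> t = T \<phi> t" for t
    using T[of \<phi>] by (metis Bcontfun_inverse continuous_on_apply_bcontfun)
  have "isCont \<phi> 0"
    by (rule continuous_on_interior[OF continuous_on_apply_bcontfun[of UNIV]]) simp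
  moreover have \<phi>0: "\<phi> 0 = z0" using fixed[of 0] h by (simp add: T_def cl_def)
  ultimately obtain d where d: "d > 0" "\<And>t. \<bar>t\<bar> < d \<Longrightarrow> dist (\<phi> t) z0 < r"
    using r unfolding continuous_at_eps_delta by (metis dist_real_def diff_zero)
  show ?thesis
  proof (rule that[of "min h d" \<phi>])
    show "min h d > 0" "\<phi> 0 = z0" using h d \<phi>0 by auto
    fix t assume t: "\<bar>t\<bar> < min h d"
    show in_ball: "\<phi> t \<in> cball z0 r" using d(2)[of t] t by (simp add: dist_commute less_imp_le)
    have "((\<lambda>u. integral {-h..u} (G \<circ> \<phi>)) has_vector_derivative (G \<circ> \<phi>) t) (at t within {-h..h})"
      using t by (intro integral_has_vector_derivative G\<phi>) auto
    moreover have "at t within {-h..h} = at t" using t by (intro at_within_interior) auto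
    ultimately have "((\<lambda>u. z0 + (integral {-h..u} (G \<circ> \<phi>) - integral {-h..0} (G \<circ> \<phi>)))
        has_vector_derivative G (\<phi> t)) (at t)"
      by (auto intro!: derivative_eq_intros)
    then have "(\<phi> has_vector_derivative G (\<phi> t)) (at t)"
    proof (rule has_vector_derivative_transform_within_open[where S = "{-h<..<h}"])
      show "z0 + (integral {-h..u} (G \<circ> \<phi>) - integral {-h..0} (G \<circ> \<phi>)) = \<phi> u" if "u \<in> {-h<..<h}" for u
        using fixed[of u] that by (simp add: T_def cl_def)
    qed (use t in auto)
    moreover have "G (\<phi> t) = F (\<phi> t)"
      using in_ball by (simp add: G_def \<pi>_def closest_point_self)
    ultimately show "(\<phi> has_vector_derivative F (\<phi> t)) (at t)" by simp
  qed
qed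

section \<open>Derivatives in position and velocity coordinates\<close>
text \<open>Points of the tangent bundle in a chart are pairs of position and velocity; \<open>ax i\<close> and \<open>ay i\<close>
  are the coordinate directions of the two factors.\<close>

abbreviation ax :: "'n::finite \<Rightarrow> (real ^ 'n) \<times> (real ^ 'n)" where
  "ax i \<equiv> (axis i 1, 0)"

abbreviation ay :: "'n::finite \<Rightarrow> (real ^ 'n) \<times> (real ^ 'n)" where
  "ay i \<equiv> (0, axis i 1)"

lemma vec_eq_sum_axis: "(y :: real ^ 'n::finite) = (\<Sum>j\<in>UNIV. y $ j *\<^sub>R axis j 1)"
  by (simp add: vec_eq_iff axis_def if_distrib[of "\<lambda>t. _ * t"] cong: if_cong)

lemma pd_Pair_expand:
  fixes H :: "(real ^ 'n::finite) \<times> (real ^ 'n) \<Rightarrow> real"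
  assumes "H differentiable at p"
  shows "pd (y, z) H p = (\<Sum>j\<in>UNIV. y $ j * pd (ax j) H p) + (\<Sum>j\<in>UNIV. z $ j * pd (ay j) H p)"
proof -
  note lin = linear_pd[OF assms]
  have "(\<Sum>j\<in>UNIV. y $ j *\<^sub>R (ax j :: (real^'n) \<times> (real^'n))) = ((\<Sum>j\<in>UNIV. y $ j *\<^sub>R axis j 1), 0)"
    by (simp add: prod_eq_iff fst_sum snd_sum)
  then have 1: "(\<Sum>j\<in>UNIV. y $ j *\<^sub>R (ax j :: (real^'n) \<times> (real^'n))) = (y, 0)"
    by (simp flip: vec_eq_sum_axis)
  have "(\<Sum>j\<in>UNIV. z $ j *\<^sub>R (ay j :: (real^'n) \<times> (real^'n))) = (0, (\<Sum>j\<in>UNIV. z $ j *\<^sub>R axis j 1))"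
    by (simp add: prod_eq_iff fst_sum snd_sum)
  then have 2: "(\<Sum>j\<in>UNIV. z $ j *\<^sub>R (ay j :: (real^'n) \<times> (real^'n))) = (0, z)"
    by (simp flip: vec_eq_sum_axis)
  have "(y, z) = (\<Sum>j\<in>UNIV. y $ j *\<^sub>R ax j) + (\<Sum>j\<in>UNIV. z $ j *\<^sub>R ay j)"
    unfolding 1 2 by simp
  then have "pd (y, z) H p = pd (\<Sum>j\<in>UNIV. y $ j *\<^sub>R ax j) H p + pd (\<Sum>j\<in>UNIV. z $ j *\<^sub>R ay j) H p"
    using linear_add[OF lin] by simp
  then show ?thesis
    unfolding linear_sum[OF lin] linear_scale[OF lin] by simp
qed

lemma dx_eq_pd:
  assumes "open U" "smooth_on U K" "\<And>x y. (x, y) \<in> U \<Longrightarrow> H x y = K (x, y)" "(x, y) \<in> U"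
  shows "dx i H x y = pd (ax i) K (x, y)"
proof -
  have d: "((\<lambda>s. K ((x, y) + s *\<^sub>R ax i)) has_real_derivative pd (ax i) K (x, y)) (at 0)"
    using has_real_derivative_line[of K "(x, y)" 0 "ax i"] smooth_on_differentiable[OF assms(2,4)]
    by simp
  have "open ((\<lambda>s. (x, y) + s *\<^sub>R ax i) -` U)"
    by (intro open_vimage assms continuous_intros)
  then have "((\<lambda>s. H (x + s *\<^sub>R axis i 1) y) has_real_derivative pd (ax i) K (x, y)) (at 0)"
    by (rule has_field_derivative_transform_within_open[OF d]) (use assms in auto)
  then show ?thesis unfolding dx_def by (rule DERIV_imp_deriv)
qed

lemma dy_eq_pd:
  assumes "open U" "smooth_on U K" "\<And>x y. (x, y) \<in> U \<Longrightarrow> H x y = K (x, y)" "(x, y) \<in> U"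
  shows "dy i H x y = pd (ay i) K (x, y)"
proof -
  have d: "((\<lambda>s. K ((x, y) + s *\<^sub>R ay i)) has_real_derivative pd (ay i) K (x, y)) (at 0)"
    using has_real_derivative_line[of K "(x, y)" 0 "ay i"] smooth_on_differentiable[OF assms(2,4)]
    by simp
  have "open ((\<lambda>s. (x, y) + s *\<^sub>R ay i) -` U)"
    by (intro open_vimage assms continuous_intros)
  then have "((\<lambda>s. H x (y + s *\<^sub>R axis i 1)) has_real_derivative pd (ay i) K (x, y)) (at 0)"
    by (rule has_field_derivative_transform_within_open[OF d]) (use assms in auto)
  then show ?thesis unfolding dy_def by (rule DERIV_imp_deriv)
qed

lemma bounded_linear_coord:
  "bounded_linear (\<lambda>p :: (real ^ 'n::finite) \<times> (real ^ 'n). fst p $ j)"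
  "bounded_linear (\<lambda>p :: (real ^ 'n::finite) \<times> (real ^ 'n). snd p $ j)"
  by (rule bounded_linear_compose[OF bounded_linear_vec_nth bounded_linear_fst],
      rule bounded_linear_compose[OF bounded_linear_vec_nth bounded_linear_snd])

lemmas smooth_on_coord = bounded_linear_coord[THEN smooth_on_bounded_linear]

lemma smooth_on_det:
  fixes A :: "'a::real_normed_vector \<Rightarrow> real ^ 'n::finite ^ 'n"
  assumes "open S" "\<And>i j. smooth_on S (\<lambda>p. A p $ i $ j)"
  shows "smooth_on S (\<lambda>p. det (A p))"
  unfolding det_def
proof (rule smooth_on_sum[OF assms(1)], rule smooth_on_mult[OF assms(1) smooth_on_const])
  show "smooth_on S (\<lambda>p. \<Prod>i\<in>UNIV. A p $ i $ \<pi> i)" for \<pi>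
    by (rule smooth_on_prod[OF assms])
qed

text \<open>Euler's relation for a function that is homogeneous of degree \<open>k\<close> in the velocity, differentiated
  in the direction \<open>v\<close>. For \<open>v = ay i\<close> it is Euler's relation of degree \<open>k - 1\<close> for the velocity
  derivative; for \<open>v = ax i\<close> it says that position derivatives keep the degree. Thus the homogeneity
  of all derivatives needed below follows from that of the function itself.\<close>

lemma euler_relation_derivative:
  fixes H :: "(real ^ 'n::finite) \<times> (real ^ 'n) \<Rightarrow> real"
  assumes U: "open U" and H: "smooth_on U H" and p: "p \<in> U"
    and E: "\<And>p. p \<in> U \<Longrightarrow> (\<Sum>j\<in>UNIV. snd p $ j * pd (ay j) H p) = k * H p"
  shows "(\<Sum>j\<in>UNIV. snd p $ j * pd v (pd (ay j) H) p) + pd (0, snd v) H p = k * pd v H p"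
proof -
  have 1: "((\<lambda>p. k * H p) has_derivative (\<lambda>v. k * pd v H p)) (at p)"
    by (intro has_derivative_mult_right smooth_on_has_derivative[OF H p])
  have c: "((\<lambda>p. snd p $ j) has_derivative (\<lambda>v. snd v $ j)) (at p)" for j :: 'n
    by (rule bounded_linear_imp_has_derivative[OF bounded_linear_coord(2)])
  have 2: "((\<lambda>p. \<Sum>j\<in>UNIV. snd p $ j * pd (ay j) H p) has_derivative
      (\<lambda>v. \<Sum>j\<in>UNIV. snd p $ j * pd v (pd (ay j) H) p + snd v $ j * pd (ay j) H p)) (at p)"
    by (rule has_derivative_sum, rule has_derivative_mult[OF c],
        rule smooth_on_has_derivative[OF smooth_on_pd[OF H] p])
  have "pd v (\<lambda>p. \<Sum>j\<in>UNIV. snd p $ j * pd (ay j) H p) p = pd v (\<lambda>p. k * H p) p"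
    using 1 by (intro pd_cong[OF U p]) (auto simp: E differentiable_def)
  then show ?thesis
    unfolding pd_eqI[OF 1] pd_eqI[OF 2]
    by (simp add: sum.distrib pd_Pair_expand[OF smooth_on_differentiable[OF H p], of 0 "snd v"])
qed

text \<open>The expression \<open>\<partial>H/\<partial>x\<^sup>i - d/dt (\<partial>H/\<partial>y\<^sup>i)\<close> along a curve, as a function of the
  position and velocity \<open>p\<close> and the acceleration \<open>z\<close>.\<close>

definition euler_lagrange ::
  "'n::finite \<Rightarrow> ((real ^ 'n) \<times> (real ^ 'n) \<Rightarrow> real) \<Rightarrow> (real ^ 'n) \<times> (real ^ 'n) \<Rightarrow> real ^ 'n \<Rightarrow> real"
  where "euler_lagrange i H p z = pd (ax i) H p - pd (snd p, z) (pd (ay i) H) p"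

definition uncurry2 :: "('a \<Rightarrow> 'b \<Rightarrow> 'c) \<Rightarrow> 'a \<times> 'b \<Rightarrow> 'c" where
  "uncurry2 H p = H (fst p) (snd p)"

lemma uncurry2_Pair [simp]: "uncurry2 H (x, y) = H x y"
  by (simp add: uncurry2_def)

section \<open>Finsler functions in one chart\<close>

text \<open>A Finsler function over one chart. The pointwise theory is developed here; manifolds enter again
  only where different charts are compared.\<close>

locale finsler_domain =
  fixes U :: "((real ^ 'n::finite) \<times> (real ^ 'n)) set" and L :: "'n coord_fun"
  assumes open_U: "open U"
    and smooth_l: "smooth_on U (uncurry2 L)"
    and L_pos: "\<And>x y. (x, y) \<in> U \<Longrightarrow> 0 < L x y"
    and conic: "\<And>x y r. (x, y) \<in> U \<Longrightarrow> 0 < r \<Longrightarrow> (x, r *\<^sub>R y) \<in> U"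
    and homogeneous: "\<And>x y r. (x, y) \<in> U \<Longrightarrow> 0 < r \<Longrightarrow> L x (r *\<^sub>R y) = r * L x y"
    and regular: "\<And>x y. (x, y) \<in> U \<Longrightarrow> invertible (g_mat L x y)"
begin

abbreviation l where "l \<equiv> uncurry2 L"

definition Q where "Q p = (l p)\<^sup>2"

lemma smooth_Q: "smooth_on U Q"
  unfolding Q_def[abs_def] power2_eq_square by (intro smooth_on_mult open_U smooth_l)

lemma euler_l:
  assumes "p \<in> U"
  shows "(\<Sum>j\<in>UNIV. snd p $ j * pd (ay j) l p) = 1 * l p"
proof -
  obtain x y where p: "p = (x, y)" by (cases p)
  have dl: "l differentiable at p" using smooth_on_differentiable[OF smooth_l assms] .
  have d: "((\<lambda>s. l ((x, y) + s *\<^sub>R (0, y))) has_real_derivative pd (0, y) l (x, y)) (at 0)"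
    using has_real_derivative_line[of l "(x, y)" 0 "(0, y)"] dl p by simp
  have "((\<lambda>s. (1 + s) * L x y) has_real_derivative pd (0, y) l (x, y)) (at 0)"
  proof (rule has_field_derivative_transform_within_open[OF d, of "{-1<..<1}"])
    show "l ((x, y) + s *\<^sub>R (0, y)) = (1 + s) * L x y" if "s \<in> {-1<..<1}" for s
      using homogeneous[of x y "1 + s"] assms that p by (simp add: scaleR_left_distrib)
  qed auto
  moreover have "((\<lambda>s. (1 + s) * L x y) has_real_derivative L x y) (at 0)"
    by (auto intro!: derivative_eq_intros)
  ultimately have "pd (0, y) l (x, y) = L x y" by (rule DERIV_unique)
  then show ?thesis using pd_Pair_expand[OF dl, of 0 y] p by simp
qed

lemma pd_Q: "p \<in> U \<Longrightarrow> pd v Q p = 2 * l p * pd v l p"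
  unfolding Q_def[abs_def]
  by (rule pd_eqI, rule has_derivative_eq_rhs[OF has_derivative_power[OF smooth_on_has_derivative[OF smooth_l]]])
     auto

lemma pd_pd_Q:
  assumes "p \<in> U"
  shows "pd w (pd v Q) p = 2 * (pd w l p * pd v l p + l p * pd w (pd v l) p)"
proof -
  have "((\<lambda>p. 2 * (l p * pd v l p)) has_derivative
      (\<lambda>w. 2 * (l p * pd w (pd v l) p + pd w l p * pd v l p))) (at p)"
    by (intro has_derivative_mult_right has_derivative_mult smooth_on_has_derivative[OF smooth_l assms]
        smooth_on_has_derivative[OF smooth_on_pd[OF smooth_l] assms])
  note d = this
  have "pd w (pd v Q) p = pd w (\<lambda>p. 2 * (l p * pd v l p)) p"
    by (rule pd_cong[OF open_U assms]) (use d in \<open>auto simp: pd_Q differentiable_def\<close>)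
  then show ?thesis using pd_eqI[OF d] by simp
qed

lemma euler_Q:
  assumes "p \<in> U"
  shows "(\<Sum>j\<in>UNIV. snd p $ j * pd (ay j) Q p) = 2 * Q p"
proof -
  have "(\<Sum>j\<in>UNIV. snd p $ j * pd (ay j) Q p) = 2 * l p * (\<Sum>j\<in>UNIV. snd p $ j * pd (ay j) l p)"
    unfolding sum_distrib_left by (rule sum.cong) (simp_all add: pd_Q[OF assms])
  then show ?thesis using euler_l[OF assms] by (simp add: Q_def power2_eq_square)
qed

lemma euler_Dy_Q:
  assumes "p \<in> U"
  shows "(\<Sum>j\<in>UNIV. snd p $ j * pd (ay j) (pd (ay i) Q) p) = 1 * pd (ay i) Q p"
proof -
  have "pd (ay j) (pd (ay i) Q) p = pd (ay i) (pd (ay j) Q) p" for j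
    by (rule pd_commute[OF smooth_Q open_U assms])
  then show ?thesis
    using euler_relation_derivative[OF open_U smooth_Q assms euler_Q, of "ay i"] by simp
qed

lemma euler_Dy_l:
  assumes "p \<in> U"
  shows "(\<Sum>j\<in>UNIV. snd p $ j * pd (ay j) (pd (ay i) l) p) = 0"
proof -
  have "pd (ay j) (pd (ay i) l) p = pd (ay i) (pd (ay j) l) p" for j
    by (rule pd_commute[OF smooth_l open_U assms])
  then show ?thesis
    using euler_relation_derivative[OF open_U smooth_l assms euler_l, of "ay i"] by simp
qed

definition g where "g i j p = 1/2 * pd (ay i) (pd (ay j) Q) p"

lemma smooth_g: "smooth_on U (g i j)"
  unfolding g_def[abs_def]
  by (intro smooth_on_mult smooth_on_const smooth_on_pd smooth_Q open_U)

lemma g_low_eq: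
  assumes "(x, y) \<in> U"
  shows "g_low L i j x y = g i j (x, y)"
proof -
  have "dy j (\<lambda>x y. (L x y)\<^sup>2) x y = pd (ay j) Q (x, y)" if "(x, y) \<in> U" for x y
    by (rule dy_eq_pd[OF open_U smooth_Q _ that]) (simp add: Q_def)
  then have "dy i (dy j (\<lambda>x y. (L x y)\<^sup>2)) x y = pd (ay i) (pd (ay j) Q) (x, y)"
    by (rule dy_eq_pd[OF open_U smooth_on_pd[OF smooth_Q] _ assms])
  then show ?thesis unfolding g_low_def g_def by simp
qed

lemma pd_g:
  assumes "p \<in> U"
  shows "pd v (g i j) p = 1/2 * pd v (pd (ay i) (pd (ay j) Q)) p"
proof -
  have "(pd (ay i) (pd (ay j) Q) has_derivative (\<lambda>v. pd v (pd (ay i) (pd (ay j) Q)) p)) (at p)"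
    by (rule smooth_on_has_derivative[OF smooth_on_pd[OF smooth_on_pd[OF smooth_Q]] assms])
  from pd_eqI[OF has_derivative_mult_right[OF this, of "1/2"]] show ?thesis
    unfolding g_def[abs_def] .
qed

lemma g_commute: "p \<in> U \<Longrightarrow> g i j p = g j i p"
  unfolding g_def using pd_commute[OF smooth_Q open_U] by simp

text \<open>Four times the spray with lowered index.\<close>

definition R where "R r p = (\<Sum>j\<in>UNIV. snd p $ j * pd (ax j) (pd (ay r) Q) p) - pd (ax r) Q p"

text \<open>The terms with the velocity component \<open>u\<close> disappear because third velocity derivatives of \<open>L\<^sup>2\<close>
  are annihilated by contraction with the velocity.\<close>

lemma contract_pd_Dy_Q:
  assumes "p \<in> U"
  shows "(\<Sum>k\<in>UNIV. snd p $ k * pd (axis j 1, u) (pd (ay k) (pd (ay r) Q)) p) = pd (ax j) (pd (ay r) Q) p"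
proof -
  have "pd (axis j 1, u) (pd (ay r) Q) p = pd (ax j) (pd (ay r) Q) p + pd (0, u) (pd (ay r) Q) p"
    using linear_add[OF linear_pd[OF smooth_on_differentiable[OF smooth_on_pd[OF smooth_Q] assms]],
        of "ax j" "(0, u)"] by simp
  then show ?thesis
    using euler_relation_derivative[OF open_U smooth_on_pd[OF smooth_Q] assms euler_Dy_Q, of "(axis j 1, u)" r]
    by simp
qed

text \<open>This treats both connections at once: \<open>u = 0\<close> gives the Christoffel symbols of first kind in the
  definition of the spray, and \<open>u j = - N\<^sub>j\<close> those built from the operators \<open>\<delta>\<^sub>j\<close>. Contracted twice
  with the velocity, both agree.\<close>

lemma contract_christoffel:
  assumes "p \<in> U"
  shows "(\<Sum>j\<in>UNIV. \<Sum>k\<in>UNIV. (pd (axis j 1, u j) (g k r) p + pd (axis k 1, u k) (g j r) p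
      - pd (axis r 1, u r) (g j k) p) * snd p $ j * snd p $ k) = R r p"
proof -
  let ?y = "snd p" and ?D = "\<lambda>j k r. pd (axis j 1, u j) (pd (ay k) (pd (ay r) Q)) p"
  have eq: "(pd (axis j 1, u j) (g k r) p + pd (axis k 1, u k) (g j r) p
      - pd (axis r 1, u r) (g j k) p) * ?y $ j * ?y $ k
    = 1/2 * (?y $ j * (?y $ k * ?D j k r)) + 1/2 * (?y $ k * (?y $ j * ?D k j r))
      - 1/2 * (?y $ k * (?y $ j * ?D r j k))" for j k
  proof -
    have "(1/2 * a + 1/2 * b - 1/2 * c) * s * t = 1/2 * (s * (t * a)) + 1/2 * (t * (s * b)) - 1/2 * (t * (s * c))"
      for a b c s t :: real by (simp add: algebra_simps)
    then show ?thesis unfolding pd_g[OF assms] .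
  qed
  have factor: "(\<Sum>j\<in>A. \<Sum>k\<in>B. c * (a j * (b k * d j k))) = c * (\<Sum>j\<in>A. a j * (\<Sum>k\<in>B. b k * d j k))"
    for A B :: "'n set" and a b d and c :: real
    by (simp only: sum_distrib_left)
  have 1: "(\<Sum>j\<in>UNIV. \<Sum>k\<in>UNIV. 1/2 * (?y $ j * (?y $ k * ?D j k r)))
      = 1/2 * (\<Sum>j\<in>UNIV. ?y $ j * pd (ax j) (pd (ay r) Q) p)"
    by (simp only: factor contract_pd_Dy_Q[OF assms])
  have 2: "(\<Sum>j\<in>UNIV. \<Sum>k\<in>UNIV. 1/2 * (?y $ k * (?y $ j * ?D k j r)))
      = 1/2 * (\<Sum>j\<in>UNIV. ?y $ j * pd (ax j) (pd (ay r) Q) p)"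
    by (subst sum.swap) (rule 1)
  have x: "(\<Sum>k\<in>UNIV. ?y $ k * pd (ax r) (pd (ay k) Q) p) = 2 * pd (ax r) Q p"
    using euler_relation_derivative[OF open_U smooth_Q assms euler_Q, of "ax r"]
      linear_0[OF linear_pd[OF smooth_on_differentiable[OF smooth_Q assms]]] by (simp add: zero_prod_def)
  have 3: "(\<Sum>j\<in>UNIV. \<Sum>k\<in>UNIV. 1/2 * (?y $ k * (?y $ j * ?D r j k))) = pd (ax r) Q p"
    by (subst sum.swap) (simp only: factor contract_pd_Dy_Q[OF assms] x)
  show ?thesis
    unfolding eq sum_subtractf sum.distrib 1 2 3 R_def by simp
qed

text \<open>For coefficients \<open>A\<close> of either connection the inverse metric can be pulled out of the sums, which
  leaves the contraction of the previous lemma.\<close>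

lemma contract_connection:
  assumes "(x, y) \<in> U"
    and A: "\<And>j k. A j k = 1/2 * (\<Sum>r\<in>UNIV. g_up L i r x y *
       (pd (axis j 1, u j) (g k r) (x, y) + pd (axis k 1, u k) (g j r) (x, y)
         - pd (axis r 1, u r) (g j k) (x, y)))"
  shows "(\<Sum>j\<in>UNIV. \<Sum>k\<in>UNIV. A j k * y $ j * y $ k) = 1/2 * (\<Sum>r\<in>UNIV. g_up L i r x y * R r (x, y))"
proof -
  let ?T = "\<lambda>j k r. (pd (axis j 1, u j) (g k r) (x, y) + pd (axis k 1, u k) (g j r) (x, y)
         - pd (axis r 1, u r) (g j k) (x, y)) * y $ j * y $ k"
  have "A j k * y $ j * y $ k = (\<Sum>r\<in>UNIV. 1/2 * g_up L i r x y * ?T j k r)" for j k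
    unfolding A sum_distrib_left sum_distrib_right by (rule sum.cong) (auto simp: mult_ac)
  then have "(\<Sum>j\<in>UNIV. \<Sum>k\<in>UNIV. A j k * y $ j * y $ k)
      = (\<Sum>j\<in>UNIV. \<Sum>k\<in>UNIV. \<Sum>r\<in>UNIV. 1/2 * g_up L i r x y * ?T j k r)" by simp
  also have "\<dots> = (\<Sum>j\<in>UNIV. \<Sum>r\<in>UNIV. \<Sum>k\<in>UNIV. 1/2 * g_up L i r x y * ?T j k r)"
    by (rule sum.cong[OF refl], rule sum.swap)
  also have "\<dots> = (\<Sum>r\<in>UNIV. \<Sum>j\<in>UNIV. \<Sum>k\<in>UNIV. 1/2 * g_up L i r x y * ?T j k r)"
    by (rule sum.swap)
  also have "\<dots> = (\<Sum>r\<in>UNIV. 1/2 * g_up L i r x y * (\<Sum>j\<in>UNIV. \<Sum>k\<in>UNIV. ?T j k r))"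
    by (simp add: sum_distrib_left)
  also have "\<dots> = (\<Sum>r\<in>UNIV. 1/2 * g_up L i r x y * R r (x, y))"
    using contract_christoffel[OF assms(1), of u] by simp
  finally show ?thesis by (simp add: sum_distrib_left mult_ac)
qed

lemma spray_eq:
  assumes "(x, y) \<in> U"
  shows "spray L i x y = 1/4 * (\<Sum>r\<in>UNIV. g_up L i r x y * R r (x, y))"
proof -
  have dx: "dx j (g_low L k r) x y = pd (ax j) (g k r) (x, y)" for j k r
    by (rule dx_eq_pd[OF open_U smooth_g g_low_eq assms])
  have "(\<Sum>j\<in>UNIV. \<Sum>k\<in>UNIV. christoffel L i j k x y * y $ j * y $ k)
      = 1/2 * (\<Sum>r\<in>UNIV. g_up L i r x y * R r (x, y))"
    by (rule contract_connection[OF assms, where u = "\<lambda>_. 0"]) (simp add: christoffel_def dx)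
  then show ?thesis unfolding spray_def by simp
qed

lemma delta_g:
  assumes "(x, y) \<in> U"
  shows "delta L j (g_low L k r) x y
    = pd (axis j 1, \<chi> s. - nonlinear_connection L s j x y) (g k r) (x, y)"
proof -
  have dx: "dx j (g_low L k r) x y = pd (ax j) (g k r) (x, y)" for j
    by (rule dx_eq_pd[OF open_U smooth_g g_low_eq assms])
  have dy: "dy s (g_low L k r) x y = pd (ay s) (g k r) (x, y)" for s
    by (rule dy_eq_pd[OF open_U smooth_g g_low_eq assms])
  have "(\<Sum>i\<in>UNIV. axis j 1 $ i * pd (ax i) (g k r) (x, y)) = pd (ax j) (g k r) (x, y)"
    by (simp add: axis_def if_distrib[of "\<lambda>t. t * _"] cong: if_cong)
  then show ?thesis
    unfolding delta_def dx dy
    by (subst pd_Pair_expand[OF smooth_on_differentiable[OF smooth_g assms]]) (simp add: sum_negf)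
qed

lemma contract_Gamma_h:
  assumes "(x, y) \<in> U"
  shows "(\<Sum>j\<in>UNIV. \<Sum>k\<in>UNIV. Gamma_h L i j k x y * y $ j * y $ k) = 2 * spray L i x y"
  unfolding spray_eq[OF assms]
  by (subst contract_connection[OF assms, where u = "\<lambda>j. \<chi> s. - nonlinear_connection L s j x y"])
     (simp_all add: Gamma_h_def delta_g[OF assms])

lemma Gamma_h_commute:
  assumes "(x, y) \<in> U"
  shows "Gamma_h L i j k x y = Gamma_h L i k j x y"
proof -
  have "pd v (g j k) (x, y) = pd v (g k j) (x, y)" for v j k
    by (rule pd_cong[OF open_U assms g_commute smooth_on_differentiable[OF smooth_g assms]])
  then show ?thesis unfolding Gamma_h_def delta_g[OF assms] by (simp add: algebra_simps)
qed

lemma g_mat_spray: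
  assumes "(x, y) \<in> U"
  shows "g_mat L x y *v (\<chi> i. spray L i x y) = (\<chi> r. 1/4 * R r (x, y))"
proof -
  have "(\<chi> i. spray L i x y) = matrix_inv (g_mat L x y) *v (\<chi> r. 1/4 * R r (x, y))"
    by (simp add: vec_eq_iff spray_eq[OF assms] matrix_vector_mult_def g_up_def sum_divide_distrib)
  moreover have "g_mat L x y ** matrix_inv (g_mat L x y) = mat 1"
    using regular[OF assms] unfolding invertible_def matrix_inv_def by (rule someI2_ex) auto
  ultimately show ?thesis by (simp add: matrix_vector_mul_assoc)
qed

text \<open>The lowered spray is smooth, and Cramer's rule expresses the spray by determinants of smooth
  functions.\<close>

lemma smooth_spray: "smooth_on U (uncurry2 (spray L i))"
proof (rule smooth_on_cong)
  \<comment> \<open>The metric tensor with its \<open>i\<close>-th column replaced by the lowered spray.\<close>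
  let ?M = "\<lambda>p. (\<chi> r j. if j = i then 1/4 * R r p else g r j p)"
  let ?g = "\<lambda>p. (\<chi> r j. g r j p)"
  have g_mat: "g_mat L x y = ?g (x, y)" if "(x, y) \<in> U" for x y
    using that by (simp add: g_mat_def g_low_eq)
  have det: "det (?g p) \<noteq> 0" if "p \<in> U" for p
    using that regular[of "fst p" "snd p"] g_mat[of "fst p" "snd p"] by (simp add: invertible_det_nz)
  have sR: "smooth_on U (R r)" for r
    unfolding R_def[abs_def]
    by (intro smooth_on_diff open_U smooth_on_sum smooth_on_mult smooth_on_coord smooth_on_pd smooth_Q)
  have sM: "smooth_on U (\<lambda>p. ?M p $ r $ j)" for r j
  proof (cases "j = i")
    case True
    then show ?thesis using smooth_on_mult[OF open_U smooth_on_const[of _ "1/4"] sR] by simp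
  qed (simp add: smooth_g)
  show "smooth_on U (\<lambda>p. det (?M p) / det (?g p))"
  proof (rule smooth_on_divide[OF open_U smooth_on_det[OF open_U sM] smooth_on_det[OF open_U]])
    show "smooth_on U (\<lambda>p. ?g p $ r $ j)" for r j using smooth_g[of r j] by simp
  qed (rule det)
  show "det (?M p) / det (?g p) = uncurry2 (spray L i) p" if "p \<in> U" for p
  proof -
    obtain x y where p: "p = (x, y)" by (cases p)
    have "?g p *v (\<chi> i. spray L i x y) = (\<chi> r. 1/4 * R r p)"
      using g_mat_spray[of x y] that p g_mat[of x y] by simp
    from cramer[OF det[OF that], THEN iffD1, OF this, unfolded vec_eq_iff, rule_format, of i]
    show ?thesis by (simp add: p cong: if_cong)
  qed
qed (rule open_U)

text \<open>The geodesic equation multiplied by the metric tensor reads \<open>pd (y, z) (pd (ay i) Q) - pd (ax i) Q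
  = w * pd (ay i) Q\<close>. With \<open>Q = L\<^sup>2\<close> this becomes \<open>L' l\<^sub>i - L E\<^sub>i = w L l\<^sub>i\<close>, where \<open>E\<^sub>i\<close> is the
  Euler-Lagrange expression and \<open>L'\<close> the derivative of \<open>L\<close> along the curve. Contraction with the
  velocity kills \<open>E\<^sub>i\<close> and yields \<open>w L = L'\<close>. So the free function \<open>w\<close> is the logarithmic derivative
  of \<open>L\<close> along the curve, which does not depend on the chart.\<close>

lemma geodesic_equation_iff:
  assumes "(x, y) \<in> U"
  shows "(\<forall>i. z $ i + 2 * spray L i x y = w * y $ i) \<longleftrightarrow>
    (\<forall>i. euler_lagrange i l (x, y) z = 0) \<and> w * l (x, y) = pd (y, z) l (x, y)"
proof -
  let ?p = "(x, y)" and ?G = "\<chi> i. spray L i x y" and ?g = "g_mat L x y"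
  let ?E = "\<lambda>i. euler_lagrange i l ?p z" and ?l' = "pd (y, z) l ?p"
  have dl: "l differentiable at ?p" and dQ: "Q differentiable at ?p"
    and dyl: "pd (ay i) l differentiable at ?p" and dyQ: "pd (ay i) Q differentiable at ?p" for i
    using smooth_on_differentiable assms smooth_l smooth_Q smooth_on_pd by blast+
  have pos: "l ?p > 0" using L_pos[OF assms] by simp
  have gz: "(?g *v u) $ i = 1/2 * (\<Sum>j\<in>UNIV. u $ j * pd (ay j) (pd (ay i) Q) ?p)" for u i
  proof -
    have "g i j ?p = 1/2 * pd (ay j) (pd (ay i) Q) ?p" for j
      unfolding g_def using pd_commute[OF smooth_Q open_U assms] by simp
    then have eq: "g_low L i j x y * u $ j = 1/2 * (u $ j * pd (ay j) (pd (ay i) Q) ?p)" for j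
      unfolding g_low_eq[OF assms] by simp
    show ?thesis
      unfolding sum_distrib_left matrix_vector_mult_def g_mat_def vec_lambda_beta eq by (rule refl)
  qed
  have gy: "(?g *v y) $ i = l ?p * pd (ay i) l ?p" for i
    unfolding gz using euler_Dy_Q[OF assms, of i] by (simp add: pd_Q[OF assms])
  have lhs: "(?g *v (z + 2 *\<^sub>R ?G)) $ i = ?l' * pd (ay i) l ?p - l ?p * ?E i" for i
  proof -
    have "(?g *v (z + 2 *\<^sub>R ?G)) $ i = 1/2 * (pd (y, z) (pd (ay i) Q) ?p - pd (ax i) Q ?p)"
      unfolding matrix_vector_right_distrib matrix_vector_mult_scaleR g_mat_spray[OF assms]
      by (simp add: gz pd_Pair_expand[OF dyQ, of y z] R_def)
    then show ?thesis
      by (simp add: pd_pd_Q[OF assms] pd_Q[OF assms] euler_lagrange_def algebra_simps)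
  qed
  have contr: "(\<Sum>i\<in>UNIV. y $ i * ?E i) = 0"
  proof -
    have 1: "(\<Sum>i\<in>UNIV. y $ i * pd (y, z) (pd (ay i) l) ?p) = pd (y, 0) l ?p"
      using euler_relation_derivative[OF open_U smooth_l assms euler_l, of "(y, z)"]
        linear_add[OF linear_pd[OF dl], of "(y, 0)" "(0, z)"] by simp
    show ?thesis
      unfolding euler_lagrange_def right_diff_distrib sum_subtractf
      using 1 pd_Pair_expand[OF dl, of y 0] by simp
  qed
  have "(\<forall>i. z $ i + 2 * spray L i x y = w * y $ i) \<longleftrightarrow> z + 2 *\<^sub>R ?G = w *\<^sub>R y"
    by (simp add: vec_eq_iff)
  also have "\<dots> \<longleftrightarrow> ?g *v (z + 2 *\<^sub>R ?G) = ?g *v (w *\<^sub>R y)"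
    by (rule inj_eq[OF inj_matrix_vector_mult[OF regular[OF assms]], symmetric])
  also have "\<dots> \<longleftrightarrow> (\<forall>i. ?l' * pd (ay i) l ?p - l ?p * ?E i = w * (l ?p * pd (ay i) l ?p))"
    unfolding vec_eq_iff lhs matrix_vector_mult_scaleR vector_scaleR_component gy real_scaleR_def
    by (rule refl)
  also have "\<dots> \<longleftrightarrow> (\<forall>i. ?E i = 0) \<and> w * l ?p = ?l'"
  proof safe
    assume eq: "\<forall>i. ?l' * pd (ay i) l ?p - l ?p * ?E i = w * (l ?p * pd (ay i) l ?p)"
    have "(\<Sum>i\<in>UNIV. y $ i * (?l' * pd (ay i) l ?p - l ?p * ?E i))
        = (\<Sum>i\<in>UNIV. y $ i * (w * (l ?p * pd (ay i) l ?p)))" using eq by simp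
    also have "(\<Sum>i\<in>UNIV. y $ i * (?l' * pd (ay i) l ?p - l ?p * ?E i))
       = ?l' * (\<Sum>i\<in>UNIV. y $ i * pd (ay i) l ?p) - l ?p * (\<Sum>i\<in>UNIV. y $ i * ?E i)"
      unfolding sum_distrib_left sum_subtractf[symmetric] by (rule sum.cong) (simp_all add: algebra_simps)
    also have "(\<Sum>i\<in>UNIV. y $ i * (w * (l ?p * pd (ay i) l ?p)))
       = w * l ?p * (\<Sum>i\<in>UNIV. y $ i * pd (ay i) l ?p)"
      unfolding sum_distrib_left by (rule sum.cong) simp_all
    finally have "?l' * l ?p = w * l ?p * l ?p"
      using contr euler_l[OF assms] by simp
    then show w: "w * l ?p = ?l'" using pos by simp
    show "?E i = 0" for i using eq[rule_format, of i] pos w[symmetric] by simp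
  next
    fix i assume E: "\<forall>i. ?E i = 0" and w: "w * l ?p = ?l'"
    show "?l' * pd (ay i) l ?p - l ?p * ?E i = w * (l ?p * pd (ay i) l ?p)"
      unfolding E[rule_format] w[symmetric] by simp
  qed
  finally show ?thesis .
qed

text \<open>The acceleration enters through the velocity Hessian of \<open>L\<close>, whose kernel contains \<open>y\<close> by
  homogeneity.\<close>

lemma euler_lagrange_add_velocity:
  assumes "(x, y) \<in> U"
  shows "euler_lagrange i l (x, y) (z + c *\<^sub>R y) = euler_lagrange i l (x, y) z"
proof -
  have d: "pd (ay i) l differentiable at (x, y)"
    using smooth_on_differentiable assms smooth_l smooth_on_pd by blast
  have "(y, z + c *\<^sub>R y) = (y, z) + c *\<^sub>R (0, y)" by simp
  then have "pd (y, z + c *\<^sub>R y) (pd (ay i) l) (x, y)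
      = pd (y, z) (pd (ay i) l) (x, y) + c * pd (0, y) (pd (ay i) l) (x, y)"
    using linear_add[OF linear_pd[OF d], of "(y, z)" "c *\<^sub>R (0, y)"]
      linear_scale[OF linear_pd[OF d], of c "(0, y)"] by simp
  moreover have "pd (0, y) (pd (ay i) l) (x, y) = 0"
    using pd_Pair_expand[OF d, of 0 y] euler_Dy_l[OF assms, of i] by simp
  ultimately show ?thesis by (simp add: euler_lagrange_def)
qed

end

section \<open>The Euler-Lagrange expressions of the changed metric\<close>
lemma pd_partials:
  fixes q :: "real \<times> real \<Rightarrow> real"
  assumes "q differentiable at P"
  shows "pd (r, t) q P = pd (1, 0) q P * r + pd (0, 1) q P * t"
proof -
  have "pd (r *\<^sub>R (1, 0) + t *\<^sub>R (0, 1)) q P = r *\<^sub>R pd (1, 0) q P + t *\<^sub>R pd (0, 1) q P"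
    unfolding linear_add[OF linear_pd[OF assms]] linear_scale[OF linear_pd[OF assms]] ..
  then show ?thesis by simp
qed

lemma partial1_eq_pd:
  assumes "open W" "smooth_on W q" "P \<in> W"
  shows "partial1 q P = pd (1, 0) q P"
proof -
  obtain r t where P: "P = (r, t)" by (cases P)
  have "((\<lambda>h. q ((0, t) + h *\<^sub>R (1, 0))) has_real_derivative pd (1, 0) q ((0, t) + r *\<^sub>R (1, 0))) (at r)"
    by (rule has_real_derivative_line) (use smooth_on_differentiable[OF assms(2,3)] P in simp)
  then show ?thesis unfolding partial1_def P by (simp add: DERIV_imp_deriv)
qed

lemma partial2_eq_pd:
  assumes "open W" "smooth_on W q" "P \<in> W" "\<And>P. P \<in> W \<Longrightarrow> h P = q P"
  shows "partial2 h P = pd (0, 1) q P"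
proof -
  obtain r t where P: "P = (r, t)" by (cases P)
  have hd: "h differentiable at P" 
    by (rule differentiable_cong[OF assms(1,3) _ smooth_on_differentiable[OF assms(2,3)]])
       (simp add: assms(4))
  have "((\<lambda>k. h ((r, 0) + k *\<^sub>R (0, 1))) has_real_derivative pd (0, 1) h ((r, 0) + t *\<^sub>R (0, 1))) (at t)"
    by (rule has_real_derivative_line) (use hd P in simp)
  then have "partial2 h P = pd (0, 1) h P" unfolding partial2_def P by (simp add: DERIV_imp_deriv)
  also have "\<dots> = pd (0, 1) q P"
    by (rule pd_cong[OF assms(1,3) _ smooth_on_differentiable[OF assms(2,3)]]) (simp add: assms(4))
  finally show ?thesis .
qed

text \<open>By homogeneity of degree one, all second partial derivatives of \<open>f\<close> are determined by \<open>f\<^sub>2\<^sub>2\<close>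
  wherever the first argument is nonzero. The relations are the partial derivatives of Euler's relation.\<close>

lemma homogeneous_second_partials:
  fixes f :: "real \<times> real \<Rightarrow> real"
  assumes W: "open W" and f: "smooth_on W f"
    and conic: "\<And>u v r. (u, v) \<in> W \<Longrightarrow> 0 < r \<Longrightarrow> (r * u, r * v) \<in> W"
    and hom: "\<And>u v r. (u, v) \<in> W \<Longrightarrow> 0 < r \<Longrightarrow> f (r * u, r * v) = r * f (u, v)"
    and uv: "(u, v) \<in> W"
  shows "u * pd (0, 1) (pd (1, 0) f) (u, v) = - (v * pd (0, 1) (pd (0, 1) f) (u, v))"
    and "u * pd (1, 0) (pd (1, 0) f) (u, v) = - (v * pd (0, 1) (pd (1, 0) f) (u, v))"
    and "pd (1, 0) (pd (0, 1) f) (u, v) = pd (0, 1) (pd (1, 0) f) (u, v)"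
proof -
  let ?f1 = "pd (1, 0) f" and ?f2 = "pd (0, 1) f"
  have euler: "?f1 P * fst P + ?f2 P * snd P = f P" if P: "P \<in> W" for P
  proof -
    have df: "f differentiable at P" using smooth_on_differentiable[OF f P] .
    have "((\<lambda>h. f (P + h *\<^sub>R P)) has_real_derivative pd P f P) (at 0)"
      using has_real_derivative_line[of f P 0 P] df by simp
    then have "((\<lambda>h. (1 + h) * f P) has_real_derivative pd P f P) (at 0)"
    \<comment> \<open>Along the ray through \<open>P\<close> the function is linear.\<close>
    proof (rule has_field_derivative_transform_within_open[of _ _ _ "{-1<..<1}"])
      show "f (P + h *\<^sub>R P) = (1 + h) * f P" if "h \<in> {-1<..<1}" for h
        using hom[of "fst P" "snd P" "1 + h"] P that
        by (cases P) (simp add: distrib_right)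
    qed auto
    moreover have "((\<lambda>h. (1 + h) * f P) has_real_derivative f P) (at 0)"
      by (auto intro!: derivative_eq_intros)
    ultimately have "pd P f P = f P" by (rule DERIV_unique)
    then show ?thesis using pd_partials[OF df, of "fst P" "snd P"] by simp
  qed
  have d: "((\<lambda>P. ?f1 P * fst P + ?f2 P * snd P) has_derivative
      (\<lambda>w. (?f1 (u, v) * fst w + pd w ?f1 (u, v) * fst (u, v))
         + (?f2 (u, v) * snd w + pd w ?f2 (u, v) * snd (u, v)))) (at (u, v))"
    by (intro has_derivative_add has_derivative_mult has_derivative_fst has_derivative_snd
        has_derivative_ident smooth_on_has_derivative[OF smooth_on_pd[OF f] uv])
  have eq: "(?f1 (u, v) * fst w + pd w ?f1 (u, v) * u) + (?f2 (u, v) * snd w + pd w ?f2 (u, v) * v) = pd w f (u, v)" for w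
  proof -
    have "pd w (\<lambda>P. ?f1 P * fst P + ?f2 P * snd P) (u, v) = pd w f (u, v)"
      by (rule pd_cong[OF W uv _ smooth_on_differentiable[OF f uv]]) (simp add: euler)
    then show ?thesis using pd_eqI[OF d, of w] by simp
  qed
  show 3: "pd (1, 0) ?f2 (u, v) = pd (0, 1) ?f1 (u, v)"
    by (rule pd_commute[OF f W uv])
  show "u * pd (0, 1) ?f1 (u, v) = - (v * pd (0, 1) ?f2 (u, v))"
    using eq[of "(0, 1)"] by (simp add: algebra_simps)
  show "u * pd (1, 0) ?f1 (u, v) = - (v * pd (0, 1) ?f1 (u, v))"
    using eq[of "(1, 0)"] 3 by (simp add: algebra_simps)
qed

text \<open>A generalized \<open>\<beta>\<close>-conformal change in one chart. The function \<open>Lbar\<close> is required to have the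
  defining form only over the chart, since coordinate expressions have arbitrary values elsewhere.\<close>

locale beta_conformal_change = finsler_domain U L
  for U :: "((real ^ 'n::finite) \<times> (real ^ 'n)) set" and L +
  fixes V :: "(real ^ 'n) set" and s :: "real ^ 'n \<Rightarrow> real" and b :: "real ^ 'n \<Rightarrow> real ^ 'n"
    and f :: "real \<times> real \<Rightarrow> real" and W :: "(real \<times> real) set" and Lbar :: "'n coord_fun"
  assumes open_V: "open V" and UV: "\<And>x y. (x, y) \<in> U \<Longrightarrow> x \<in> V"
    and smooth_s: "smooth_on V s" and smooth_b: "smooth_on V b"
    and open_W: "open W" and smooth_f: "smooth_on W f"
    and W_conic: "\<And>u v r. (u, v) \<in> W \<Longrightarrow> 0 < r \<Longrightarrow> (r * u, r * v) \<in> W"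
    and f_homogeneous: "\<And>u v r. (u, v) \<in> W \<Longrightarrow> 0 < r \<Longrightarrow> f (r * u, r * v) = r * f (u, v)"
    and f_arg_W: "\<And>x y. (x, y) \<in> U \<Longrightarrow> f_arg L s b x y \<in> W"
    and Lbar: "\<And>x y. (x, y) \<in> U \<Longrightarrow> Lbar x y = f (f_arg L s b x y)"
begin

text \<open>\<open>\<sigma>\<close>, the components of \<open>\<beta>\<close>, and the two arguments \<open>e\<^sup>\<sigma> L\<close> and \<open>\<beta>\<close> of \<open>f\<close>, as functions of
  position and velocity.\<close>

definition sf where "sf p = s (fst p)"
definition bf where "bf i p = b (fst p) $ i"
definition ua where "ua p = exp (sf p) * l p"
definition va where "va p = (\<Sum>j\<in>UNIV. bf j p * snd p $ j)"

lemma smooth_sf: "smooth_on U sf"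
  unfolding sf_def[abs_def]
  by (rule smooth_on_compose_linear[OF smooth_s bounded_linear_fst open_V]) (use UV in auto)

lemma smooth_bf: "smooth_on U (bf i)"
  unfolding bf_def[abs_def]
  by (rule smooth_on_compose_linear[OF smooth_on_linear_compose[OF smooth_b bounded_linear_vec_nth open_V]
        bounded_linear_fst open_V]) (use UV in auto)

lemma f_arg_eq: "f_arg L s b x y = (ua (x, y), va (x, y))"
  by (simp add: f_arg_def ua_def sf_def va_def bf_def form_def)

lemma uv_W: "p \<in> U \<Longrightarrow> (ua p, va p) \<in> W"
  using f_arg_W[of "fst p" "snd p"] by (simp add: f_arg_eq)

lemma pd_fst_compose:
  assumes "smooth_on V k" "p \<in> U"
  shows "pd w (\<lambda>p. k (fst p)) p = pd (fst w) k (fst p)"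
proof -
  have k: "k differentiable at (fst p)"
    using smooth_on_differentiable[OF assms(1)] UV[of "fst p" "snd p"] assms(2) by simp
  show ?thesis
    by (rule pd_eqI[OF has_derivative_compose[OF has_derivative_fst[OF has_derivative_ident] has_derivative_pd[OF k]]])
qed

lemma pd_ay_sf:
  assumes "p \<in> U"
  shows "pd (ay i) sf p = 0"
proof -
  have "s differentiable at (fst p)"
    using smooth_on_differentiable[OF smooth_s] UV[of "fst p" "snd p"] assms by simp
  then show ?thesis unfolding sf_def[abs_def] pd_fst_compose[OF smooth_s assms]
    using linear_0[OF linear_pd] by simp
qed

lemma pd_ay_bf:
  assumes "p \<in> U"
  shows "pd (ay i) (bf j) p = 0"
proof -
  have sm: "smooth_on V (\<lambda>x. b x $ j)"
    by (rule smooth_on_linear_compose[OF smooth_b bounded_linear_vec_nth open_V])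
  have "(\<lambda>x. b x $ j) differentiable at (fst p)"
    using smooth_on_differentiable[OF sm] UV[of "fst p" "snd p"] assms by simp
  then show ?thesis unfolding bf_def[abs_def] pd_fst_compose[OF sm assms]
    using linear_0[OF linear_pd] by simp
qed

lemma ua_has_derivative:
  assumes "p \<in> U"
  shows "(ua has_derivative (\<lambda>w. exp (sf p) * (pd w sf p * l p + pd w l p))) (at p)"
proof -
  have "((\<lambda>p. exp (sf p)) has_derivative (\<lambda>w. exp (sf p) * pd w sf p)) (at p)"
    using has_derivative_exp[OF smooth_on_has_derivative[OF smooth_sf assms]]
    by (simp add: mult.commute)
  from has_derivative_mult[OF this smooth_on_has_derivative[OF smooth_l assms]]
  show ?thesis unfolding ua_def[abs_def]
    by (rule has_derivative_eq_rhs) (simp add: fun_eq_iff algebra_simps)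
qed

lemma va_has_derivative:
  assumes "p \<in> U"
  shows "(va has_derivative (\<lambda>w. \<Sum>j\<in>UNIV. bf j p * snd w $ j + pd w (bf j) p * snd p $ j)) (at p)"
  unfolding va_def[abs_def]
  by (rule has_derivative_sum, rule has_derivative_mult[OF smooth_on_has_derivative[OF smooth_bf assms]],
      rule bounded_linear_imp_has_derivative[OF bounded_linear_coord(2)])

lemma compose_has_derivative:
  assumes "smooth_on W q" "p \<in> U"
  shows "((\<lambda>p. q (ua p, va p)) has_derivative (\<lambda>w. pd (1, 0) q (ua p, va p) * pd w ua p
      + pd (0, 1) q (ua p, va p) * pd w va p)) (at p)"
proof -
  have u: "(ua has_derivative (\<lambda>w. pd w ua p)) (at p)"
    using ua_has_derivative[OF assms(2)] has_derivative_pd differentiable_def by blast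
  have v: "(va has_derivative (\<lambda>w. pd w va p)) (at p)"
    using va_has_derivative[OF assms(2)] has_derivative_pd differentiable_def by blast
  have q: "q differentiable at (ua p, va p)"
    by (rule smooth_on_differentiable[OF assms(1) uv_W[OF assms(2)]])
  show ?thesis
    by (rule has_derivative_eq_rhs[OF has_derivative_compose[OF has_derivative_Pair[OF u v]
            has_derivative_pd[OF q]]]) (rule ext, rule pd_partials[OF q])
qed

abbreviation f1 where "f1 p \<equiv> pd (1, 0) f (ua p, va p)"
abbreviation f2 where "f2 p \<equiv> pd (0, 1) f (ua p, va p)"
abbreviation lbar where "lbar \<equiv> uncurry2 Lbar"

lemma lbar_eq: "p \<in> U \<Longrightarrow> lbar p = f (ua p, va p)"
  using Lbar[of "fst p" "snd p"] by (cases p) (simp add: f_arg_eq)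

lemma pd_lbar:
  assumes "p \<in> U"
  shows "pd w lbar p = f1 p * pd w ua p + f2 p * pd w va p"
proof -
  note d = compose_has_derivative[OF smooth_f assms]
  have dd: "(\<lambda>p. f (ua p, va p)) differentiable at p"
    using d unfolding differentiable_def by blast
  have "pd w lbar p = pd w (\<lambda>p. f (ua p, va p)) p"
    by (rule pd_cong[OF open_U assms lbar_eq[symmetric] dd])
  then show ?thesis using pd_eqI[OF d] by simp
qed

lemma pd_ay_ua: "p \<in> U \<Longrightarrow> pd (ay i) ua p = exp (sf p) * pd (ay i) l p"
  using pd_eqI[OF ua_has_derivative, of p "ay i"] by (simp add: pd_ay_sf)

lemma pd_ay_va: "p \<in> U \<Longrightarrow> pd (ay i) va p = bf i p"
proof -
  assume p: "p \<in> U"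
  have "(\<Sum>j\<in>UNIV. bf j p * axis i 1 $ j) = bf i p"
    by (simp add: axis_def if_distrib[of "\<lambda>t. _ * t"] cong: if_cong)
  then show ?thesis
    using pd_eqI[OF va_has_derivative[OF p], of "ay i"] by (simp add: pd_ay_bf[OF p])
qed

lemma pd_pd_ay_lbar:
  assumes "p \<in> U"
  shows "pd w (pd (ay i) lbar) p =
    (pd (1, 0) (pd (1, 0) f) (ua p, va p) * pd w ua p + pd (0, 1) (pd (1, 0) f) (ua p, va p) * pd w va p)
      * (exp (sf p) * pd (ay i) l p)
    + f1 p * (exp (sf p) * (pd w sf p * pd (ay i) l p + pd w (pd (ay i) l) p))
    + (pd (1, 0) (pd (0, 1) f) (ua p, va p) * pd w ua p + pd (0, 1) (pd (0, 1) f) (ua p, va p) * pd w va p)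
      * bf i p
    + f2 p * pd w (bf i) p"
proof -
  have e: "((\<lambda>p. exp (sf p) * pd (ay i) l p) has_derivative
      (\<lambda>w. exp (sf p) * (pd w sf p * pd (ay i) l p + pd w (pd (ay i) l) p))) (at p)"
  proof -
    have "((\<lambda>p. exp (sf p)) has_derivative (\<lambda>w. exp (sf p) * pd w sf p)) (at p)"
      using has_derivative_exp[OF smooth_on_has_derivative[OF smooth_sf assms]]
      by (simp add: mult.commute)
    from has_derivative_mult[OF this smooth_on_has_derivative[OF smooth_on_pd[OF smooth_l] assms]]
    show ?thesis by (rule has_derivative_eq_rhs) (simp add: fun_eq_iff algebra_simps)
  qed
  note d = has_derivative_add[OF
      has_derivative_mult[OF compose_has_derivative[OF smooth_on_pd[OF smooth_f] assms] e]
      has_derivative_mult[OF compose_has_derivative[OF smooth_on_pd[OF smooth_f] assms]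
        smooth_on_has_derivative[OF smooth_bf assms]], of "(1, 0)" "(0, 1)" i]
  have dd: "(\<lambda>p. f1 p * (exp (sf p) * pd (ay i) l p) + f2 p * bf i p) differentiable at p"
    using d unfolding differentiable_def by blast
  have "pd w (pd (ay i) lbar) p = pd w (\<lambda>p. f1 p * (exp (sf p) * pd (ay i) l p) + f2 p * bf i p) p"
    by (rule pd_cong[OF open_U assms _ dd]) (simp only: pd_lbar pd_ay_ua pd_ay_va)
  then show ?thesis unfolding pd_eqI[OF d, of w] by (simp only: add_ac)
qed

lemma dx_b: "(x, y) \<in> U \<Longrightarrow> dx j (\<lambda>x y. b x $ i) x y = pd (ax j) (bf i) (x, y)"
  by (rule dx_eq_pd[OF open_U smooth_bf]) (auto simp: bf_def)

lemma pd_bf_eq: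
  assumes "(x, y) \<in> U"
  shows "pd (y, z) (bf i) (x, y) = (\<Sum>j\<in>UNIV. y $ j * pd (ax j) (bf i) (x, y))"
  using pd_Pair_expand[OF smooth_on_differentiable[OF smooth_bf assms], of y z i]
  by (simp add: pd_ay_bf[OF assms])

text \<open>The connection coefficients contracted twice with the velocity give twice the spray, so \<open>E\<^sub>0\<^sub>0\<close> is
  the derivative of \<open>\<beta>\<close> along the geodesics of \<open>L\<close> with \<open>w = 0\<close>.\<close>

lemma E_00_eq:
  assumes p: "(x, y) \<in> U"
  shows "E_00 L b x y = pd (y, - 2 *\<^sub>R (\<chi> i. spray L i x y)) va (x, y)"
proof -
  let ?z = "- 2 *\<^sub>R (\<chi> i. spray L i x y)"
  let ?h = "\<lambda>i j. hcov L b i j x y * y $ i * y $ j"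
  have "E_00 L b x y = (\<Sum>i\<in>UNIV. \<Sum>j\<in>UNIV. 1/2 * ?h i j + 1/2 * ?h j i)"
    unfolding E_00_def E_low_def
    by (rule sum.cong[OF refl], rule sum.cong[OF refl]) (simp add: algebra_simps)
  also have "\<dots> = (\<Sum>i\<in>UNIV. \<Sum>j\<in>UNIV. 1/2 * ?h i j) + (\<Sum>i\<in>UNIV. \<Sum>j\<in>UNIV. 1/2 * ?h j i)"
    by (simp only: sum.distrib)
  also have "(\<Sum>i\<in>UNIV. \<Sum>j\<in>UNIV. 1/2 * ?h j i) = (\<Sum>i\<in>UNIV. \<Sum>j\<in>UNIV. 1/2 * ?h i j)"
    by (rule sum.swap)
  also have "(\<Sum>i\<in>UNIV. \<Sum>j\<in>UNIV. 1/2 * ?h i j) = 1/2 * (\<Sum>i\<in>UNIV. \<Sum>j\<in>UNIV. ?h i j)"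
    by (simp only: sum_distrib_left)
  finally have 1: "E_00 L b x y = (\<Sum>i\<in>UNIV. \<Sum>j\<in>UNIV. ?h i j)" by simp
  have "?h i j = y $ i * (y $ j * pd (ax j) (bf i) (x, y))
      - (\<Sum>m\<in>UNIV. b x $ m * (Gamma_h L m i j x y * y $ i * y $ j))" for i j
    unfolding hcov_def dx_b[OF p] left_diff_distrib sum_distrib_right by (simp add: mult_ac)
  then have "(\<Sum>i\<in>UNIV. \<Sum>j\<in>UNIV. ?h i j) = (\<Sum>i\<in>UNIV. \<Sum>j\<in>UNIV. y $ i * (y $ j * pd (ax j) (bf i) (x, y)))
      - (\<Sum>i\<in>UNIV. \<Sum>j\<in>UNIV. \<Sum>m\<in>UNIV. b x $ m * (Gamma_h L m i j x y * y $ i * y $ j))"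
    by (simp only: sum_subtractf)
  also have "(\<Sum>i\<in>UNIV. \<Sum>j\<in>UNIV. y $ i * (y $ j * pd (ax j) (bf i) (x, y)))
      = (\<Sum>i\<in>UNIV. y $ i * pd (y, ?z) (bf i) (x, y))"
    unfolding pd_bf_eq[OF p] by (simp only: sum_distrib_left)
  also have "(\<Sum>i\<in>UNIV. \<Sum>j\<in>UNIV. \<Sum>m\<in>UNIV. b x $ m * (Gamma_h L m i j x y * y $ i * y $ j))
      = (\<Sum>i\<in>UNIV. \<Sum>m\<in>UNIV. \<Sum>j\<in>UNIV. b x $ m * (Gamma_h L m i j x y * y $ i * y $ j))"
    by (rule sum.cong[OF refl], rule sum.swap)
  also have "\<dots> = (\<Sum>m\<in>UNIV. \<Sum>i\<in>UNIV. \<Sum>j\<in>UNIV. b x $ m * (Gamma_h L m i j x y * y $ i * y $ j))"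
    by (rule sum.swap)
  also have "\<dots> = (\<Sum>m\<in>UNIV. b x $ m * (2 * spray L m x y))"
    unfolding contract_Gamma_h[OF p, symmetric] by (simp only: sum_distrib_left)
  finally have 2: "(\<Sum>i\<in>UNIV. \<Sum>j\<in>UNIV. ?h i j) = (\<Sum>i\<in>UNIV. y $ i * pd (y, ?z) (bf i) (x, y))
      - (\<Sum>m\<in>UNIV. b x $ m * (2 * spray L m x y))" .
  have "pd (y, ?z) va (x, y) = (\<Sum>j\<in>UNIV. bf j (x, y) * ?z $ j) + (\<Sum>j\<in>UNIV. y $ j * pd (y, ?z) (bf j) (x, y))"
    unfolding pd_eqI[OF va_has_derivative[OF p]] snd_conv sum.distrib by (simp only: mult.commute)
  also have "(\<Sum>j\<in>UNIV. bf j (x, y) * ?z $ j) = - (\<Sum>m\<in>UNIV. b x $ m * (2 * spray L m x y))"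
    unfolding sum_negf[symmetric] by (rule sum.cong) (simp_all add: bf_def)
  finally show ?thesis using 1 2 by simp
qed

text \<open>The connection coefficients are symmetric and cancel, so \<open>2 F\<^sub>0\<^sub>i\<close> is the Euler-Lagrange
  expression of \<open>\<beta>\<close>. The acceleration \<open>z\<close> is arbitrary because the components of \<open>\<beta>\<close> depend on the
  position only.\<close>

lemma F_0_eq:
  assumes p: "(x, y) \<in> U"
  shows "2 * F_0 L b i x y = (\<Sum>j\<in>UNIV. y $ j * pd (ax i) (bf j) (x, y)) - pd (y, z) (bf i) (x, y)"
proof -
  have "2 * (F_low L b j i x y * y $ j) = y $ j * pd (ax i) (bf j) (x, y) - y $ j * pd (ax j) (bf i) (x, y)" for j
    unfolding F_low_def hcov_def dx_b[OF p] Gamma_h_commute[OF p, of _ i j] by (simp add: algebra_simps)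
  then show ?thesis
    unfolding F_0_def pd_bf_eq[OF p] sum_distrib_left sum_subtractf[symmetric] by simp
qed

lemma sigma_low_eq: "(x, y) \<in> U \<Longrightarrow> sigma_low s i x y = pd (ax i) sf (x, y)"
  unfolding sigma_low_def by (rule dx_eq_pd[OF open_U smooth_sf]) (auto simp: sf_def)

lemma sigma_0_eq:
  assumes "(x, y) \<in> U"
  shows "sigma_0 s x y = pd (y, z) sf (x, y)"
  using pd_Pair_expand[OF smooth_on_differentiable[OF smooth_sf assms], of y z]
  by (simp add: sigma_0_def sigma_low_eq[OF assms] pd_ay_sf[OF assms] mult.commute)

lemma l_low_eq: "(x, y) \<in> U \<Longrightarrow> l_low L i x y = pd (ay i) l (x, y)"
  unfolding l_low_def by (rule dy_eq_pd[OF open_U smooth_l]) auto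

lemma y_low_eq:
  assumes "(x, y) \<in> U"
  shows "y_low L i x y = L x y * pd (ay i) l (x, y)"
proof -
  have eq: "g_low L i j x y * y $ j = 1/2 * (y $ j * pd (ay j) (pd (ay i) Q) (x, y))" for j
    unfolding g_low_eq[OF assms] g_def pd_commute[OF smooth_Q open_U assms, of "ay i" "ay j"] by simp
  have "y_low L i x y = 1/2 * (\<Sum>j\<in>UNIV. y $ j * pd (ay j) (pd (ay i) Q) (x, y))"
    unfolding y_low_def sum_distrib_left eq by (rule refl)
  then show ?thesis using euler_Dy_Q[OF assms, of i] by (simp add: pd_Q[OF assms])
qed

text \<open>The algebraic core of the next lemma. The homogeneity relations eliminate \<open>f11\<close> and \<open>f12\<close> in
  favour of \<open>f22\<close>, and the remaining terms with \<open>f22\<close> combine to a multiple of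
  \<open>m\<^sub>i = b\<^sub>i - \<beta>/L\<^sup>2 y\<^sub>i\<close>. The quantities \<open>K\<close> and \<open>B\<close> occur in both parts of the Euler-Lagrange
  expression and cancel.\<close>

lemma change_algebra:
  fixes E u v :: real
  assumes "E > 0" "Lv > 0" "u = E * Lv"
    and f12: "u * f12 = - (v * f22)" and f11: "u * f11 = - (v * f12)"
  shows "(Lv)\<^sup>2 * E * (F * F1 / Lv) * si - ((F * F1 / Lv) * Lv * E * li - (F * f22) * v * (bi - v / Lv\<^sup>2 * (Lv * li))) * s0
      + 2 * (F * F2) * F0 - (F * f22) * e00 * (bi - v / Lv\<^sup>2 * (Lv * li))
    = F * ((F1 * (E * (si * Lv + K)) + F2 * (2 * F0 + B))
        - ((f11 * (E * (s0 * Lv)) + f12 * e00) * (E * li) + F1 * (E * (s0 * li + K))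
          + (f12 * (E * (s0 * Lv)) + f22 * e00) * bi + F2 * B))"
proof -
  have L0: "Lv \<noteq> 0" "E \<noteq> 0" using assms by auto
  have e12: "f12 = - (v * f22) / (E * Lv)" using f12 L0 assms(3) by (simp add: field_simps)
  have e11: "f11 = - (v * f12) / (E * Lv)" using f11 L0 assms(3) by (simp add: field_simps)
  show ?thesis unfolding e11 e12 using L0 by (simp add: field_simps power2_eq_square)
qed

text \<open>The meaning of \<open>\<phi>\<^sub>i\<close>: up to the factor \<open>Lbar\<close> it is the Euler-Lagrange expression of the changed
  metric along the geodesics of \<open>L\<close> with acceleration \<open>-2 G\<close>. Along these, \<open>L\<close> is constant and its
  own Euler-Lagrange expressions vanish, so that the terms left in the chain rule for
  \<open>f (e\<^sup>\<sigma> L, \<beta>)\<close> are those due to the variation of \<open>\<sigma>\<close> and \<open>\<beta>\<close>.\<close>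

lemma phi_low_eq:
  assumes p: "(x, y) \<in> U"
  shows "phi_low f L s b i x y
    = Lbar x y * euler_lagrange i lbar (x, y) (- 2 *\<^sub>R (\<chi> i. spray L i x y))"
proof -
  let ?p = "(x, y)" and ?z = "- 2 *\<^sub>R (\<chi> i. spray L i x y)"
  let ?P = "(ua ?p, va ?p)"
  note P = uv_W[OF p]
  \<comment> \<open>The acceleration \<open>?z\<close> solves the geodesic equation with \<open>w = 0\<close>.\<close>
  have geo: "euler_lagrange i l ?p ?z = 0" "pd (y, ?z) l ?p = 0"
    using geodesic_equation_iff[OF p, of ?z 0] by auto
  have f1: "partial1 f ?P = f1 ?p" by (rule partial1_eq_pd[OF open_W smooth_f P])
  have f2: "partial2 f Q = pd (0, 1) f Q" if "Q \<in> W" for Q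
    by (rule partial2_eq_pd[OF open_W smooth_f that]) simp
  have f22: "partial2 (partial2 f) ?P = pd (0, 1) (pd (0, 1) f) ?P"
    by (rule partial2_eq_pd[OF open_W smooth_on_pd[OF smooth_f] P f2])
  have hom: "ua ?p * pd (0, 1) (pd (1, 0) f) ?P = - (va ?p * pd (0, 1) (pd (0, 1) f) ?P)"
    "ua ?p * pd (1, 0) (pd (1, 0) f) ?P = - (va ?p * pd (0, 1) (pd (1, 0) f) ?P)"
    "pd (1, 0) (pd (0, 1) f) ?P = pd (0, 1) (pd (1, 0) f) ?P"
    by (rule homogeneous_second_partials[OF open_W smooth_f _ _ P], erule (1) W_conic,
        erule (1) f_homogeneous)+
  have va: "pd (ax i) va ?p = 2 * F_0 L b i x y + pd (y, ?z) (bf i) ?p"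
    using pd_eqI[OF va_has_derivative[OF p], of "ax i"] F_0_eq[OF p, of i ?z] by (simp add: mult.commute)
  have ua: "pd w ua ?p = exp (s x) * (pd w sf ?p * L x y + pd w l ?p)" for w
    using pd_eqI[OF ua_has_derivative[OF p], of w] by (simp add: sf_def)
  have "phi_low f L s b i x y = 
    (L x y)\<^sup>2 * exp (s x) * (f ?P * f1 ?p / L x y) * pd (ax i) sf ?p
     - ((f ?P * f1 ?p / L x y) * L x y * exp (s x) * pd (ay i) l ?p
        - (f ?P * pd (0, 1) (pd (0, 1) f) ?P) * va ?p * (b x $ i - va ?p / (L x y)\<^sup>2 * (L x y * pd (ay i) l ?p)))
       * pd (y, ?z) sf ?p
     + 2 * (f ?P * f2 ?p) * F_0 L b i x y
     - (f ?P * pd (0, 1) (pd (0, 1) f) ?P) * pd (y, ?z) va ?p * (b x $ i - va ?p / (L x y)\<^sup>2 * (L x y * pd (ay i) l ?p))"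
  proof -
    have form: "form b x y = va ?p" by (simp add: form_def va_def bf_def)
    show ?thesis
      unfolding phi_low_def p_coef_def q_coef_def q0_coef_def f_arg_eq m_low_def y_low_eq[OF p]
        l_low_eq[OF p] sigma_low_eq[OF p] sigma_0_eq[OF p, of ?z] E_00_eq[OF p] f1 f2[OF P] f22 form
      by (rule refl)
  qed
  also have "\<dots> = f ?P * ((f1 ?p * (exp (s x) * (pd (ax i) sf ?p * L x y + pd (ax i) l ?p))
          + f2 ?p * (2 * F_0 L b i x y + pd (y, ?z) (bf i) ?p))
        - ((pd (1, 0) (pd (1, 0) f) ?P * (exp (s x) * (pd (y, ?z) sf ?p * L x y))
            + pd (0, 1) (pd (1, 0) f) ?P * pd (y, ?z) va ?p) * (exp (s x) * pd (ay i) l ?p)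
          + f1 ?p * (exp (s x) * (pd (y, ?z) sf ?p * pd (ay i) l ?p + pd (ax i) l ?p))
          + (pd (0, 1) (pd (1, 0) f) ?P * (exp (s x) * (pd (y, ?z) sf ?p * L x y))
            + pd (0, 1) (pd (0, 1) f) ?P * pd (y, ?z) va ?p) * b x $ i
          + f2 ?p * pd (y, ?z) (bf i) ?p))"
    by (rule change_algebra[OF exp_gt_zero L_pos[OF p] _ hom(1,2)]) (simp add: ua_def sf_def)
  also have "\<dots> = Lbar x y * euler_lagrange i lbar ?p ?z"
  proof -
    have K: "pd (y, ?z) (pd (ay i) l) ?p = pd (ax i) l ?p"
      using geo(1) by (simp add: euler_lagrange_def)
    have bi: "bf i ?p = b x $ i" "sf ?p = s x" by (simp_all add: bf_def sf_def)
    have u': "pd (y, ?z) ua ?p = exp (s x) * (pd (y, ?z) sf ?p * L x y)"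
      unfolding ua geo(2) by simp
    show ?thesis
      unfolding euler_lagrange_def snd_conv pd_lbar[OF p, of "ax i"] pd_pd_ay_lbar[OF p] K u' va bi
        ua[of "ax i"] Lbar[OF p] f_arg_eq
      by (subst hom(3)) (rule refl)
  qed
  finally show ?thesis .
qed

end

section \<open>Change of coordinates\<close>
lemma pd_component:
  fixes \<tau> :: "'a::real_normed_vector \<Rightarrow> real ^ 'n::finite"
  assumes "\<tau> differentiable at x"
  shows "pd w (\<lambda>x. \<tau> x $ k) x = pd w \<tau> x $ k"
  by (rule pd_eqI[OF bounded_linear.has_derivative[OF bounded_linear_vec_nth has_derivative_pd[OF assms]]])

lemma pd_commute_vec:
  fixes \<tau> :: "'a::real_normed_vector \<Rightarrow> real ^ 'n::finite"
  assumes N: "open N" "x \<in> N" and \<tau>: "smooth_on N \<tau>"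
  shows "pd v (pd w \<tau>) x = pd w (pd v \<tau>) x"
proof -
  have "pd v (pd w \<tau>) x $ k = pd v (pd w (\<lambda>x. \<tau> x $ k)) x" for v w k
  proof -
    have sk: "smooth_on N (\<lambda>x. \<tau> x $ k)"
      by (rule smooth_on_linear_compose[OF \<tau> bounded_linear_vec_nth N(1)])
    have "pd v (pd w \<tau>) x $ k = pd v (\<lambda>x. pd w \<tau> x $ k) x"
      by (rule pd_component[symmetric, OF smooth_on_differentiable[OF smooth_on_pd[OF \<tau>] N(2)]])
    also have "\<dots> = pd v (pd w (\<lambda>x. \<tau> x $ k)) x"
      by (rule pd_cong[OF N pd_component[OF smooth_on_differentiable[OF \<tau>]]
            smooth_on_differentiable[OF smooth_on_pd[OF sk] N(2)]])
    finally show ?thesis .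
  qed
  moreover have "pd v (pd w (\<lambda>x. \<tau> x $ k)) x = pd w (pd v (\<lambda>x. \<tau> x $ k)) x" for k
    by (rule pd_commute[OF smooth_on_linear_compose[OF \<tau> bounded_linear_vec_nth N(1)] N])
  ultimately show ?thesis by (simp add: vec_eq_iff)
qed

text \<open>The action of a coordinate change \<open>\<tau>\<close> on pairs of position and velocity, and, in the next
  definition, the velocity component of its derivative. Applied to \<open>(y, z)\<close> at \<open>(x, y)\<close> the latter
  gives the transformed acceleration.\<close>

definition prolong :: "(real ^ 'n::finite \<Rightarrow> real ^ 'n) \<Rightarrow> (real ^ 'n) \<times> (real ^ 'n) \<Rightarrow> (real ^ 'n) \<times> (real ^ 'n)"
  where "prolong \<tau> p = (\<tau> (fst p), pd (snd p) \<tau> (fst p))"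

definition second_prolong :: "(real ^ 'n::finite \<Rightarrow> real ^ 'n) \<Rightarrow> (real ^ 'n) \<times> (real ^ 'n) \<Rightarrow> (real ^ 'n) \<times> (real ^ 'n) \<Rightarrow> real ^ 'n"
  where "second_prolong \<tau> p w = pd (snd w) \<tau> (fst p)
    + (\<Sum>j\<in>UNIV. snd p $ j *\<^sub>R pd (fst w) (pd (axis j 1) \<tau>) (fst p))"

lemma pd_axis_expand:
  fixes \<tau> :: "real ^ 'n::finite \<Rightarrow> 'b::real_normed_vector"
  assumes "\<tau> differentiable at x"
  shows "pd y \<tau> x = (\<Sum>j\<in>UNIV. y $ j *\<^sub>R pd (axis j 1) \<tau> x)"
proof -
  note lin = linear_pd[OF assms]
  have "pd (\<Sum>j\<in>UNIV. y $ j *\<^sub>R axis j 1) \<tau> x = (\<Sum>j\<in>UNIV. y $ j *\<^sub>R pd (axis j 1) \<tau> x)"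
    unfolding linear_sum[OF lin, of "\<lambda>j. y $ j *\<^sub>R axis j 1" UNIV] linear_scale[OF lin] ..
  then show ?thesis by (simp flip: vec_eq_sum_axis)
qed

lemma prolong_has_derivative:
  assumes N: "open N" and \<tau>: "smooth_on N \<tau>" and p: "fst p \<in> N"
  shows "(prolong \<tau> has_derivative (\<lambda>w. (pd (fst w) \<tau> (fst p), second_prolong \<tau> p w))) (at p)"
proof -
  have fst': "(fst has_derivative fst) (at p)"
    by (rule bounded_linear_imp_has_derivative[OF bounded_linear_fst])
  have 1: "((\<lambda>p. \<tau> (fst p)) has_derivative (\<lambda>w. pd (fst w) \<tau> (fst p))) (at p)"
    by (rule has_derivative_compose[OF fst' smooth_on_has_derivative[OF \<tau> p]])
  have 2: "((\<lambda>p. snd p $ j *\<^sub>R pd (axis j 1) \<tau> (fst p)) has_derivative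
      (\<lambda>w. snd p $ j *\<^sub>R pd (fst w) (pd (axis j 1) \<tau>) (fst p) + snd w $ j *\<^sub>R pd (axis j 1) \<tau> (fst p))) (at p)" for j
    by (rule has_derivative_scaleR[OF bounded_linear_imp_has_derivative[OF bounded_linear_coord(2)]
          has_derivative_compose[OF fst' smooth_on_has_derivative[OF smooth_on_pd[OF \<tau>] p]]])
  have 3: "((\<lambda>p. \<Sum>j\<in>UNIV. snd p $ j *\<^sub>R pd (axis j 1) \<tau> (fst p)) has_derivative
      second_prolong \<tau> p) (at p)"
    by (rule has_derivative_eq_rhs[OF has_derivative_sum[OF 2]])
       (simp add: fun_eq_iff second_prolong_def sum.distrib
          pd_axis_expand[OF smooth_on_differentiable[OF \<tau> p], of "snd _"] add.commute)
  have 4: "((\<lambda>p. pd (snd p) \<tau> (fst p)) has_derivative second_prolong \<tau> p) (at p)"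
  proof (rule has_derivative_transform_within_open[OF 3])
    show "open (fst -` N)" by (intro open_vimage_fst N)
    show "p \<in> fst -` N" using p by simp
    show "(\<Sum>j\<in>UNIV. snd q $ j *\<^sub>R pd (axis j 1) \<tau> (fst q)) = pd (snd q) \<tau> (fst q)" if "q \<in> fst -` N" for q
      by (rule pd_axis_expand[symmetric, OF smooth_on_differentiable[OF \<tau>]]) (use that in simp)
  qed
  show ?thesis unfolding prolong_def[abs_def] by (rule has_derivative_Pair[OF 1 4])
qed

text \<open>The Euler-Lagrange expressions form a covector. The second derivatives of \<open>\<tau>\<close> enter once through
  the position derivative of the transformed velocity and once through the derivative of the Jacobian
  along the curve; these two contributions cancel because second derivatives commute.\<close>

lemma euler_lagrange_covariant:
  fixes H H' :: "(real ^ 'n::finite) \<times> (real ^ 'n) \<Rightarrow> real"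
  assumes N: "open N" and \<tau>: "smooth_on N \<tau>"
    and U: "open U" "open U'" and H: "smooth_on U H" "smooth_on U' H'"
    and dom: "\<And>q. q \<in> U \<Longrightarrow> fst q \<in> N \<Longrightarrow> prolong \<tau> q \<in> U'"
    and eq: "\<And>q. q \<in> U \<Longrightarrow> fst q \<in> N \<Longrightarrow> H q = H' (prolong \<tau> q)"
    and p: "(x, y) \<in> U" "x \<in> N"
  shows "euler_lagrange i H (x, y) z
    = (\<Sum>k\<in>UNIV. pd (axis i 1) \<tau> x $ k
        * euler_lagrange k H' (prolong \<tau> (x, y)) (second_prolong \<tau> (x, y) (y, z)))"
proof -
  let ?S = "U \<inter> fst -` N" and ?p = "(x, y)"
  have S: "open ?S" by (intro open_Int U open_vimage_fst N)
  have pS: "?p \<in> ?S" using p by simp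
  have comp: "((\<lambda>q. K (prolong \<tau> q)) has_derivative
      (\<lambda>w. pd (pd (fst w) \<tau> (fst q), second_prolong \<tau> q w) K (prolong \<tau> q))) (at q)"
    if "smooth_on U' K" "q \<in> ?S" for K :: "(real ^ 'n) \<times> (real ^ 'n) \<Rightarrow> real" and q
    by (rule has_derivative_compose[OF prolong_has_derivative[OF N \<tau>]
          smooth_on_has_derivative[OF that(1) dom]]) (use that(2) in auto)
  have pdH: "pd w H q = pd (pd (fst w) \<tau> (fst q), second_prolong \<tau> q w) H' (prolong \<tau> q)" if q: "q \<in> ?S" for w q
  proof -
    have d: "(\<lambda>q. H' (prolong \<tau> q)) differentiable at q"
      using comp[OF H(2) q] unfolding differentiable_def by blast
    have "pd w H q = pd w (\<lambda>q. H' (prolong \<tau> q)) q"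
      by (rule pd_cong[OF S q _ d]) (simp add: eq)
    then show ?thesis using pd_eqI[OF comp[OF H(2) q]] by simp
  qed
  have dH': "H' differentiable at (prolong \<tau> q)" if "q \<in> ?S" for q
    using smooth_on_differentiable[OF H(2)] dom that by simp
  have zero: "pd 0 (K :: real ^ 'n \<Rightarrow> real ^ 'n) x = 0" if "smooth_on N K" "x \<in> N" for K x
    by (rule linear_0[OF linear_pd[OF smooth_on_differentiable[OF that]]])
  have pd_ay: "pd (ay i) H q = (\<Sum>k\<in>UNIV. pd (axis i 1) \<tau> (fst q) $ k * pd (ay k) H' (prolong \<tau> q))"
    if q: "q \<in> ?S" for q
  proof -
    have "second_prolong \<tau> q (ay i) = pd (axis i 1) \<tau> (fst q)"
      using q by (simp add: second_prolong_def zero[OF smooth_on_pd[OF \<tau>]])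
    then show ?thesis
      using pdH[OF q, of "ay i"] pd_Pair_expand[OF dH'[OF q], of 0 "pd (axis i 1) \<tau> (fst q)"] q zero[OF \<tau>]
      by simp
  qed
  have d1: "((\<lambda>q. pd (axis i 1) \<tau> (fst q) $ k) has_derivative
      (\<lambda>w. pd (fst w) (pd (axis i 1) \<tau>) x $ k)) (at ?p)" for k
  proof -
    have fst': "(fst has_derivative fst) (at ?p)"
      by (rule bounded_linear_imp_has_derivative[OF bounded_linear_fst])
    have "(pd (axis i 1) \<tau> has_derivative (\<lambda>w. pd w (pd (axis i 1) \<tau>) x)) (at (fst ?p))"
      using smooth_on_has_derivative[OF smooth_on_pd[OF \<tau>] p(2)] by simp
    from bounded_linear.has_derivative[OF bounded_linear_vec_nth has_derivative_compose[OF fst' this]]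
    show ?thesis .
  qed
  have d2: "((\<lambda>q. \<Sum>k\<in>UNIV. pd (axis i 1) \<tau> (fst q) $ k * pd (ay k) H' (prolong \<tau> q)) has_derivative
      (\<lambda>w. \<Sum>k\<in>UNIV. pd (axis i 1) \<tau> x $ k
          * pd (pd (fst w) \<tau> x, second_prolong \<tau> ?p w) (pd (ay k) H') (prolong \<tau> ?p)
        + pd (fst w) (pd (axis i 1) \<tau>) x $ k * pd (ay k) H' (prolong \<tau> ?p))) (at ?p)"
    by (rule has_derivative_sum)
       (use has_derivative_mult[OF d1 comp[OF smooth_on_pd[OF H(2)] pS]] in simp)
  have dd2: "(\<lambda>q. \<Sum>k\<in>UNIV. pd (axis i 1) \<tau> (fst q) $ k * pd (ay k) H' (prolong \<tau> q)) differentiable at ?p"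
    using d2 unfolding differentiable_def by blast
  let ?q = "prolong \<tau> ?p" and ?z = "second_prolong \<tau> ?p (y, z)"
  have A: "pd (y, z) (pd (ay i) H) ?p = (\<Sum>k\<in>UNIV. pd (axis i 1) \<tau> x $ k * pd (snd ?q, ?z) (pd (ay k) H') ?q
      + pd y (pd (axis i 1) \<tau>) x $ k * pd (ay k) H' ?q)"
  proof -
    have "pd (y, z) (pd (ay i) H) ?p
      = pd (y, z) (\<lambda>q. \<Sum>k\<in>UNIV. pd (axis i 1) \<tau> (fst q) $ k * pd (ay k) H' (prolong \<tau> q)) ?p"
      by (rule pd_cong[OF S pS pd_ay[symmetric] dd2])
    then show ?thesis unfolding pd_eqI[OF d2] by (simp add: prolong_def)
  qed
  have s: "second_prolong \<tau> ?p (ax i) = pd y (pd (axis i 1) \<tau>) x"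
  proof -
    have "pd y (pd (axis i 1) \<tau>) x = (\<Sum>j\<in>UNIV. y $ j *\<^sub>R pd (axis j 1) (pd (axis i 1) \<tau>) x)"
      by (rule pd_axis_expand[OF smooth_on_differentiable[OF smooth_on_pd[OF \<tau>] p(2)]])
    also have "\<dots> = (\<Sum>j\<in>UNIV. y $ j *\<^sub>R pd (axis i 1) (pd (axis j 1) \<tau>) x)"
      by (rule sum.cong[OF refl], subst pd_commute_vec[OF N p(2) \<tau>], rule refl)
    finally show ?thesis by (simp add: second_prolong_def zero[OF \<tau> p(2)])
  qed
  have B: "pd (ax i) H ?p = (\<Sum>k\<in>UNIV. pd (axis i 1) \<tau> x $ k * pd (ax k) H' ?q)
      + (\<Sum>k\<in>UNIV. pd y (pd (axis i 1) \<tau>) x $ k * pd (ay k) H' ?q)"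
    unfolding pdH[OF pS] s fst_conv by (rule pd_Pair_expand[OF dH'[OF pS]])
  show ?thesis
    unfolding euler_lagrange_def snd_conv A B right_diff_distrib sum_subtractf sum.distrib by simp
qed

section \<open>Charts and tangent vectors\<close>

definition overlap :: "('m, 'n) chart \<Rightarrow> ('m, 'n) chart \<Rightarrow> (real ^ 'n) set" where
  "overlap c c' = snd c ` (fst c \<inter> fst c')"

locale smooth_manifold =
  fixes \<A> :: "('m::{t2_space, second_countable_topology}, 'n::finite) chart set"
  assumes atlas: "smooth_atlas \<A>"
begin

lemma chart_homeomorphism: "c \<in> \<A> \<Longrightarrow> homeomorphism (fst c) (chart_range c) (snd c) (chart_inv c)"
  and open_chart: "c \<in> \<A> \<Longrightarrow> open (fst c)"
  and open_chart_range: "c \<in> \<A> \<Longrightarrow> open (chart_range c)"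
  and smooth_transition: "c \<in> \<A> \<Longrightarrow> c' \<in> \<A> \<Longrightarrow> smooth_on (overlap c c') (transition c c')"
  using atlas by (auto simp: smooth_atlas_def overlap_def)

lemma chart_inv_chart: "c \<in> \<A> \<Longrightarrow> p \<in> fst c \<Longrightarrow> chart_inv c (snd c p) = p"
  using chart_homeomorphism homeomorphism_apply1 by metis

lemma chart_chart_inv: "c \<in> \<A> \<Longrightarrow> x \<in> chart_range c \<Longrightarrow> snd c (chart_inv c x) = x"
  using chart_homeomorphism homeomorphism_apply2 by metis

lemma chart_inv_in: "c \<in> \<A> \<Longrightarrow> x \<in> chart_range c \<Longrightarrow> chart_inv c x \<in> fst c"
  using chart_homeomorphism homeomorphism_image2 by (metis imageI)

lemma chart_in_range: "p \<in> fst c \<Longrightarrow> snd c p \<in> chart_range c"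
  by (simp add: chart_range_def)

lemma overlap_iff:
  assumes "c \<in> \<A>"
  shows "x \<in> overlap c c' \<longleftrightarrow> x \<in> chart_range c \<and> chart_inv c x \<in> fst c'"
proof
  assume "x \<in> overlap c c'"
  then obtain p where "p \<in> fst c" "p \<in> fst c'" "x = snd c p" by (auto simp: overlap_def)
  then show "x \<in> chart_range c \<and> chart_inv c x \<in> fst c'"
    using chart_inv_chart[OF assms] chart_in_range[of p c] by simp
next
  assume x: "x \<in> chart_range c \<and> chart_inv c x \<in> fst c'"
  then have "x = snd c (chart_inv c x)" "chart_inv c x \<in> fst c \<inter> fst c'"
    using chart_chart_inv[OF assms] chart_inv_in[OF assms] by auto
  then show "x \<in> overlap c c'" unfolding overlap_def by (rule image_eqI)
qed

lemma open_overlap: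
  assumes "c \<in> \<A>" "c' \<in> \<A>"
  shows "open (overlap c c')"
proof -
  have "openin (top_of_set (chart_range c)) (snd c ` (fst c \<inter> fst c'))"
    by (rule homeomorphism_imp_open_map[OF chart_homeomorphism[OF assms(1)]])
       (rule openin_open_Int[OF open_chart[OF assms(2)]])
  then show ?thesis
    unfolding overlap_def using open_chart_range[OF assms(1)] openin_open_trans by blast
qed

lemma transition_overlap:
  assumes "c \<in> \<A>" "c' \<in> \<A>" "x \<in> overlap c c'"
  shows "chart_inv c' (transition c c' x) = chart_inv c x" "transition c c' x \<in> overlap c' c"
    "transition c c' x \<in> chart_range c'"
  using assms by (auto simp: overlap_iff transition_def chart_inv_chart chart_inv_in chart_in_range)

lemma transition_differentiable:
  "c \<in> \<A> \<Longrightarrow> c' \<in> \<A> \<Longrightarrow> x \<in> overlap c c' \<Longrightarrow> transition c c' differentiable at x"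
  by (rule smooth_on_differentiable[OF smooth_transition])

lemma tangent_of_eq:
  assumes "c \<in> \<A>" "c' \<in> \<A>" "x \<in> overlap c c'"
  shows "tangent_of \<A> c x y c' = pd y (transition c c') x"
  using assms by (simp add: tangent_of_def overlap_iff pd_def)

text \<open>The cocycle rule for Jacobians. It makes the tangent vector with given components independent of
  the chart in which the components are given.\<close>

lemma transition_compose:
  assumes c: "c \<in> \<A>" "c' \<in> \<A>" "c'' \<in> \<A>" and x: "x \<in> overlap c c'" "x \<in> overlap c c''"
  shows "pd y (transition c c'') x = pd (pd y (transition c c') x) (transition c' c'') (transition c c' x)"
proof -
  have x': "transition c c' x \<in> overlap c' c''"
    using x transition_overlap[OF c(1,2) x(1)] c by (simp add: overlap_iff)
  have d: "((\<lambda>x. transition c' c'' (transition c c' x)) has_derivative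
      (\<lambda>y. pd (pd y (transition c c') x) (transition c' c'') (transition c c' x))) (at x)"
    by (rule has_derivative_compose[OF has_derivative_pd has_derivative_pd])
       (intro transition_differentiable c x x')+
  have dd: "(\<lambda>x. transition c' c'' (transition c c' x)) differentiable at x"
    using d unfolding differentiable_def by blast
  have "pd y (transition c c'') x = pd y (\<lambda>x. transition c' c'' (transition c c' x)) x"
  proof (rule pd_cong[OF _ _ _ dd])
    show "open (overlap c c' \<inter> overlap c c'')" by (intro open_Int open_overlap c)
    show "x \<in> overlap c c' \<inter> overlap c c''" using x by simp
    show "transition c' c'' (transition c c' q) = transition c c'' q" if "q \<in> overlap c c' \<inter> overlap c c''" for q
      using that transition_overlap(1)[OF c(1,2)] by (simp add: transition_def)
  qed
  then show ?thesis using pd_eqI[OF d] by simp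
qed

lemma point_of_transition:
  assumes c: "c \<in> \<A>" "c' \<in> \<A>" and x: "x \<in> overlap c c'"
  shows "point_of \<A> c' (transition c c' x) (pd y (transition c c') x) = point_of \<A> c x y"
proof -
  note t = transition_overlap[OF c x]
  have "tangent_of \<A> c' (transition c c' x) (pd y (transition c c') x) c'' = tangent_of \<A> c x y c''" for c''
  proof (cases "c'' \<in> \<A> \<and> chart_inv c x \<in> fst c''")
    case True
    then have o: "c'' \<in> \<A>" "x \<in> overlap c c''" "transition c c' x \<in> overlap c' c''"
      using x t c by (auto simp: overlap_iff)
    show ?thesis
      unfolding tangent_of_eq[OF c(1) o(1,2)] tangent_of_eq[OF c(2) o(1,3)]
      by (rule transition_compose[OF c o(1) x o(2), symmetric])
  next
    case False
    then show ?thesis unfolding tangent_of_def t(1) by auto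
  qed
  then show ?thesis by (simp add: point_of_def t(1) fun_eq_iff)
qed

lemma prolong_loc_dom:
  assumes "c \<in> \<A>" "c' \<in> \<A>" "q \<in> loc_dom \<A> c D" "fst q \<in> overlap c c'"
  shows "prolong (transition c c') q \<in> loc_dom \<A> c' D"
    and "uncurry2 (loc \<A> c' L) (prolong (transition c c') q) = uncurry2 (loc \<A> c L) q"
  using point_of_transition[OF assms(1,2,4), of "snd q"] assms(3) transition_overlap[OF assms(1,2,4)]
  by (auto simp: prolong_def loc_dom_def loc_def uncurry2_def)

lemma point_of_scaleR:
  assumes c: "c \<in> \<A>" and x: "x \<in> chart_range c"
  shows "point_of \<A> c x (r *\<^sub>R y) = (fst (point_of \<A> c x y), \<lambda>c'. r *\<^sub>R snd (point_of \<A> c x y) c')"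
proof -
  have "tangent_of \<A> c x (r *\<^sub>R y) c' = r *\<^sub>R tangent_of \<A> c x y c'" for c'
  proof (cases "c' \<in> \<A> \<and> chart_inv c x \<in> fst c'")
    case True
    then have o: "c' \<in> \<A>" "x \<in> overlap c c'" using x c by (auto simp: overlap_iff)
    show ?thesis
      unfolding tangent_of_eq[OF c o]
      by (rule linear_scale[OF linear_pd[OF transition_differentiable[OF c o]]])
  qed (auto simp: tangent_of_def)
  then show ?thesis by (simp add: point_of_def fun_eq_iff)
qed

lemma finsler_domain_chart:
  assumes "finsler_metric \<A> D L" and c: "c \<in> \<A>"
  shows "finsler_domain (loc_dom \<A> c D) (loc \<A> c L)"
proof
  note F = assms(1)[unfolded finsler_metric_def conic_domain_def]
  show "open (loc_dom \<A> c D)" using F c by blast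
  have "(\<lambda>(x, y). loc \<A> c L x y) = uncurry2 (loc \<A> c L)" by (auto simp: uncurry2_def)
  then show "smooth_on (loc_dom \<A> c D) (uncurry2 (loc \<A> c L))" using F c by metis
  fix x y assume p: "(x, y) \<in> loc_dom \<A> c D"
  then have x: "x \<in> chart_range c" and D: "point_of \<A> c x y \<in> D" by (auto simp: loc_dom_def)
  show "0 < loc \<A> c L x y" using F D by (simp add: loc_def)
  show "invertible (g_mat (loc \<A> c L) x y)" using F c p by blast
  fix r :: real assume r: "0 < r"
  obtain m v where mv: "point_of \<A> c x y = (m, v)" by (cases "point_of \<A> c x y")
  have eq: "point_of \<A> c x (r *\<^sub>R y) = (m, \<lambda>c. r *\<^sub>R v c)"
    using point_of_scaleR[OF c x, of r y] mv by simp
  show "(x, r *\<^sub>R y) \<in> loc_dom \<A> c D"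
    using F D r mv x unfolding loc_dom_def by (simp add: eq)
  show "loc \<A> c L x (r *\<^sub>R y) = r * loc \<A> c L x y"
    using F D r mv unfolding loc_def eq by simp
qed

end

section \<open>Geodesics as extremals\<close>
definition coord_curve :: "('m, 'n::finite) chart \<Rightarrow> (real \<Rightarrow> 'm) \<Rightarrow> real \<Rightarrow> real ^ 'n" where
  "coord_curve c \<gamma> = snd c \<circ> \<gamma>"

definition coord_velocity :: "('m, 'n::finite) chart \<Rightarrow> (real \<Rightarrow> 'm) \<Rightarrow> real \<Rightarrow> real ^ 'n" where
  "coord_velocity c \<gamma> t = vector_derivative (coord_curve c \<gamma>) (at t)"

definition twice_differentiable_at :: "('m, 'n::finite) chart \<Rightarrow> (real \<Rightarrow> 'm) \<Rightarrow> real \<Rightarrow> bool" where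
  "twice_differentiable_at c \<gamma> t \<longleftrightarrow>
     coord_curve c \<gamma> differentiable at t \<and> coord_velocity c \<gamma> differentiable at t"

text \<open>The part of the definition of a geodesic that does not involve the Finsler function.\<close>

definition regular_curve ::
  "('m::topological_space, 'n::finite) chart set \<Rightarrow> ('m \<times> ('m, 'n) tvec) set \<Rightarrow> real set \<Rightarrow> (real \<Rightarrow> 'm) \<Rightarrow> bool" where
  "regular_curve \<A> D I \<gamma> \<longleftrightarrow>
     continuous_on I \<gamma> \<and> \<gamma> ` I \<subseteq> manifold \<A> \<and> (\<forall>t\<in>I. (\<gamma> t, velocity \<A> \<gamma> t) \<in> D) \<and>
     (\<forall>c\<in>\<A>. \<forall>t\<in>I. \<gamma> t \<in> fst c \<longrightarrow> twice_differentiable_at c \<gamma> t)"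

definition extremal_at ::
  "('m, 'n::finite) chart set \<Rightarrow> ('m \<times> ('m, 'n) tvec \<Rightarrow> real) \<Rightarrow> ('m, 'n) chart \<Rightarrow> (real \<Rightarrow> 'm) \<Rightarrow> real \<Rightarrow> bool" where
  "extremal_at \<A> L c \<gamma> t \<longleftrightarrow> (\<forall>i. euler_lagrange i (uncurry2 (loc \<A> c L))
     (coord_curve c \<gamma> t, coord_velocity c \<gamma> t) (vector_derivative (coord_velocity c \<gamma>) (at t)) = 0)"

context smooth_manifold
begin

lemma open_curve_preimage:
  assumes "open I" "continuous_on I \<gamma>" "open T"
  shows "open {t \<in> I. \<gamma> t \<in> T}"
proof -
  have "{t \<in> I. \<gamma> t \<in> T} = \<gamma> -` T \<inter> I" by auto
  then show ?thesis using continuous_on_open_vimage[OF assms(1)] assms(2,3) by metis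
qed

lemma coord_curve_change:
  assumes I: "open I" "continuous_on I \<gamma>" and c: "c \<in> \<A>" "c' \<in> \<A>"
    and t: "t \<in> I" "\<gamma> t \<in> fst c" "\<gamma> t \<in> fst c'"
    and d: "coord_curve c \<gamma> differentiable at t"
  shows "(coord_curve c' \<gamma> has_vector_derivative
      pd (coord_velocity c \<gamma> t) (transition c c') (coord_curve c \<gamma> t)) (at t)"
proof -
  have o: "coord_curve c \<gamma> t \<in> overlap c c'" using t by (auto simp: overlap_def coord_curve_def)
  have "(coord_curve c \<gamma> has_derivative (\<lambda>h. h *\<^sub>R coord_velocity c \<gamma> t)) (at t)"
    using d unfolding coord_velocity_def vector_derivative_works has_vector_derivative_def .
  note D = has_derivative_compose[OF this has_derivative_pd[OF transition_differentiable[OF c o]]]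
  have "(coord_curve c' \<gamma> has_derivative
      (\<lambda>h. pd (h *\<^sub>R coord_velocity c \<gamma> t) (transition c c') (coord_curve c \<gamma> t))) (at t)"
  proof (rule has_derivative_transform_within_open[OF D])
    show "open {t \<in> I. \<gamma> t \<in> fst c}" by (rule open_curve_preimage[OF I open_chart[OF c(1)]])
    show "transition c c' (coord_curve c \<gamma> r) = coord_curve c' \<gamma> r" if "r \<in> {t \<in> I. \<gamma> t \<in> fst c}" for r
      using that by (simp add: coord_curve_def transition_def chart_inv_chart[OF c(1)])
  qed (use t in auto)
  then show ?thesis
    unfolding has_vector_derivative_def linear_scale[OF linear_pd[OF transition_differentiable[OF c o]]] .
qed

lemma point_of_velocity:
  assumes I: "open I" "continuous_on I \<gamma>" and c: "c \<in> \<A>"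
    and t: "t \<in> I" "\<gamma> t \<in> fst c" and d: "coord_curve c \<gamma> differentiable at t"
  shows "point_of \<A> c (coord_curve c \<gamma> t) (coord_velocity c \<gamma> t) = (\<gamma> t, velocity \<A> \<gamma> t)"
proof -
  have inv: "chart_inv c (coord_curve c \<gamma> t) = \<gamma> t"
    using chart_inv_chart[OF c t(2)] by (simp add: coord_curve_def)
  have "tangent_of \<A> c (coord_curve c \<gamma> t) (coord_velocity c \<gamma> t) c' = velocity \<A> \<gamma> t c'" for c'
  proof (cases "c' \<in> \<A> \<and> \<gamma> t \<in> fst c'")
    case True
    then show ?thesis
      using vector_derivative_at[OF coord_curve_change[OF I c _ t _ d]]
      by (simp add: tangent_of_def chart_inv_chart[OF c t(2)] velocity_def pd_def coord_curve_def)
  next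
    case False
    then show ?thesis by (auto simp: tangent_of_def inv velocity_def)
  qed
  then show ?thesis by (simp add: point_of_def inv fun_eq_iff)
qed

lemma curve_in_loc_dom:
  assumes "open I" "regular_curve \<A> D I \<gamma>" "c \<in> \<A>" "t \<in> I" "\<gamma> t \<in> fst c"
  shows "(coord_curve c \<gamma> t, coord_velocity c \<gamma> t) \<in> loc_dom \<A> c D"
proof -
  have "continuous_on I \<gamma>" "coord_curve c \<gamma> differentiable at t" "(\<gamma> t, velocity \<A> \<gamma> t) \<in> D"
    using assms by (auto simp: regular_curve_def twice_differentiable_at_def)
  with point_of_velocity[OF assms(1) this(1) assms(3,4,5) this(2)] assms(5) show ?thesis
    by (simp add: loc_dom_def coord_curve_def chart_in_range)
qed

lemma coord_velocity_change:
  assumes I: "open I" "continuous_on I \<gamma>" and c: "c \<in> \<A>" "c' \<in> \<A>"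
    and t: "t \<in> I" "\<gamma> t \<in> fst c" "\<gamma> t \<in> fst c'"
    and d: "\<And>r. r \<in> I \<Longrightarrow> \<gamma> r \<in> fst c \<Longrightarrow> coord_curve c \<gamma> differentiable at r"
    and d2: "coord_velocity c \<gamma> differentiable at t"
  shows "(coord_velocity c' \<gamma> has_vector_derivative
      second_prolong (transition c c') (coord_curve c \<gamma> t, coord_velocity c \<gamma> t)
        (coord_velocity c \<gamma> t, vector_derivative (coord_velocity c \<gamma>) (at t))) (at t)"
proof -
  let ?x = "coord_curve c \<gamma>" and ?y = "coord_velocity c \<gamma>" and ?\<tau> = "transition c c'"
  let ?z = "vector_derivative ?y (at t)"
  have o: "?x t \<in> overlap c c'" using t by (auto simp: overlap_def coord_curve_def)
  have x: "(?x has_derivative (\<lambda>h. h *\<^sub>R ?y t)) (at t)"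
    using d[OF t(1,2)] unfolding coord_velocity_def vector_derivative_works has_vector_derivative_def .
  have y: "(?y has_derivative (\<lambda>h. h *\<^sub>R ?z)) (at t)"
    using d2 unfolding vector_derivative_works has_vector_derivative_def .
  have P: "(prolong ?\<tau> has_derivative (\<lambda>w. (pd (fst w) ?\<tau> (fst (?x t, ?y t)), second_prolong ?\<tau> (?x t, ?y t) w)))
      (at (?x t, ?y t))"
    by (rule prolong_has_derivative[OF open_overlap[OF c] smooth_transition[OF c]]) (use o in simp)
  have lin: "linear (second_prolong ?\<tau> (?x t, ?y t))"
    using has_derivative_linear[OF has_derivative_snd[OF P]] by (simp add: eta_contract_eq)
  have D: "((\<lambda>r. snd (prolong ?\<tau> (?x r, ?y r))) has_derivative
      (\<lambda>h. second_prolong ?\<tau> (?x t, ?y t) (h *\<^sub>R ?y t, h *\<^sub>R ?z))) (at t)"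
    using has_derivative_snd[OF has_derivative_compose[OF has_derivative_Pair[OF x y] P]] by simp
  have "(coord_velocity c' \<gamma> has_derivative
      (\<lambda>h. second_prolong ?\<tau> (?x t, ?y t) (h *\<^sub>R ?y t, h *\<^sub>R ?z))) (at t)"
  proof (rule has_derivative_transform_within_open[OF D])
    show "open {t \<in> I. \<gamma> t \<in> fst c \<inter> fst c'}"
      by (rule open_curve_preimage[OF I open_Int[OF open_chart[OF c(1)] open_chart[OF c(2)]]])
    show "snd (prolong ?\<tau> (?x r, ?y r)) = coord_velocity c' \<gamma> r" if "r \<in> {t \<in> I. \<gamma> t \<in> fst c \<inter> fst c'}" for r
      using that vector_derivative_at[OF coord_curve_change[OF I c _ _ _ d]]
      by (simp add: prolong_def coord_velocity_def)
  qed (use t in auto)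
  moreover have "second_prolong ?\<tau> (?x t, ?y t) (h *\<^sub>R ?y t, h *\<^sub>R ?z)
      = h *\<^sub>R second_prolong ?\<tau> (?x t, ?y t) (?y t, ?z)" for h
    using linear_scale[OF lin, of h "(?y t, ?z)"] by simp
  ultimately show ?thesis by (simp add: has_vector_derivative_def)
qed

lemma euler_lagrange_chart_change:
  assumes F: "finsler_metric \<A> D L" and c: "c \<in> \<A>" "c' \<in> \<A>"
    and p: "(x, y) \<in> loc_dom \<A> c D" "x \<in> overlap c c'"
  shows "euler_lagrange i (uncurry2 (loc \<A> c L)) (x, y) z
    = (\<Sum>k\<in>UNIV. pd (axis i 1) (transition c c') x $ k
        * euler_lagrange k (uncurry2 (loc \<A> c' L)) (prolong (transition c c') (x, y))
            (second_prolong (transition c c') (x, y) (y, z)))"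
proof -
  interpret c: finsler_domain "loc_dom \<A> c D" "loc \<A> c L" by (rule finsler_domain_chart[OF F c(1)])
  interpret c': finsler_domain "loc_dom \<A> c' D" "loc \<A> c' L" by (rule finsler_domain_chart[OF F c(2)])
  show ?thesis
    by (rule euler_lagrange_covariant[OF open_overlap[OF c] smooth_transition[OF c] c.open_U c'.open_U
          c.smooth_l c'.smooth_l prolong_loc_dom(1)[OF c] prolong_loc_dom(2)[OF c, symmetric] p])
qed

text \<open>Covariance is used for the transition back from \<open>c'\<close> to \<open>c\<close>: it expresses the Euler-Lagrange
  expressions in \<open>c'\<close> by those in \<open>c\<close>, and no Jacobian has to be inverted.\<close>

lemma extremal_at_chart_change:
  assumes F: "finsler_metric \<A> D L" and I: "open I" and \<gamma>: "regular_curve \<A> D I \<gamma>"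
    and c: "c \<in> \<A>" "c' \<in> \<A>" and t: "t \<in> I" "\<gamma> t \<in> fst c" "\<gamma> t \<in> fst c'"
    and e: "extremal_at \<A> L c \<gamma> t"
  shows "extremal_at \<A> L c' \<gamma> t"
proof -
  let ?x = "coord_curve c' \<gamma> t" and ?y = "coord_velocity c' \<gamma> t" and ?\<tau> = "transition c' c"
  have \<gamma>': "continuous_on I \<gamma>"
    "\<And>r. r \<in> I \<Longrightarrow> \<gamma> r \<in> fst c' \<Longrightarrow> coord_curve c' \<gamma> differentiable at r"
    "coord_velocity c' \<gamma> differentiable at t"
    using \<gamma> c t by (auto simp: regular_curve_def twice_differentiable_at_def)
  have o: "?x \<in> overlap c' c" using t by (auto simp: overlap_def coord_curve_def)
  have x: "coord_curve c \<gamma> t = ?\<tau> ?x"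
    using t by (simp add: coord_curve_def transition_def chart_inv_chart[OF c(2)])
  have y: "coord_velocity c \<gamma> t = pd ?y ?\<tau> ?x"
    using vector_derivative_at[OF coord_curve_change[OF I \<gamma>'(1) c(2,1) t(1,3,2) \<gamma>'(2)[OF t(1,3)]]]
    by (simp add: coord_velocity_def)
  have z: "vector_derivative (coord_velocity c \<gamma>) (at t) = second_prolong ?\<tau> (?x, ?y) (?y, vector_derivative (coord_velocity c' \<gamma>) (at t))"
    by (rule vector_derivative_at[OF coord_velocity_change[OF I \<gamma>'(1) c(2,1) t(1,3,2) \<gamma>'(2,3)]])
  have "euler_lagrange k (uncurry2 (loc \<A> c L)) (prolong ?\<tau> (?x, ?y))
      (second_prolong ?\<tau> (?x, ?y) (?y, vector_derivative (coord_velocity c' \<gamma>) (at t))) = 0" for k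
    using e unfolding extremal_at_def x y z by (simp add: prolong_def)
  then show ?thesis
    unfolding extremal_at_def
    using euler_lagrange_chart_change[OF F c(2,1) curve_in_loc_dom[OF I \<gamma> c(2) t(1,3)] o] by simp
qed

text \<open>A geodesic carries one function \<open>w\<close> for all charts. It is recovered from the chartwise
  Euler-Lagrange equations as the logarithmic derivative of \<open>t \<mapsto> L (\<gamma> t, velocity \<gamma> t)\<close>, whose
  definition refers to no chart.\<close>

lemma geodesic_iff_extremal:
  assumes F: "finsler_metric \<A> D L" and I: "open I"
  shows "geodesic \<A> D L I \<gamma> \<longleftrightarrow> regular_curve \<A> D I \<gamma> \<and>
    (\<forall>c\<in>\<A>. \<forall>t\<in>I. \<gamma> t \<in> fst c \<longrightarrow> extremal_at \<A> L c \<gamma> t)"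
proof -
  let ?y = "\<lambda>c. coord_velocity c \<gamma>" and ?x = "\<lambda>c. coord_curve c \<gamma>"
  let ?z = "\<lambda>c t. vector_derivative (?y c) (at t)"
  let ?eq = "\<lambda>w c t. \<forall>i. ?z c t $ i + 2 * spray (loc \<A> c L) i (?x c t) (?y c t) = w t * ?y c t $ i"
  have G: "geodesic \<A> D L I \<gamma> \<longleftrightarrow> regular_curve \<A> D I \<gamma> \<and>
      (\<exists>w. \<forall>c\<in>\<A>. \<forall>t\<in>I. \<gamma> t \<in> fst c \<longrightarrow> ?eq w c t)"
    unfolding geodesic_def regular_curve_def twice_differentiable_at_def Let_def
      coord_velocity_def[abs_def] coord_curve_def
    by blast
  have iff: "?eq w c t \<longleftrightarrow> extremal_at \<A> L c \<gamma> t \<and>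
      w t * uncurry2 (loc \<A> c L) (?x c t, ?y c t)
        = pd (?y c t, ?z c t) (uncurry2 (loc \<A> c L)) (?x c t, ?y c t)"
    if \<gamma>: "regular_curve \<A> D I \<gamma>" and c: "c \<in> \<A>" and t: "t \<in> I" "\<gamma> t \<in> fst c" for w c t
  proof -
    interpret finsler_domain "loc_dom \<A> c D" "loc \<A> c L" by (rule finsler_domain_chart[OF F c])
    show ?thesis
      unfolding extremal_at_def by (rule geodesic_equation_iff[OF curve_in_loc_dom[OF I \<gamma> c t]])
  qed
  define w where "w t = deriv (\<lambda>r. L (\<gamma> r, velocity \<A> \<gamma> r)) t / L (\<gamma> t, velocity \<A> \<gamma> t)" for t
  have w: "w t * uncurry2 (loc \<A> c L) (?x c t, ?y c t)
      = pd (?y c t, ?z c t) (uncurry2 (loc \<A> c L)) (?x c t, ?y c t)"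
    if \<gamma>: "regular_curve \<A> D I \<gamma>" and c: "c \<in> \<A>" and t: "t \<in> I" "\<gamma> t \<in> fst c" for c t
  proof -
    interpret finsler_domain "loc_dom \<A> c D" "loc \<A> c L" by (rule finsler_domain_chart[OF F c])
    have \<gamma>': "continuous_on I \<gamma>"
      "\<And>r. r \<in> I \<Longrightarrow> \<gamma> r \<in> fst c \<Longrightarrow> ?x c differentiable at r" "?y c differentiable at t"
      using \<gamma> c t by (auto simp: regular_curve_def twice_differentiable_at_def)
    have pos: "0 < L (\<gamma> r, velocity \<A> \<gamma> r)" if "r \<in> I" for r
      using F \<gamma> that by (auto simp: finsler_metric_def regular_curve_def)
    have eq: "l (?x c r, ?y c r) = L (\<gamma> r, velocity \<A> \<gamma> r)" if "r \<in> I" "\<gamma> r \<in> fst c" for r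
      using point_of_velocity[OF I \<gamma>'(1) c that \<gamma>'(2)[OF that]] by (simp add: loc_def)
    have x: "(?x c has_derivative (\<lambda>h. h *\<^sub>R ?y c t)) (at t)"
      using \<gamma>'(2)[OF t] unfolding coord_velocity_def vector_derivative_works has_vector_derivative_def .
    have y: "(?y c has_derivative (\<lambda>h. h *\<^sub>R ?z c t)) (at t)"
      using \<gamma>'(3) unfolding vector_derivative_works has_vector_derivative_def .
    have dl: "l differentiable at (?x c t, ?y c t)"
      by (rule smooth_on_differentiable[OF smooth_l curve_in_loc_dom[OF I \<gamma> c t]])
    have D: "((\<lambda>r. L (\<gamma> r, velocity \<A> \<gamma> r)) has_derivative
        (\<lambda>h. pd (h *\<^sub>R ?y c t, h *\<^sub>R ?z c t) l (?x c t, ?y c t))) (at t)"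
      by (rule has_derivative_transform_within_open[OF
            has_derivative_compose[OF has_derivative_Pair[OF x y] has_derivative_pd[OF dl]]
            open_curve_preimage[OF I \<gamma>'(1) open_chart[OF c]]])
         (use t eq in auto)
    have "pd (h *\<^sub>R ?y c t, h *\<^sub>R ?z c t) l (?x c t, ?y c t) = pd (?y c t, ?z c t) l (?x c t, ?y c t) * h" for h
      using linear_scale[OF linear_pd[OF dl], of h "(?y c t, ?z c t)"] by (simp add: mult.commute)
    then have "deriv (\<lambda>r. L (\<gamma> r, velocity \<A> \<gamma> r)) t = pd (?y c t, ?z c t) l (?x c t, ?y c t)"
      using D by (intro DERIV_imp_deriv) (simp add: has_field_derivative_def)
    then show ?thesis unfolding w_def eq[OF t] using pos[OF t(1)] by simp
  qed
  show ?thesis unfolding G using iff w by (metis (no_types, lifting))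
qed

end

section \<open>Geodesics with prescribed initial velocity\<close>
context finsler_domain
begin

text \<open>The first order system \<open>x' = y\<close>, \<open>y' = -2 G(x, y)\<close> has a locally Lipschitz right-hand side
  because the spray is smooth.\<close>

lemma geodesic_flow_exists:
  assumes "(x0, y0) \<in> U"
  obtains h x y where "h > 0" "x 0 = x0" "y 0 = y0"
    "\<And>t. \<bar>t\<bar> < h \<Longrightarrow> (x t, y t) \<in> U"
    "\<And>t. \<bar>t\<bar> < h \<Longrightarrow> (x has_vector_derivative y t) (at t)"
    "\<And>t. \<bar>t\<bar> < h \<Longrightarrow> (y has_vector_derivative - 2 *\<^sub>R (\<chi> i. spray L i (x t) (y t))) (at t)"
proof -
  define F where "F p = (snd p, - 2 *\<^sub>R (\<chi> i. spray L i (fst p) (snd p)))" for p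
  obtain r where r: "r > 0" "cball (x0, y0) r \<subseteq> U"
    using open_U assms open_contains_cball by blast
  have "\<exists>K. K-lipschitz_on (cball (x0, y0) r) (\<lambda>p. F p \<bullet> v)" for v
  proof -
    have eq: "F p \<bullet> v = (\<Sum>i\<in>UNIV. fst v $ i * (snd p $ i)) + (\<Sum>i\<in>UNIV. (- 2 * snd v $ i) * uncurry2 (spray L i) p)" for p
      by (simp add: F_def inner_prod_def inner_vec_def uncurry2_def sum_negf sum_distrib_left mult_ac)
    have "smooth_on U (\<lambda>p. F p \<bullet> v)"
      unfolding eq
      by (intro smooth_on_add smooth_on_sum smooth_on_mult smooth_on_const smooth_on_coord smooth_spray open_U)
    then show ?thesis using smooth_on_lipschitz_cball[OF _ r(2)] by metis
  qed
  then obtain K where K: "\<And>v. (K v)-lipschitz_on (cball (x0, y0) r) (\<lambda>p. F p \<bullet> v)" by metis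
  define M where "M = (\<Sum>v\<in>Basis. K v)"
  have "M-lipschitz_on (cball (x0, y0) r) (\<lambda>p. F p \<bullet> v)" if "v \<in> Basis" for v
  proof (rule lipschitz_on_mono[OF K order_refl])
    show "K v \<le> M" unfolding M_def
      by (rule member_le_sum[OF that]) (use lipschitz_on_nonneg[OF K] in auto)
  qed
  from lipschitz_on_componentwise[OF this]
  obtain h z where z: "h > 0" "z 0 = (x0, y0)" "\<And>t. \<bar>t\<bar> < h \<Longrightarrow> z t \<in> cball (x0, y0) r"
    "\<And>t. \<bar>t\<bar> < h \<Longrightarrow> (z has_vector_derivative F (z t)) (at t)"
    using ode_solution_exists[OF r(1)] by metis
  show ?thesis
  proof (rule that[of h "\<lambda>t. fst (z t)" "\<lambda>t. snd (z t)"])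
    fix t assume t: "\<bar>t\<bar> < h"
    show "(fst (z t), snd (z t)) \<in> U" using z(3)[OF t] r(2) by auto
    have d: "(z has_derivative (\<lambda>h. h *\<^sub>R F (z t))) (at t)"
      using z(4)[OF t] by (simp add: has_vector_derivative_def)
    show "((\<lambda>t. fst (z t)) has_vector_derivative snd (z t)) (at t)"
      using has_derivative_fst[OF d] by (simp add: has_vector_derivative_def F_def)
    show "((\<lambda>t. snd (z t)) has_vector_derivative - 2 *\<^sub>R (\<chi> i. spray L i (fst (z t)) (snd (z t)))) (at t)"
      using has_derivative_snd[OF d] by (simp add: has_vector_derivative_def F_def)
  qed (use z in auto)
qed

text \<open>The accelerations that solve the Euler-Lagrange equations of a Finsler function at \<open>(x, y)\<close> are
  \<open>-2 G + w y\<close> for arbitrary \<open>w\<close>, a line parallel to \<open>y\<close>. If the lines of two Finsler functions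
  have one point in common, they are equal.\<close>

lemma extremal_directions_agree:
  assumes L': "finsler_domain U L'" and p: "(x, y) \<in> U"
    and spray: "\<And>i. euler_lagrange i (uncurry2 L') (x, y) (- 2 *\<^sub>R (\<chi> i. spray L i x y)) = 0"
  shows "(\<forall>i. euler_lagrange i l (x, y) z = 0) \<longleftrightarrow> (\<forall>i. euler_lagrange i (uncurry2 L') (x, y) z = 0)"
proof -
  interpret L': finsler_domain U L' by (rule L')
  let ?z = "- 2 *\<^sub>R (\<chi> i. spray L i x y)"
  have pos: "l (x, y) \<noteq> 0" "L'.l (x, y) \<noteq> 0" using L_pos[OF p] L'.L_pos[OF p] by auto
  have spray_L: "\<forall>i. euler_lagrange i l (x, y) ?z = 0"
    using geodesic_equation_iff[OF p, of ?z 0] by simp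
  show ?thesis
  proof
    assume E: "\<forall>i. euler_lagrange i l (x, y) z = 0"
    define w where "w = pd (y, z) l (x, y) / l (x, y)"
    have "z $ i + 2 * spray L i x y = w * y $ i" for i
      using geodesic_equation_iff[OF p, of z w] E pos by (simp add: w_def)
    then have z: "z = ?z + w *\<^sub>R y" by (simp add: vec_eq_iff algebra_simps)
    show "\<forall>i. euler_lagrange i (uncurry2 L') (x, y) z = 0"
      unfolding z L'.euler_lagrange_add_velocity[OF p] using spray by blast
  next
    assume E: "\<forall>i. euler_lagrange i (uncurry2 L') (x, y) z = 0"
    define w where "w u = pd (y, u) L'.l (x, y) / L'.l (x, y)" for u
    have 1: "z $ i + 2 * spray L' i x y = w z * y $ i" for i
      using L'.geodesic_equation_iff[OF p, of z "w z"] E pos by (simp add: w_def)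
    have 2: "?z $ i + 2 * spray L' i x y = w ?z * y $ i" for i
      using L'.geodesic_equation_iff[OF p, of ?z "w ?z"] spray pos unfolding w_def by simp
    define v where "v = w z - w ?z"
    have z: "z = ?z + v *\<^sub>R y"
    proof (rule vec_eq_iff[THEN iffD2], rule allI)
      fix i
      have "z $ i - ?z $ i = v * y $ i"
        using 1[of i] 2[of i] unfolding v_def left_diff_distrib by linarith
      then show "z $ i = (?z + v *\<^sub>R y) $ i" by simp
    qed
    show "\<forall>i. euler_lagrange i l (x, y) z = 0"
      unfolding z euler_lagrange_add_velocity[OF p] by (rule spray_L)
  qed
qed

lemma continuous_on_euler_lagrange_spray:
  assumes L': "smooth_on U (uncurry2 L')"
  shows "continuous_on U (\<lambda>p. euler_lagrange i (uncurry2 L') p (- 2 *\<^sub>R (\<chi> i. spray L i (fst p) (snd p))))"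
proof -
  let ?l = "uncurry2 L'"
  let ?E = "\<lambda>p. pd (ax i) ?l p - ((\<Sum>j\<in>UNIV. snd p $ j * pd (ax j) (pd (ay i) ?l) p)
    + (\<Sum>j\<in>UNIV. (- 2 * uncurry2 (spray L j) p) * pd (ay j) (pd (ay i) ?l) p))"
  have "smooth_on U ?E"
    by (intro smooth_on_diff smooth_on_add smooth_on_sum smooth_on_mult smooth_on_const smooth_on_coord
        smooth_spray smooth_on_pd L' open_U)
  moreover have "?E p = euler_lagrange i ?l p (- 2 *\<^sub>R (\<chi> i. spray L i (fst p) (snd p)))" if "p \<in> U" for p
    unfolding euler_lagrange_def
    by (subst pd_Pair_expand[OF smooth_on_differentiable[OF smooth_on_pd[OF L'] that]])
       (simp add: uncurry2_def)
  ultimately show ?thesis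
    using smooth_on_continuous_on continuous_on_cong by (metis (no_types, lifting))
qed

end

context smooth_manifold
begin

text \<open>The flow in a single chart gives a curve; that it satisfies the geodesic equation in every other
  chart is the covariance of the Euler-Lagrange equations.\<close>

lemma geodesic_exists:
  assumes F: "finsler_metric \<A> D L" and c: "c \<in> \<A>" and p: "(x0, y0) \<in> loc_dom \<A> c D"
  obtains h \<gamma> where "h > 0" "geodesic \<A> D L {-h<..<h} \<gamma>" "\<gamma> 0 \<in> fst c"
    "coord_curve c \<gamma> 0 = x0" "coord_velocity c \<gamma> 0 = y0"
    "vector_derivative (coord_velocity c \<gamma>) (at 0) = - 2 *\<^sub>R (\<chi> i. spray (loc \<A> c L) i x0 y0)"
proof -
  interpret finsler_domain "loc_dom \<A> c D" "loc \<A> c L" by (rule finsler_domain_chart[OF F c])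
  obtain h x y where h: "h > 0" and x0: "x 0 = x0" "y 0 = y0"
    and U: "\<And>t. \<bar>t\<bar> < h \<Longrightarrow> (x t, y t) \<in> loc_dom \<A> c D"
    and x: "\<And>t. \<bar>t\<bar> < h \<Longrightarrow> (x has_vector_derivative y t) (at t)"
    and y: "\<And>t. \<bar>t\<bar> < h \<Longrightarrow> (y has_vector_derivative - 2 *\<^sub>R (\<chi> i. spray (loc \<A> c L) i (x t) (y t))) (at t)"
    by (rule geodesic_flow_exists[OF p]) blast
  define I where "I = {-h<..<h}"
  have tI: "\<bar>t\<bar> < h" if "t \<in> I" for t using that by (auto simp: I_def)
  have I: "open I" "0 \<in> I" using h by (auto simp: I_def)
  define \<gamma> where "\<gamma> t = chart_inv c (x t)" for t
  have range: "x t \<in> chart_range c" if "t \<in> I" for t using U[OF tI[OF that]] by (simp add: loc_dom_def)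
  have \<gamma>c: "\<gamma> t \<in> fst c" if "t \<in> I" for t
    unfolding \<gamma>_def by (rule chart_inv_in[OF c range[OF that]])
  have cc: "coord_curve c \<gamma> t = x t" if "t \<in> I" for t
    unfolding coord_curve_def \<gamma>_def o_def by (rule chart_chart_inv[OF c range[OF that]])
  have dx: "(coord_curve c \<gamma> has_vector_derivative y t) (at t)" if "t \<in> I" for t
    by (rule has_vector_derivative_transform_within_open[OF x[OF tI[OF that]] I(1) that cc[symmetric]])
  have cv: "coord_velocity c \<gamma> t = y t" if "t \<in> I" for t
    unfolding coord_velocity_def by (rule vector_derivative_at[OF dx[OF that]])
  have dv: "(coord_velocity c \<gamma> has_vector_derivative - 2 *\<^sub>R (\<chi> i. spray (loc \<A> c L) i (x t) (y t))) (at t)"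
    if "t \<in> I" for t
    by (rule has_vector_derivative_transform_within_open[OF y[OF tI[OF that]] I(1) that cv[symmetric]])
  have cont: "continuous_on I \<gamma>"
  proof -
    have "continuous_on I x"
      by (rule continuous_at_imp_continuous_on) (use has_vector_derivative_continuous[OF x] tI in blast)
    then show ?thesis
      unfolding \<gamma>_def[abs_def]
      using continuous_on_compose2[OF homeomorphism_cont2[OF chart_homeomorphism[OF c]]] range by blast
  qed
  have d1: "coord_curve c \<gamma> differentiable at t" "coord_velocity c \<gamma> differentiable at t" if "t \<in> I" for t
    using dx[OF that] dv[OF that] by (auto intro: differentiableI_vector)
  have twice: "twice_differentiable_at c' \<gamma> t" if "c' \<in> \<A>" "t \<in> I" "\<gamma> t \<in> fst c'" for c' t
    unfolding twice_differentiable_at_def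
    using coord_curve_change[OF I(1) cont c that(1,2) \<gamma>c[OF that(2)] that(3) d1(1)[OF that(2)]]
      coord_velocity_change[OF I(1) cont c that(1,2) \<gamma>c[OF that(2)] that(3) d1(1) d1(2)[OF that(2)]]
    by (auto intro: differentiableI_vector)
  have inD: "(\<gamma> t, velocity \<A> \<gamma> t) \<in> D" if "t \<in> I" for t
    using point_of_velocity[OF I(1) cont c that \<gamma>c[OF that] d1(1)[OF that]] U[OF tI[OF that]]
    by (simp add: cc[OF that] cv[OF that] loc_dom_def)
  have reg: "regular_curve \<A> D I \<gamma>"
    unfolding regular_curve_def manifold_def using cont twice inD \<gamma>c c by auto
  have e: "extremal_at \<A> (L) c \<gamma> t" if "t \<in> I" for t
    unfolding extremal_at_def cc[OF that] cv[OF that] vector_derivative_at[OF dv[OF that]]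
    using geodesic_equation_iff[OF U[OF tI[OF that]], of "- 2 *\<^sub>R (\<chi> i. spray (loc \<A> c L) i (x t) (y t))" 0]
    by simp
  have "geodesic \<A> D L I \<gamma>"
    unfolding geodesic_iff_extremal[OF F I(1)]
    using reg e extremal_at_chart_change[OF F I(1) reg c _ _ \<gamma>c] by blast
  then show ?thesis
    using that[of h \<gamma>] h \<gamma>c[OF I(2)] cc[OF I(2)] cv[OF I(2)] vector_derivative_at[OF dv[OF I(2)]] x0
    unfolding I_def by simp
qed

lemma form_covec:
  assumes "smooth_one_form \<A> \<beta>" "c \<in> \<A>" "x \<in> chart_range c"
  shows "form (covec \<A> c \<beta>) x y = loc \<A> c \<beta> x y"
proof -
  have lin: "linear (loc \<A> c \<beta> x)" using assms by (simp add: smooth_one_form_def)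
  have "loc \<A> c \<beta> x y = loc \<A> c \<beta> x (\<Sum>j\<in>UNIV. y $ j *\<^sub>R axis j 1)"
    by (simp flip: vec_eq_sum_axis)
  also have "\<dots> = (\<Sum>j\<in>UNIV. y $ j *\<^sub>R loc \<A> c \<beta> x (axis j 1))"
    unfolding linear_sum[OF lin, of "\<lambda>j. y $ j *\<^sub>R axis j 1" UNIV] linear_scale[OF lin] ..
  finally show ?thesis by (simp add: form_def covec_def mult.commute)
qed

end

section \<open>The projectivity criterion\<close>

lemma vanishes_on_closure:
  fixes K :: "'a::topological_space \<Rightarrow> real"
  assumes U: "open U" "continuous_on U K" and T: "U \<subseteq> closure T" "\<And>q. q \<in> T \<Longrightarrow> q \<in> U \<Longrightarrow> K q = 0"
    and p: "p \<in> U"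
  shows "K p = 0"
proof (rule ccontr)
  assume "K p \<noteq> 0"
  have "open (K -` (- {0}) \<inter> U)"
    using continuous_on_open_vimage[OF U(1)] U(2) by blast
  moreover have "p \<in> K -` (- {0}) \<inter> U" using p \<open>K p \<noteq> 0\<close> by simp
  moreover have "p \<in> closure T" using p T(1) by blast
  ultimately have "T \<inter> (K -` (- {0}) \<inter> U) \<noteq> {}"
    using open_Int_closure_eq_empty[of "K -` (- {0}) \<inter> U" T] by blast
  then show False using T(2) by auto
qed

theorem theorem5p2:
  fixes \<A> :: "('m::{t2_space, second_countable_topology}, 'n::finite) chart set"
    and D P :: "('m \<times> ('m, 'n) tvec) set"
    and L \<beta> :: "'m \<times> ('m, 'n) tvec \<Rightarrow> real"
    and \<sigma> :: "'m \<Rightarrow> real"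
    and f :: "real \<times> real \<Rightarrow> real"
    and W :: "(real \<times> real) set"
  assumes atlas: "smooth_atlas \<A>"
    and finsler: "finsler_metric \<A> D L"
    and sigma: "smooth_scalar \<A> \<sigma>"
    and beta: "smooth_one_form \<A> \<beta>"
    and W_open: "open W"
    and W_conic: "\<And>u v r. (u, v) \<in> W \<Longrightarrow> 0 < r \<Longrightarrow> (r * u, r * v) \<in> W"
    and W_values: "\<And>p v. (p, v) \<in> D \<Longrightarrow> (exp (\<sigma> p) * L (p, v), \<beta> (p, v)) \<in> W"
    and f_smooth: "smooth_on W f"
    and f_homogeneous: "\<And>u v r. (u, v) \<in> W \<Longrightarrow> 0 < r \<Longrightarrow> f (r * u, r * v) = r * f (u, v)"
    and finsler_changed: "finsler_metric \<A> D (changed_metric \<sigma> \<beta> f L)"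
    and P_subset: "P \<subseteq> D"
    and P_dense: "\<And>c. c \<in> \<A> \<Longrightarrow> loc_dom \<A> c D \<subseteq> closure (loc_dom \<A> c P)"
    and standing: "\<And>c x y. c \<in> \<A> \<Longrightarrow> (x, y) \<in> loc_dom \<A> c P \<Longrightarrow>
        standing_assumptions f (loc \<A> c L) (\<sigma> \<circ> chart_inv c) (covec \<A> c \<beta>) x y"
  shows "projectively_related \<A> D L (changed_metric \<sigma> \<beta> f L) \<longleftrightarrow>
    (\<forall>c\<in>\<A>. \<forall>(x, y)\<in>loc_dom \<A> c P. \<forall>i.
       phi_low f (loc \<A> c L) (\<sigma> \<circ> chart_inv c) (covec \<A> c \<beta>) i x y = 0)"
proof -
  interpret smooth_manifold \<A> by unfold_locales (rule atlas)
  define L' where "L' = changed_metric \<sigma> \<beta> f L"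
  have F': "finsler_metric \<A> D L'" using finsler_changed by (simp add: L'_def)
  let ?phi = "\<lambda>c. phi_low f (loc \<A> c L) (\<sigma> \<circ> chart_inv c) (covec \<A> c \<beta>)"
  let ?S = "\<lambda>c x y. - 2 *\<^sub>R (\<chi> i. spray (loc \<A> c L) i x y)"
  have dom: "finsler_domain (loc_dom \<A> c D) (loc \<A> c L)" "finsler_domain (loc_dom \<A> c D) (loc \<A> c L')"
    if "c \<in> \<A>" for c
    using finsler_domain_chart[OF finsler that] finsler_domain_chart[OF F' that] by auto
  have phi: "?phi c i x y = loc \<A> c L' x y * euler_lagrange i (uncurry2 (loc \<A> c L')) (x, y) (?S c x y)"
    if c: "c \<in> \<A>" and p: "(x, y) \<in> loc_dom \<A> c D" for c x y i
  proof -
    interpret finsler_domain "loc_dom \<A> c D" "loc \<A> c L" by (rule dom(1)[OF c])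
    have arg: "f_arg (loc \<A> c L) (\<sigma> \<circ> chart_inv c) (covec \<A> c \<beta>) x y
        = (exp (\<sigma> (fst (point_of \<A> c x y))) * L (point_of \<A> c x y), \<beta> (point_of \<A> c x y))"
      if "(x, y) \<in> loc_dom \<A> c D" for x y
      using that form_covec[OF beta c, of x y] by (simp add: f_arg_def loc_dom_def loc_def point_of_def)
    interpret beta_conformal_change "loc_dom \<A> c D" "loc \<A> c L" "chart_range c" "\<sigma> \<circ> chart_inv c"
      "covec \<A> c \<beta>" f W "loc \<A> c L'"
    proof
      show "f_arg (loc \<A> c L) (\<sigma> \<circ> chart_inv c) (covec \<A> c \<beta>) x y \<in> W"
        "loc \<A> c L' x y = f (f_arg (loc \<A> c L) (\<sigma> \<circ> chart_inv c) (covec \<A> c \<beta>) x y)"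
        if "(x, y) \<in> loc_dom \<A> c D" for x y
        using that W_values[of "fst (point_of \<A> c x y)" "snd (point_of \<A> c x y)"]
        unfolding arg[OF that]
        by (auto simp: loc_dom_def loc_def L'_def changed_metric_def split: prod.splits)
      show "open (chart_range c)" by (rule open_chart_range[OF c])
      show "x \<in> chart_range c" if "(x, y) \<in> loc_dom \<A> c D" for x y
        using that by (simp add: loc_dom_def)
      show "smooth_on (chart_range c) (\<sigma> \<circ> chart_inv c)"
        using sigma c by (simp add: smooth_scalar_def)
      show "smooth_on (chart_range c) (covec \<A> c \<beta>)"
        using beta c by (simp add: smooth_one_form_def)
    qed (fact W_open f_smooth W_conic f_homogeneous)+
    show ?thesis by (rule phi_low_eq[OF p])
  qed
  have pos: "loc \<A> c L' x y > 0" if "c \<in> \<A>" "(x, y) \<in> loc_dom \<A> c D" for c x y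
    using finsler_domain.L_pos[OF dom(2)] that by blast
  have P_D: "loc_dom \<A> c P \<subseteq> loc_dom \<A> c D" for c using P_subset by (auto simp: loc_dom_def)
  show ?thesis
    unfolding L'_def[symmetric]
  proof
    assume proj: "projectively_related \<A> D L L'"
    show "\<forall>c\<in>\<A>. \<forall>(x, y)\<in>loc_dom \<A> c P. \<forall>i. ?phi c i x y = 0"
    proof (intro ballI allI, clarify)
      fix c x y i assume c: "(c :: ('m, 'n) chart) \<in> \<A>" and "(x, y) \<in> loc_dom \<A> c P"
      then have p: "(x, y) \<in> loc_dom \<A> c D" using P_D by blast
      obtain h \<gamma> where h: "h > 0" and g: "geodesic \<A> D L {-h<..<h} \<gamma>" "\<gamma> 0 \<in> fst c"
        "coord_curve c \<gamma> 0 = x" "coord_velocity c \<gamma> 0 = y"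
        "vector_derivative (coord_velocity c \<gamma>) (at 0) = ?S c x y"
        by (rule geodesic_exists[OF finsler c p])
      have "geodesic \<A> D L' {-h<..<h} \<gamma>"
        using proj g(1) unfolding projectively_related_def
        by (meson is_interval_oo open_greaterThanLessThan)
      then have "extremal_at \<A> L' c \<gamma> 0"
        using geodesic_iff_extremal[OF F' open_greaterThanLessThan] c g(2) h by simp
      then have "euler_lagrange i (uncurry2 (loc \<A> c L')) (x, y) (?S c x y) = 0"
        unfolding extremal_at_def g by blast
      then show "?phi c i x y = 0" unfolding phi[OF c p] by simp
    qed
  next
    assume zero: "\<forall>c\<in>\<A>. \<forall>(x, y)\<in>loc_dom \<A> c P. \<forall>i. ?phi c i x y = 0"
    have EL: "euler_lagrange i (uncurry2 (loc \<A> c L')) (x, y) (?S c x y) = 0"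
      if c: "c \<in> \<A>" and p: "(x, y) \<in> loc_dom \<A> c D" for c x y i
    proof -
      interpret A: finsler_domain "loc_dom \<A> c D" "loc \<A> c L" by (rule dom(1)[OF c])
      interpret B: finsler_domain "loc_dom \<A> c D" "loc \<A> c L'" by (rule dom(2)[OF c])
      let ?K = "\<lambda>p. euler_lagrange i (uncurry2 (loc \<A> c L')) p (?S c (fst p) (snd p))"
      have "?K (x, y) = 0"
      proof (rule vanishes_on_closure[OF A.open_U _ P_dense[OF c] _ p])
        show "continuous_on (loc_dom \<A> c D) ?K"
          by (rule A.continuous_on_euler_lagrange_spray[OF B.smooth_l])
        show "?K q = 0" if "q \<in> loc_dom \<A> c P" "q \<in> loc_dom \<A> c D" for q
        proof -
          obtain x y where q: "q = (x, y)" by (cases q)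
          have "?phi c i x y = 0" using zero c that(1) q by blast
          then show ?thesis using phi[OF c, of x y i] pos[OF c, of x y] that(2) q by simp
        qed
      qed
      then show ?thesis by simp
    qed
    have "extremal_at \<A> L c \<gamma> t \<longleftrightarrow> extremal_at \<A> L' c \<gamma> t"
      if "open I" "regular_curve \<A> D I \<gamma>" "c \<in> \<A>" "t \<in> I" "\<gamma> t \<in> fst c" for I \<gamma> c t
    proof -
      have p: "(coord_curve c \<gamma> t, coord_velocity c \<gamma> t) \<in> loc_dom \<A> c D"
        by (rule curve_in_loc_dom[OF that])
      show ?thesis
        unfolding extremal_at_def
        by (rule finsler_domain.extremal_directions_agree[OF dom[OF that(3)] p EL[OF that(3) p]])
    qed
    note extremal_iff = this
    have "geodesic \<A> D L I \<gamma> \<longleftrightarrow> geodesic \<A> D L' I \<gamma>" if I: "open I" for I \<gamma>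
      unfolding geodesic_iff_extremal[OF finsler I] geodesic_iff_extremal[OF F' I]
      using extremal_iff[OF I] by blast
    then show "projectively_related \<A> D L L'"
      unfolding projectively_related_def by blast
  qed
qed

end
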